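(* Let $d\ge 2$ and $n\ge d+1$ be integers, let $\boldsymbol{\mu}_{\min}=(1,\dots,1,n-d+1)$ (with $d-1$ ones), and let $\mathcal{A}=(\alpha_1,\alpha_2)$ be a partition of $d+1$ with $1\le\alpha_1\le\alpha_2$. The subset $\mathcal{P}_{n,d,\mathcal{A}}^{\boldsymbol{\mu}_{\min}}\subseteq\mathcal{P}_{n,d}^{\boldsymbol{\mu}_{\min}}$ has the following properties: (1) $\mathcal{P}_{n,d,\mathcal{A}}^{\boldsymbol{\mu}_{\min}}$ is irreducible and is open in its Zariski closure in $\mathcal{P}_{n,d}^{\boldsymbol{\mu}_{\min}}$. (2) $\dim(\mathcal{P}_{n,d,\mathcal{A}}^{\boldsymbol{\mu}_{\min}})=d^2+d+2n-\max(0,\alpha_2-\alpha_1-1)$. (3) The Zariski closure $\overline{\mathcal{P}}_{n,d,\mathcal{A}}^{\boldsymbol{\mu}_{\min}}$ of $\mathcal{P}_{n,d,\mathcal{A}}^{\boldsymbol{\mu}_{\min}}$ in $\mathcal{P}_{n,d}^{\boldsymbol{\mu}_{\min}}$ satisfies $$\overline{\mathcal{P}}_{n,d,\mathcal{A}}^{\boldsymbol{\mu}_{\min}}=\bigcup_{\mathcal{A}'\le\mathcal{A}}\mathcal{P}_{n,d,\mathcal{A}'}^{\boldsymbol{\mu}_{\min}},$$ where the union is over $2$-part partitions $\mathcal{A}'$ of $d+1$ with $\mathcal{A}'\le\mathcal{A}$.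
   Context: $\mathsf{k}$ is an arbitrary infinite field, $R=\mathsf{k}[s,t]$ with the standard grading, and $R_n$ is the space of homogeneous polynomials of degree $n$. For linearly independent $a_0,\dots,a_d\in R_n$ with $I=\langle a_0,\dots,a_d\rangle\subseteq R$, there is a graded exact sequence $0\to\bigoplus_{i=1}^d R(-n-\mu_i)\to R(-n)^{d+1}\xrightarrow{(a_0,\dots,a_d)} I\to 0$ with uniquely determined integers $1\le\mu_1\le\cdots\le\mu_d$; the tuple $(\mu_1,\dots,\mu_d)$ is called the $\boldsymbol{\mu}$-type of $(a_0,\dots,a_d)$ and of $I$; one has $\mu_1+\cdots+\mu_d=n-\deg\gcd(a_0,\dots,a_d)$. $\mathcal{P}_{n,d}^{\boldsymbol{\mu}_{\min}}\subseteq R_n^{d+1}$ is the set of linearly independent, relatively prime $(a_0,\dots,a_d)$ of $\boldsymbol{\mu}$-type $\boldsymbol{\mu}_{\min}$, with the Zariski topology induced from $R_n^{d+1}$. The ancestor ideal of $I$ is the largest homogeneous ideal of $R$ that equals $I$ in all degrees $\ge n$. It is known that if $I$ has $\boldsymbol{\mu}$-type $\boldsymbol{\mu}_{\min}$ and $n\ge d+1$, then the ancestor ideal equals $\langle h_1,h_2\rangle$ with $h_1,h_2$ relatively prime homogeneous and $I_n=R_{n-\deg(h_1)}\cdot h_1\oplus R_{n-\deg(h_2)}\cdot h_2$. Ordering so that $\deg(h_1)\ge\deg(h_2)$ and setting $\alpha_i=n+1-\deg(h_i)\ge1$ gives a partition $\mathcal{A}=(\alpha_1,\alpha_2)$ of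 $d+1$ with $\alpha_1\le\alpha_2$, called the partition given by the ancestor ideal. $\mathcal{P}_{n,d,\mathcal{A}}^{\boldsymbol{\mu}_{\min}}$ is the set of all tuples in $\mathcal{P}_{n,d}^{\boldsymbol{\mu}_{\min}}$ whose ancestor ideal gives the partition $\mathcal{A}$. A $2$-part partition of $d+1$ is $(\alpha_1,\alpha_2)$ with integers $1\le\alpha_1\le\alpha_2$ and $\alpha_1+\alpha_2=d+1$; $(\alpha_1',\alpha_2')\le(\alpha_1,\alpha_2)$ means $\alpha_1'\le\alpha_1$ and $\alpha_1'+\alpha_2'\le\alpha_1+\alpha_2$. *)

theory Defs
  imports
    "HOL-Analysis.Abstract_Topology"
    "HOL-Computational_Algebra.Polynomial"
    "HOL-Library.FuncSet"
    "HOL-Library.Extended_Nat"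
begin

section \<open>Irreducibility and Krull dimension of topological spaces\<close>

definition irreducible_space :: "'a topology \<Rightarrow> bool" where
  "irreducible_space X \<longleftrightarrow> topspace X \<noteq> {} \<and>
     (\<forall>A B. closedin X A \<and> closedin X B \<and> A \<union> B = topspace X \<longrightarrow>
        A = topspace X \<or> B = topspace X)"

definition krull_dim :: "'a topology \<Rightarrow> enat" where
  "krull_dim X = Sup {enat m | m. \<exists>Z :: nat \<Rightarrow> 'a set.
     (\<forall>i\<le>m. closedin X (Z i) \<and> irreducible_space (subtopology X (Z i))) \<and>
     (\<forall>i<m. Z i \<subset> Z (Suc i))}"

section \<open>Binary forms and ideals of the polynomial ring in two variables\<close>

text \<open>The ring $R = k[s,t]$ is the type \<open>'k poly poly\<close>: the monomial $s^j t^i$ has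
  coefficient \<open>coeff (coeff p i) j\<close> in \<open>p\<close>.\<close>

definition forms :: "nat \<Rightarrow> 'k::field poly poly set" where
  "forms m = {p. \<forall>i j. coeff (coeff p i) j \<noteq> 0 \<longrightarrow> i + j = m}"

text \<open>A ring is a module over itself, and its submodules are its ideals.\<close>

lemma module_times: "module ((*) :: 'a::comm_ring_1 \<Rightarrow> 'a \<Rightarrow> 'a)"
  by unfold_locales (simp_all add: algebra_simps)

abbreviation ideal_gen :: "'a::comm_ring_1 set \<Rightarrow> 'a set" where
  "ideal_gen \<equiv> module.span (*)"

definition homogeneous_ideal :: "'k::field poly poly set \<Rightarrow> bool" where
  "homogeneous_ideal J \<longleftrightarrow> (\<exists>S. S \<subseteq> (\<Union>m. forms m) \<and> J = ideal_gen S)"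

definition ancestor_ideal :: "nat \<Rightarrow> 'k::field poly poly set \<Rightarrow> 'k poly poly set" where
  "ancestor_ideal n I =
     (GREATEST J. homogeneous_ideal J \<and> (\<forall>m\<ge>n. J \<inter> forms m = I \<inter> forms m))"

section \<open>The Zariski topology on tuples of forms\<close>

definition form_tuples :: "nat \<Rightarrow> nat \<Rightarrow> (nat \<Rightarrow> 'k::field poly poly) set" where
  "form_tuples n d = {..d} \<rightarrow>\<^sub>E forms n"

text \<open>The polynomial functions on $R_n^{d+1} \cong k^{(d+1)(n+1)}$; the coordinates are the
  coefficients of $s^{n-j} t^j$ in the components.\<close>

inductive_set polynomial_functions ::
  "nat \<Rightarrow> nat \<Rightarrow> ((nat \<Rightarrow> 'k::field poly poly) \<Rightarrow> 'k) set" for n d where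
  const: "(\<lambda>_. c) \<in> polynomial_functions n d"
| coord: "i \<le> d \<Longrightarrow> j \<le> n \<Longrightarrow> (\<lambda>a. coeff (coeff (a i) j) (n - j)) \<in> polynomial_functions n d"
| add: "f \<in> polynomial_functions n d \<Longrightarrow> g \<in> polynomial_functions n d \<Longrightarrow>
    (\<lambda>a. f a + g a) \<in> polynomial_functions n d"
| mult: "f \<in> polynomial_functions n d \<Longrightarrow> g \<in> polynomial_functions n d \<Longrightarrow>
    (\<lambda>a. f a * g a) \<in> polynomial_functions n d"

definition zero_locus :: "nat \<Rightarrow> nat \<Rightarrow> ((nat \<Rightarrow> 'k::field poly poly) \<Rightarrow> 'k) set \<Rightarrow>
    (nat \<Rightarrow> 'k poly poly) set" where
  "zero_locus n d F = {a \<in> form_tuples n d. \<forall>f\<in>F. f a = 0}"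

definition zariski :: "nat \<Rightarrow> nat \<Rightarrow> (nat \<Rightarrow> 'k::field poly poly) topology" where
  "zariski n d = topology (\<lambda>U. U \<subseteq> form_tuples n d \<and>
     (\<exists>F \<subseteq> polynomial_functions n d. form_tuples n d - U = zero_locus n d F))"

lemma istopology_zariski:
  "istopology (\<lambda>U :: (nat \<Rightarrow> 'k::field poly poly) set. U \<subseteq> form_tuples n d \<and>
     (\<exists>F \<subseteq> polynomial_functions n d. form_tuples n d - U = zero_locus n d F))"
  unfolding istopology_def
proof (intro conjI allI impI)
  fix S T :: "(nat \<Rightarrow> 'k poly poly) set"
  assume S: "S \<subseteq> form_tuples n d \<and>
      (\<exists>F \<subseteq> polynomial_functions n d. form_tuples n d - S = zero_locus n d F)"
    and T: "T \<subseteq> form_tuples n d \<and>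
      (\<exists>F \<subseteq> polynomial_functions n d. form_tuples n d - T = zero_locus n d F)"
  then show "S \<inter> T \<subseteq> form_tuples n d" by blast
  obtain F G where F: "F \<subseteq> polynomial_functions n d" "form_tuples n d - S = zero_locus n d F"
    and G: "G \<subseteq> polynomial_functions n d" "form_tuples n d - T = zero_locus n d G"
    using S T by blast
  define H where "H = {(\<lambda>a. f a * g a) | f g. f \<in> F \<and> g \<in> G}"
  have "H \<subseteq> polynomial_functions n d"
    using F(1) G(1) by (auto simp: H_def intro: polynomial_functions.mult)
  moreover have "zero_locus n d H = zero_locus n d F \<union> zero_locus n d G"
  proof (intro subset_antisym subsetI)
    fix a assume a: "a \<in> zero_locus n d H"
    show "a \<in> zero_locus n d F \<union> zero_locus n d G"
    proof (rule ccontr)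
      assume "a \<notin> zero_locus n d F \<union> zero_locus n d G"
      then obtain f g where fg: "f \<in> F" "g \<in> G" "f a \<noteq> 0" "g a \<noteq> 0"
        using a unfolding zero_locus_def by blast
      then have *: "(\<lambda>a. f a * g a) \<in> H" unfolding H_def by blast
      have "\<forall>h\<in>H. h a = 0" using a unfolding zero_locus_def by simp
      from bspec[OF this *] have "f a * g a = 0" .
      with fg show False by simp
    qed
  qed (auto simp: zero_locus_def H_def)
  moreover have "form_tuples n d - S \<inter> T = (form_tuples n d - S) \<union> (form_tuples n d - T)"
    by blast
  ultimately show "\<exists>F \<subseteq> polynomial_functions n d. form_tuples n d - S \<inter> T = zero_locus n d F"
    unfolding F(2) G(2) by (intro exI[of _ H]) simp
next
  fix K :: "(nat \<Rightarrow> 'k poly poly) set set"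
  assume K: "\<forall>U\<in>K. U \<subseteq> form_tuples n d \<and>
      (\<exists>F \<subseteq> polynomial_functions n d. form_tuples n d - U = zero_locus n d F)"
  then show "\<Union>K \<subseteq> form_tuples n d" by blast
  obtain F where F: "\<And>U. U \<in> K \<Longrightarrow> F U \<subseteq> polynomial_functions n d"
    "\<And>U. U \<in> K \<Longrightarrow> form_tuples n d - U = zero_locus n d (F U)"
    using K by metis
  have "form_tuples n d - \<Union>K = zero_locus n d (\<Union>(F ` K))"
  proof (intro set_eqI)
    fix a
    have "a \<in> U \<longleftrightarrow> a \<in> form_tuples n d \<and> (\<exists>f \<in> F U. f a \<noteq> 0)" if "U \<in> K" for U
    proof -
      have "U \<subseteq> form_tuples n d" using K that by simp
      moreover have "a \<in> form_tuples n d - U \<longleftrightarrow> a \<in> zero_locus n d (F U)"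
        by (simp only: F(2)[OF that])
      ultimately show ?thesis unfolding zero_locus_def by auto
    qed
    then show "a \<in> form_tuples n d - \<Union>K \<longleftrightarrow> a \<in> zero_locus n d (\<Union>(F ` K))"
      unfolding zero_locus_def by blast
  qed
  then show "\<exists>F \<subseteq> polynomial_functions n d. form_tuples n d - \<Union>K = zero_locus n d F"
    using F(1) by (intro exI[of _ "\<Union>(F ` K)"]) blast
qed

lemma openin_zariski:
  "openin (zariski n d) U \<longleftrightarrow> U \<subseteq> form_tuples n d \<and>
     (\<exists>F \<subseteq> polynomial_functions n d. form_tuples n d - U = zero_locus n d F)"
  unfolding zariski_def by (simp only: topology_inverse'[OF istopology_zariski])

lemma topspace_zariski [simp]:
  "topspace (zariski n d :: (nat \<Rightarrow> 'a::field poly poly) topology) = form_tuples n d"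
proof -
  have "form_tuples n d - form_tuples n d = zero_locus n d {\<lambda>_. 1 :: 'a}"
    by (simp add: zero_locus_def)
  then have "openin (zariski n d) (form_tuples n d :: (nat \<Rightarrow> 'a poly poly) set)"
    unfolding openin_zariski
    by (intro conjI subset_refl exI[of _ "{\<lambda>_. 1}"]) (simp add: polynomial_functions.const)
  moreover have "topspace (zariski n d :: (nat \<Rightarrow> 'a poly poly) topology) \<subseteq> form_tuples n d"
    using openin_topspace[of "zariski n d :: (nat \<Rightarrow> 'a poly poly) topology"]
    unfolding openin_zariski by (rule conjunct1)
  ultimately show ?thesis
    by (intro subset_antisym openin_subset)
qed

lemma closedin_zariski:
  fixes Z :: "(nat \<Rightarrow> 'a::field poly poly) set"
  shows "closedin (zariski n d) Z \<longleftrightarrow> (\<exists>F \<subseteq> polynomial_functions n d. Z = zero_locus n d F)"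
proof -
  have sub: "zero_locus n d F \<subseteq> form_tuples n d" for F :: "((nat \<Rightarrow> 'a poly poly) \<Rightarrow> 'a) set"
    by (simp add: zero_locus_def)
  show ?thesis
  proof (cases "Z \<subseteq> form_tuples n d")
    case True
    then have "form_tuples n d - (form_tuples n d - Z) = Z" by (simp add: double_diff)
    with True show ?thesis
      unfolding closedin_def openin_zariski topspace_zariski by simp
  next
    case False
    have "Z \<noteq> zero_locus n d F" for F
      using sub[of F] False by simp
    with False show ?thesis
      unfolding closedin_def openin_zariski topspace_zariski by simp
  qed
qed

section \<open>The \<open>\<mu>\<close>-type and the strata\<close>

definition lin_indep_tuple :: "nat \<Rightarrow> (nat \<Rightarrow> 'k::field poly poly) \<Rightarrow> bool" where
  "lin_indep_tuple d a \<longleftrightarrow>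
     (\<forall>c :: nat \<Rightarrow> 'k. (\<Sum>i\<le>d. smult [:c i:] (a i)) = 0 \<longrightarrow> (\<forall>i\<le>d. c i = 0))"

definition rel_prime_tuple :: "nat \<Rightarrow> (nat \<Rightarrow> 'k::field poly poly) \<Rightarrow> bool" where
  "rel_prime_tuple d a \<longleftrightarrow> (\<forall>g. (\<forall>i\<le>d. g dvd a i) \<longrightarrow> is_unit g)"

text \<open>A graded homomorphism $\bigoplus_{i=1}^d R(-n-\mu_i) \to R(-n)^{d+1}$ is a matrix whose
  \<open>i\<close>-th row \<open>p i\<close> consists of forms of degree $\mu_i$.  The last three clauses say that its
  composition with $(a_0,\dots,a_d)$ is zero, that its image is the whole kernel of
  $(a_0,\dots,a_d)$, and that it is injective.\<close>

definition has_mu_type :: "nat \<Rightarrow> (nat \<Rightarrow> 'k::field poly poly) \<Rightarrow> (nat \<Rightarrow> nat) \<Rightarrow> bool" where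
  "has_mu_type d a \<mu> \<longleftrightarrow>
     (\<forall>i\<in>{1..d}. 1 \<le> \<mu> i) \<and> mono_on {1..d} \<mu> \<and>
     (\<exists>p :: nat \<Rightarrow> nat \<Rightarrow> 'k poly poly.
        (\<forall>i\<in>{1..d}. \<forall>j\<le>d. p i j \<in> forms (\<mu> i)) \<and>
        (\<forall>i\<in>{1..d}. (\<Sum>j\<le>d. p i j * a j) = 0) \<and>
        (\<forall>b :: nat \<Rightarrow> 'k poly poly. (\<Sum>j\<le>d. b j * a j) = 0 \<longrightarrow>
           (\<exists>c :: nat \<Rightarrow> 'k poly poly. \<forall>j\<le>d. b j = (\<Sum>i=1..d. c i * p i j))) \<and>
        (\<forall>c :: nat \<Rightarrow> 'k poly poly. (\<forall>j\<le>d. (\<Sum>i=1..d. c i * p i j) = 0) \<longrightarrow>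
           (\<forall>i\<in>{1..d}. c i = 0)))"

definition mu_min :: "nat \<Rightarrow> nat \<Rightarrow> nat \<Rightarrow> nat" where
  "mu_min n d i = (if i < d then 1 else n - d + 1)"

definition P_mu :: "nat \<Rightarrow> nat \<Rightarrow> (nat \<Rightarrow> nat) \<Rightarrow> (nat \<Rightarrow> 'k::field poly poly) set" where
  "P_mu n d \<mu> = {a \<in> form_tuples n d.
     lin_indep_tuple d a \<and> rel_prime_tuple d a \<and> has_mu_type d a \<mu>}"

text \<open>\<open>e1\<close> and \<open>e2\<close> are the degrees of \<open>h1\<close> and \<open>h2\<close>.  The clauses on $I_n$, the degree \<open>n\<close> part of
  \<open>I\<close>, express that it is the internal direct sum $R_{n-e_1} h_1 \oplus R_{n-e_2} h_2$.\<close>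

definition ancestor_partition ::
  "nat \<Rightarrow> nat \<Rightarrow> (nat \<Rightarrow> 'k::field poly poly) \<Rightarrow> nat \<times> nat \<Rightarrow> bool" where
  "ancestor_partition n d a A \<longleftrightarrow>
     (let I = ideal_gen (a ` {..d}) in
      \<exists>h1 h2 e1 e2. h1 \<noteq> 0 \<and> h2 \<noteq> 0 \<and> h1 \<in> forms e1 \<and> h2 \<in> forms e2 \<and>
        e2 \<le> e1 \<and> e1 \<le> n \<and> coprime h1 h2 \<and>
        ancestor_ideal n I = ideal_gen {h1, h2} \<and>
        I \<inter> forms n = {u * h1 + v * h2 | u v. u \<in> forms (n - e1) \<and> v \<in> forms (n - e2)} \<and>
        (\<forall>u \<in> forms (n - e1). \<forall>v \<in> forms (n - e2). u * h1 + v * h2 = 0 \<longrightarrow> u = 0 \<and> v = 0) \<and>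
        A = (n + 1 - e1, n + 1 - e2))"

definition P_mu_min_part :: "nat \<Rightarrow> nat \<Rightarrow> nat \<times> nat \<Rightarrow> (nat \<Rightarrow> 'k::field poly poly) set" where
  "P_mu_min_part n d A = {a \<in> P_mu n d (mu_min n d). ancestor_partition n d a A}"

definition two_part_partitions :: "nat \<Rightarrow> (nat \<times> nat) set" where
  "two_part_partitions m = {(\<alpha>1, \<alpha>2). 1 \<le> \<alpha>1 \<and> \<alpha>1 \<le> \<alpha>2 \<and> \<alpha>1 + \<alpha>2 = m}"

definition partition_le :: "nat \<times> nat \<Rightarrow> nat \<times> nat \<Rightarrow> bool" where
  "partition_le A' A \<longleftrightarrow> fst A' \<le> fst A \<and> fst A' + snd A' \<le> fst A + snd A"

text \<open>The Zariski topology induced on the tuples of type \<open>mu_min\<close>.\<close>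

definition zariski_mu_min :: "nat \<Rightarrow> nat \<Rightarrow> (nat \<Rightarrow> 'k::field poly poly) topology" where
  "zariski_mu_min n d = subtopology (zariski n d) (P_mu n d (mu_min n d))"

end

theory Submission imports Defs "Berlekamp_Zassenhaus.Unique_Factorization_Poly" begin

text \<open>Write \<open>e1 = n + 1 - \<alpha>1\<close> and \<open>e2 = n + 1 - \<alpha>2\<close>. A linearly independent, relatively prime tuple lies in the
  stratum of \<open>(\<alpha>1, \<alpha>2)\<close> iff \<open>a i = u i * h1 + v i * h2\<close> with \<open>h1\<close>, \<open>h2\<close> of degrees \<open>e1\<close>, \<open>e2\<close>: the Koszul relations
  of the monomial multiples of \<open>h1\<close> and \<open>h2\<close> give the \<open>d - 1\<close> linear syzygies. The stratum is thus the generic part of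
  the image of an affine space, hence irreducible, and letting \<open>h1\<close> degenerate to a multiple of \<open>h2\<close> shows that its
  closure contains the strata of the smaller partitions. The other strata do not meet the closure: for \<open>\<alpha>1' > \<alpha>1\<close> no
  nonzero form \<open>h2\<close> of degree \<open>e2\<close> has all its multiples of degree \<open>n\<close> in the span of the \<open>a i\<close>, and the existence
  of such a form is a closed condition.

  For the dimension, a chain of length \<open>m\<close> gives \<open>m\<close> algebraically independent polynomial functions on the stratum. Pulled
  back to a normal form of \<open>(u, v, h1, h2)\<close> they are polynomials in as many parameters as the claimed dimension, and
  counting monomials bounds \<open>m\<close>. Since the parameters are rational functions of the tuple, fixing them one after
  the other gives a chain of that length.\<close>

section \<open>Rings of functions and linear systems\<close>

text \<open>The field is only assumed infinite, so every density argument runs along a curve: a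
  polynomial in one variable with one nonzero value has finitely many zeros, and finitely many bad
  points can be avoided.

  \<open>fun_ring\<close> is instantiated by polynomials in one variable, polynomial functions of
  the tuple, polynomials in the normal-form parameters, and functions of the parameters that are
  quotients of polynomial functions of the tuple. One elimination without divisions over such a ring
  yields openness of linear independence and of coprimality, the equations that separate the strata,
  and the rationality of the parameters.

  To identify the whole closure, every tuple of minimal type must lie in some stratum. This follows
  from the convexity of the dimensions of iterated colon spaces.

  The correction in the dimension comes from automorphisms: \<open>(u, v, h1, h2)\<close> has
  \<open>(d + 1)^2 + e1 + e2 + 2\<close> coefficients, where \<open>e1 + e2 = 2 * n + 1 - d\<close>,
  and the automorphisms of the pair of degrees form a group of dimension 4 if \<open>e1 = e2\<close>
  and \<open>e1 - e2 + 3\<close> otherwise, with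
  \<open>e1 - e2 = \<alpha>2 - \<alpha>1\<close>.\<close>

locale fun_ring =
  fixes A :: "('x \<Rightarrow> 'k::field) set"
  assumes const [intro, simp]: "(\<lambda>_. c) \<in> A"
    and add [intro]: "f \<in> A \<Longrightarrow> g \<in> A \<Longrightarrow> (\<lambda>x. f x + g x) \<in> A"
    and mult [intro]: "f \<in> A \<Longrightarrow> g \<in> A \<Longrightarrow> (\<lambda>x. f x * g x) \<in> A"
begin

lemma uminus [intro]: "f \<in> A \<Longrightarrow> (\<lambda>x. - f x) \<in> A"
  using mult[OF const[of "-1"], of f] by simp

lemma diff [intro]: "f \<in> A \<Longrightarrow> g \<in> A \<Longrightarrow> (\<lambda>x. f x - g x) \<in> A"
  using add[OF _ uminus, of f g] by simp

lemma sum [intro]: "(\<And>i. i \<in> I \<Longrightarrow> f i \<in> A) \<Longrightarrow> (\<lambda>x. \<Sum>i\<in>I. f i x) \<in> A"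
  by (induction I rule: infinite_finite_induct) auto

lemma prod [intro]: "(\<And>i. i \<in> I \<Longrightarrow> f i \<in> A) \<Longrightarrow> (\<lambda>x. \<Prod>i\<in>I. f i x) \<in> A"
  by (induction I rule: infinite_finite_induct) auto

lemma power [intro]: "f \<in> A \<Longrightarrow> (\<lambda>x. f x ^ m) \<in> A"
  by (induction m) auto

text \<open>Gaussian elimination without divisions: the pivot, nonzero at \<open>x0\<close>, becomes a factor
  of \<open>f\<close>.\<close>

lemma left_inverse_near_injective:
  fixes M :: "'r \<Rightarrow> 'i \<Rightarrow> 'x \<Rightarrow> 'k"
  assumes "finite I" and R: "finite R"
    and M: "\<And>r i. r \<in> R \<Longrightarrow> i \<in> I \<Longrightarrow> M r i \<in> A"
    and inj: "\<And>y. (\<forall>r\<in>R. (\<Sum>i\<in>I. M r i x0 * y i) = 0) \<Longrightarrow> \<forall>i\<in>I. y i = 0"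
  shows "\<exists>f\<in>A. f x0 \<noteq> 0 \<and> (\<exists>N. (\<forall>i\<in>I. \<forall>r\<in>R. N i r \<in> A) \<and>
    (\<forall>x. \<forall>i\<in>I. \<forall>j\<in>I. (\<Sum>r\<in>R. N i r x * M r j x) = (if i = j then f x else 0)))"
  using \<open>finite I\<close> M inj
proof (induction I arbitrary: M rule: finite_induct)
  case empty
  show ?case by (intro bexI[of _ "\<lambda>_. 1"]) auto
next
  case (insert i0 I)
  note MA = insert.prems(1) and inj = insert.prems(2)
  have "\<exists>r0\<in>R. M r0 i0 x0 \<noteq> 0"
  proof (rule ccontr)
    assume "\<not> ?thesis"
    then have "\<forall>r\<in>R. (\<Sum>i\<in>insert i0 I. M r i x0 * (if i = i0 then 1 else 0)) = 0"
      using insert.hyps by (auto intro!: sum.neutral)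
    from inj[OF this] show False by auto
  qed
  then obtain r0 where r0: "r0 \<in> R" "M r0 i0 x0 \<noteq> 0" by blast
  define p where "p = M r0 i0"
  \<comment> \<open>Column \<open>i0\<close> is cleared from every row. Row \<open>r0\<close>
    becomes zero but stays, so that the set of rows does not change in the induction.\<close>
  define M' where "M' = (\<lambda>r i x. p x * M r i x - M r i0 x * M r0 i x)"
  have pA: "p \<in> A" using MA r0 by (simp add: p_def)
  have M'A: "M' r i \<in> A" if "r \<in> R" "i \<in> I" for r i
    unfolding M'_def using that r0 MA pA by (intro diff mult) auto
  have inj': "\<forall>i\<in>I. y i = 0" if y: "\<forall>r\<in>R. (\<Sum>i\<in>I. M' r i x0 * y i) = 0" for y
  proof -
    define z where "z = (\<Sum>i\<in>I. M r0 i x0 * y i)"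
    \<comment> \<open>The value at \<open>i0\<close> is obtained by solving the pivot row.\<close>
    define y' where "y' = (\<lambda>i. if i = i0 then - z / p x0 else y i)"
    have eq: "(\<Sum>i\<in>insert i0 I. M r i x0 * y' i) = M r i0 x0 * (- z / p x0) + (\<Sum>i\<in>I. M r i x0 * y i)" for r
    proof -
      have "(\<Sum>i\<in>I. M r i x0 * y' i) = (\<Sum>i\<in>I. M r i x0 * y i)"
        using insert.hyps by (intro sum.cong) (auto simp: y'_def)
      then show ?thesis using insert.hyps by (simp add: y'_def)
    qed
    have "(\<Sum>i\<in>insert i0 I. M r i x0 * y' i) = 0" if "r \<in> R" for r
    proof -
      have "0 = (\<Sum>i\<in>I. M' r i x0 * y i)" using y that by simp
      also have "\<dots> = p x0 * (\<Sum>i\<in>I. M r i x0 * y i) - M r i0 x0 * z"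
        by (simp add: M'_def z_def sum_distrib_left sum_subtractf algebra_simps)
      finally show ?thesis unfolding eq using r0(2) by (simp add: p_def field_simps)
    qed
    from inj[rule_format, OF this] have "\<forall>i\<in>insert i0 I. y' i = 0" by blast
    then show ?thesis using insert.hyps by (auto simp: y'_def split: if_splits)
  qed
  have "\<exists>f\<in>A. f x0 \<noteq> 0 \<and> (\<exists>N. (\<forall>i\<in>I. \<forall>r\<in>R. N i r \<in> A) \<and>
      (\<forall>x. \<forall>i\<in>I. \<forall>j\<in>I. (\<Sum>r\<in>R. N i r x * M' r j x) = (if i = j then f x else 0)))"
  proof (rule insert.IH, goal_cases)
    case (1 r i)
    then show ?case by (rule M'A)
  next
    case (2 y)
    then show ?case by (rule inj')
  qed
  then obtain f' N' where f': "f' \<in> A" "f' x0 \<noteq> 0"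
    and "\<forall>i\<in>I. \<forall>r\<in>R. N' i r \<in> A"
      "\<forall>x. \<forall>i\<in>I. \<forall>j\<in>I. (\<Sum>r\<in>R. N' i r x * M' r j x) = (if i = j then f' x else 0)"
    by (elim bexE conjE exE)
  then have N'A: "i \<in> I \<Longrightarrow> r \<in> R \<Longrightarrow> N' i r \<in> A"
    and N': "i \<in> I \<Longrightarrow> j \<in> I \<Longrightarrow> (\<Sum>r\<in>R. N' i r x * M' r j x) = (if i = j then f' x else 0)" for i j r x
    by simp_all
  \<comment> \<open>Row operations undone: \<open>K\<close> applied to \<open>M\<close> equals
    \<open>N'\<close> applied to \<open>M'\<close>, the subtracted multiples of the pivot row being
    collected in column \<open>r0\<close>.\<close>
  define K where "K = (\<lambda>i r x. N' i r x * p x - (if r = r0 then \<Sum>q\<in>R. N' i q x * M q i0 x else 0))"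
  have KA: "K i r \<in> A" if "i \<in> I" "r \<in> R" for i r
    unfolding K_def using that N'A pA MA by (cases "r = r0") (auto intro!: diff mult sum)
  have Ksum: "(\<Sum>r\<in>R. K i r x * M r j x) = (\<Sum>r\<in>R. N' i r x * M' r j x)" for i j x
  proof -
    have "(\<Sum>r\<in>R. K i r x * M r j x) = (\<Sum>r\<in>R. N' i r x * p x * M r j x) -
        (\<Sum>r\<in>R. if r = r0 then (\<Sum>q\<in>R. N' i q x * M q i0 x) * M r j x else 0)"
      unfolding sum_subtractf[symmetric] by (intro sum.cong) (auto simp: K_def algebra_simps)
    also have "\<dots> = (\<Sum>r\<in>R. N' i r x * p x * M r j x) - (\<Sum>q\<in>R. N' i q x * M q i0 x) * M r0 j x"
      using R r0 by simp
    also have "\<dots> = (\<Sum>r\<in>R. N' i r x * M' r j x)"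
      by (simp add: M'_def sum_distrib_left sum_distrib_right sum_subtractf algebra_simps)
    finally show ?thesis .
  qed
  have K: "(\<Sum>r\<in>R. K i r x * M r j x) = (if i = j then f' x else 0)" if "i \<in> I" "j \<in> insert i0 I" for i j x
  proof (cases "j = i0")
    case True
    have "M' r i0 x = 0" for r by (simp add: M'_def p_def)
    with True show ?thesis unfolding Ksum using that insert.hyps by auto
  next
    case False
    with that show ?thesis unfolding Ksum using N' by simp
  qed
  \<comment> \<open>Row \<open>i0\<close> is back substitution into the pivot row. The other rows
    are multiplied by \<open>p\<close> so that all rows share the factor
    \<open>f' * p\<close>.\<close>
  define N where "N = (\<lambda>i r x. if i = i0 then (if r = r0 then f' x else 0) - (\<Sum>j\<in>I. M r0 j x * K j r x)
     else p x * K i r x)"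
  have "N i r \<in> A" if "i \<in> insert i0 I" "r \<in> R" for i r
    unfolding N_def using that KA pA MA f' r0
    by (cases "i = i0"; cases "r = r0") (auto intro!: diff mult sum uminus)
  moreover have "(\<Sum>r\<in>R. N i r x * M r j x) = (if i = j then f' x * p x else 0)"
    if i: "i \<in> insert i0 I" and j: "j \<in> insert i0 I" for i j x
  proof (cases "i = i0")
    case True
    have "(\<Sum>r\<in>R. N i r x * M r j x) = (\<Sum>r\<in>R. if r = r0 then f' x * M r j x else 0) -
       (\<Sum>r\<in>R. \<Sum>k\<in>I. M r0 k x * (K k r x * M r j x))"
      unfolding sum_subtractf[symmetric]
      by (intro sum.cong) (auto simp: True N_def algebra_simps sum_distrib_left sum_distrib_right)
    also have "(\<Sum>r\<in>R. \<Sum>k\<in>I. M r0 k x * (K k r x * M r j x)) = (\<Sum>k\<in>I. M r0 k x * (\<Sum>r\<in>R. K k r x * M r j x))"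
      by (subst sum.swap) (simp add: sum_distrib_left)
    also have "\<dots> = (\<Sum>k\<in>I. if k = j then M r0 k x * f' x else 0)"
      using K j by (intro sum.cong) auto
    also have "\<dots> = (if j \<in> I then M r0 j x * f' x else 0)"
      using insert.hyps by simp
    also have "(\<Sum>r\<in>R. if r = r0 then f' x * M r j x else 0) = f' x * M r0 j x"
      using R r0 by simp
    finally show ?thesis using True j insert.hyps by (auto simp: p_def)
  next
    case False
    then have "(\<Sum>r\<in>R. N i r x * M r j x) = p x * (\<Sum>r\<in>R. K i r x * M r j x)"
      by (simp add: N_def sum_distrib_left algebra_simps)
    then show ?thesis using K[of i j x] False i j by auto
  qed
  ultimately show ?case
    using f' pA r0 by (intro bexI[of _ "\<lambda>x. f' x * p x"] conjI exI[of _ N]) (auto simp: p_def)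
qed

end

text \<open>An equation with a nonzero coefficient eliminates one unknown together with itself, so
  the excess of unknowns survives the induction. The monomial count applies this to exponent vectors
  as index sets.\<close>

lemma exists_nontrivial_solution:
  fixes M :: "'r \<Rightarrow> 'i \<Rightarrow> 'k::field"
  assumes "finite R" "finite I" "card R < card I"
  shows "\<exists>y. (\<exists>i\<in>I. y i \<noteq> 0) \<and> (\<forall>r\<in>R. (\<Sum>i\<in>I. M r i * y i) = 0)"
  using assms
proof (induction R arbitrary: I M rule: finite_induct)
  case empty
  then have "I \<noteq> {}" by auto
  then show ?case by (intro exI[of _ "\<lambda>_. 1"]) auto
next
  case (insert r R)
  show ?case
  proof (cases "\<forall>i\<in>I. M r i = 0")
    case True
    have "card R < card I" using insert by simp
    from insert.IH[OF \<open>finite I\<close> this, of M] obtain y where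
      "\<exists>i\<in>I. y i \<noteq> 0" "\<forall>r\<in>R. (\<Sum>i\<in>I. M r i * y i) = 0" by blast
    with True show ?thesis by (intro exI[of _ y]) auto
  next
    case False
    then obtain i0 where i0: "i0 \<in> I" "M r i0 \<noteq> 0" by blast
    define J where "J = I - {i0}"
    have J: "finite J" "i0 \<notin> J" "I = insert i0 J" using i0 insert.prems by (auto simp: J_def)
    have "card R < card J" using insert J by simp
    from insert.IH[OF J(1) this, of "\<lambda>q i. M r i0 * M q i - M q i0 * M r i"] obtain y where
      y: "\<exists>i\<in>J. y i \<noteq> 0" "\<forall>q\<in>R. (\<Sum>i\<in>J. (M r i0 * M q i - M q i0 * M r i) * y i) = 0" by blast
    define z where "z = (\<Sum>i\<in>J. M r i * y i)"
    define y' where "y' = (\<lambda>i. if i = i0 then - z / M r i0 else y i)"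
    have eq: "(\<Sum>i\<in>I. M q i * y' i) = M q i0 * (- z / M r i0) + (\<Sum>i\<in>J. M q i * y i)" for q
    proof -
      have "(\<Sum>i\<in>J. M q i * y' i) = (\<Sum>i\<in>J. M q i * y i)"
        using J by (intro sum.cong) (auto simp: y'_def)
      then show ?thesis using J by (simp add: y'_def)
    qed
    have "(\<Sum>i\<in>I. M q i * y' i) = 0" if "q \<in> R" for q
    proof -
      have "0 = (\<Sum>i\<in>J. (M r i0 * M q i - M q i0 * M r i) * y i)" using y that by simp
      also have "\<dots> = M r i0 * (\<Sum>i\<in>J. M q i * y i) - M q i0 * z"
        by (simp add: z_def sum_distrib_left sum_subtractf algebra_simps)
      finally show ?thesis unfolding eq using i0 by (simp add: field_simps)
    qed
    moreover have "(\<Sum>i\<in>I. M r i * y' i) = 0" unfolding eq using i0 by (simp add: z_def)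
    moreover have "\<exists>i\<in>I. y' i \<noteq> 0" using y(1) J by (auto simp: y'_def)
    ultimately show ?thesis by (intro exI[of _ y']) auto
  qed
qed

section \<open>The Zariski topology\<close>

lemma fun_ring_polynomial_functions: "fun_ring (polynomial_functions n d)"
  by unfold_locales (auto intro: polynomial_functions.intros)

lemma (in fun_ring) polynomial_function_compose:
  assumes "f \<in> polynomial_functions n d"
    and "\<And>i j. i \<le> d \<Longrightarrow> j \<le> n \<Longrightarrow> (\<lambda>x. coeff (coeff (\<phi> x i) j) (n - j)) \<in> A"
  shows "(\<lambda>x. f (\<phi> x)) \<in> A"
  using assms(1) by induction (auto intro: assms(2))

lemma fun_ring_poly: "fun_ring (range (poly :: 'k::field poly \<Rightarrow> 'k \<Rightarrow> 'k))"
proof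
  show "(\<lambda>_. c) \<in> range (poly :: 'k poly \<Rightarrow> 'k \<Rightarrow> 'k)" for c
    by (rule range_eqI[of _ poly "[:c:]"]) auto
  fix f g :: "'k \<Rightarrow> 'k" assume "f \<in> range poly" "g \<in> range poly"
  then obtain p q where "f = poly p" "g = poly q" by auto
  then have "(\<lambda>x. f x + g x) = poly (p + q)" "(\<lambda>x. f x * g x) = poly (p * q)" by auto
  then show "(\<lambda>x. f x + g x) \<in> range poly" "(\<lambda>x. f x * g x) \<in> range poly" by auto
qed

lemma id_in_range_poly [simp]: "(\<lambda>x. x) \<in> range (poly :: 'k::field poly \<Rightarrow> 'k \<Rightarrow> 'k)"
  by (rule range_eqI[of _ _ "[:0, 1:]"]) auto

lemma poly_fun_cofinite_nonzero:
  fixes f :: "'k::field \<Rightarrow> 'k"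
  assumes "f \<in> range poly" "f c \<noteq> 0"
  shows "finite {x. f x = 0}"
proof -
  obtain p where p: "f = poly p" using assms by auto
  then have "p \<noteq> 0" using assms by auto
  then show ?thesis unfolding p by (rule poly_roots_finite)
qed

text \<open>Acts as a passage to the limit: an equation valid for all but finitely many parameters
  also holds at the exceptional ones.\<close>

lemma poly_fun_eq_0:
  fixes f :: "'k::field \<Rightarrow> 'k"
  assumes "f \<in> range poly" "infinite (UNIV :: 'k set)" "finite F" "\<And>x. x \<notin> F \<Longrightarrow> f x = 0"
  shows "f c = 0"
proof (rule ccontr)
  assume "f c \<noteq> 0"
  from poly_fun_cofinite_nonzero[OF assms(1) this] have "finite ({x. f x = 0} \<union> F)"
    using assms by simp
  moreover have "{x. f x = 0} \<union> F = UNIV" using assms(4) by auto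
  ultimately show False using assms(2) by simp
qed

lemma closedin_subtopology_zariski:
  fixes Y C :: "(nat \<Rightarrow> 'k::field poly poly) set"
  assumes "Y \<subseteq> form_tuples n d"
  shows "closedin (subtopology (zariski n d) Y) C \<longleftrightarrow>
    (\<exists>F \<subseteq> polynomial_functions n d. C = {a \<in> Y. \<forall>f\<in>F. f a = 0})"
proof -
  have "zero_locus n d F \<inter> Y = {a \<in> Y. \<forall>f\<in>F. f a = 0}" for F :: "((nat \<Rightarrow> 'k poly poly) \<Rightarrow> 'k) set"
    using assms by (auto simp: zero_locus_def)
  then show ?thesis unfolding closedin_subtopology closedin_zariski by metis
qed

text \<open>Two proper closed subsets are each missed by a single function, and the product of the
  two functions vanishes on the union. Irreducibility thus becomes primality of the vanishing ideal,
  which can be tested on lines.\<close>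

lemma irreducible_space_zariski_iff:
  fixes Y :: "(nat \<Rightarrow> 'k::field poly poly) set"
  assumes Y: "Y \<subseteq> form_tuples n d"
  shows "irreducible_space (subtopology (zariski n d) Y) \<longleftrightarrow> Y \<noteq> {} \<and>
    (\<forall>f\<in>polynomial_functions n d. \<forall>g\<in>polynomial_functions n d.
       (\<forall>a\<in>Y. f a * g a = 0) \<longrightarrow> (\<forall>a\<in>Y. f a = 0) \<or> (\<forall>a\<in>Y. g a = 0))"
    (is "_ \<longleftrightarrow> _ \<and> ?R")
proof -
  have ts: "topspace (subtopology (zariski n d) Y) = Y"
    using Y by (auto simp: topspace_subtopology)
  show ?thesis
  proof (intro iffI conjI)
    assume irr: "irreducible_space (subtopology (zariski n d) Y)"
    show "Y \<noteq> {}" using irr unfolding irreducible_space_def ts by blast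
    show ?R
    proof (intro ballI impI)
      fix f g :: "(nat \<Rightarrow> 'k poly poly) \<Rightarrow> 'k"
      assume fg: "f \<in> polynomial_functions n d" "g \<in> polynomial_functions n d" "\<forall>a\<in>Y. f a * g a = 0"
      let ?A = "{a \<in> Y. \<forall>h\<in>{f}. h a = 0}" and ?B = "{a \<in> Y. \<forall>h\<in>{g}. h a = 0}"
      have "closedin (subtopology (zariski n d) Y) ?A" "closedin (subtopology (zariski n d) Y) ?B"
        unfolding closedin_subtopology_zariski[OF Y] using fg by blast+
      moreover have "?A \<union> ?B = Y" using fg(3) by auto
      ultimately have "?A = Y \<or> ?B = Y"
        using irr unfolding irreducible_space_def ts by blast
      then show "(\<forall>a\<in>Y. f a = 0) \<or> (\<forall>a\<in>Y. g a = 0)" by blast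
    qed
  next
    assume R: "Y \<noteq> {} \<and> ?R"
    show "irreducible_space (subtopology (zariski n d) Y)"
      unfolding irreducible_space_def ts
    proof (intro conjI allI impI)
      show "Y \<noteq> {}" using R by simp
      fix A B
      assume AB: "closedin (subtopology (zariski n d) Y) A \<and> closedin (subtopology (zariski n d) Y) B \<and> A \<union> B = Y"
      then obtain F G where F: "F \<subseteq> polynomial_functions n d" "A = {a \<in> Y. \<forall>f\<in>F. f a = 0}"
        and G: "G \<subseteq> polynomial_functions n d" "B = {a \<in> Y. \<forall>f\<in>G. f a = 0}"
        unfolding closedin_subtopology_zariski[OF Y] by blast
      show "A = Y \<or> B = Y"
      proof (rule ccontr)
        assume "\<not> ?thesis"
        then obtain f g a b where fg: "f \<in> F" "g \<in> G" "a \<in> Y" "f a \<noteq> 0" "b \<in> Y" "g b \<noteq> 0"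
          using F(2) G(2) by blast
        have "\<forall>c\<in>Y. f c * g c = 0"
        proof
          fix c assume "c \<in> Y"
          then have "c \<in> A \<or> c \<in> B" using AB by blast
          then show "f c * g c = 0" using fg F(2) G(2) by auto
        qed
        then show False using R fg F(1) G(1) by (meson subsetD)
      qed
    qed
  qed
qed

lemma closure_of_subtopology_zariski:
  fixes P Y :: "(nat \<Rightarrow> 'k::field poly poly) set"
  assumes P: "P \<subseteq> form_tuples n d" and Y: "Y \<subseteq> P"
  shows "subtopology (zariski n d) P closure_of Y =
    {a \<in> P. \<forall>f\<in>polynomial_functions n d. (\<forall>b\<in>Y. f b = 0) \<longrightarrow> f a = 0}" (is "_ = ?C")
proof
  have "?C = {a \<in> P. \<forall>f\<in>{f \<in> polynomial_functions n d. \<forall>b\<in>Y. f b = 0}. f a = 0}" by auto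
  then have "closedin (subtopology (zariski n d) P) ?C"
    unfolding closedin_subtopology_zariski[OF P] by (intro exI[of _ "{f \<in> polynomial_functions n d. \<forall>b\<in>Y. f b = 0}"]) auto
  moreover have "Y \<subseteq> ?C" using Y by auto
  ultimately show "subtopology (zariski n d) P closure_of Y \<subseteq> ?C"
    by (intro closure_of_minimal)
next
  let ?D = "subtopology (zariski n d) P closure_of Y"
  have "closedin (subtopology (zariski n d) P) ?D" by simp
  then obtain F where F: "F \<subseteq> polynomial_functions n d" "?D = {a \<in> P. \<forall>f\<in>F. f a = 0}"
    unfolding closedin_subtopology_zariski[OF P] by blast
  have "Y \<subseteq> ?D" using Y P by (intro closure_of_subset) (auto simp: topspace_subtopology)
  then have "\<forall>f\<in>F. \<forall>b\<in>Y. f b = 0" using F(2) by blast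
  then show "?C \<subseteq> ?D" using F by blast
qed

section \<open>Binary forms\<close>

definition varS :: "'k::field poly poly" where "varS = [:[:0, 1:]:]"
definition varT :: "'k::field poly poly" where "varT = [:0, 1:]"
abbreviation cf :: "'k::field poly poly \<Rightarrow> nat \<Rightarrow> nat \<Rightarrow> 'k" where "cf p i j \<equiv> coeff (coeff p i) j"

lemma poly_poly_eqI: "(\<And>i j. cf p i j = cf q i j) \<Longrightarrow> p = q"
  by (simp add: poly_eq_iff)

lemma cf_mult: "cf (p * q) i j = (\<Sum>i'\<le>i. \<Sum>j'\<le>j. cf p i' j' * cf q (i - i') (j - j'))"
  by (simp add: coeff_mult coeff_sum)

lemma cf_sum: "cf (\<Sum>i\<in>I. f i) a b = (\<Sum>i\<in>I. cf (f i) a b)"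
  by (simp add: coeff_sum)

lemma varS_neq_0 [simp]: "varS \<noteq> 0"
  by (simp add: varS_def)

lemma varT_neq_0 [simp]: "varT \<noteq> 0"
  by (simp add: varT_def)

lemma varS_power: "varS ^ k = [:monom 1 k:]"
  by (induction k) (simp_all add: varS_def monom_0 pCons_one monom_Suc)

lemma varT_power: "varT ^ k = monom 1 k"
  by (induction k) (simp_all add: varT_def monom_Suc)

lemma cf_varS_power_mult: "cf (varS ^ k * p) i j = (if k \<le> j then cf p i (j - k) else 0)"
  by (simp add: varS_power coeff_monom_mult)

lemma cf_varT_power_mult: "cf (varT ^ k * p) i j = (if k \<le> i then cf p (i - k) j else 0)"
  by (simp add: varT_power coeff_monom_mult)

lemma cf_varS_mult: "cf (varS * p) i j = (if 1 \<le> j then cf p i (j - 1) else 0)"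
  using cf_varS_power_mult[of 1 p i j] by simp

lemma cf_varT_mult: "cf (varT * p) i j = (if 1 \<le> i then cf p (i - 1) j else 0)"
  using cf_varT_power_mult[of 1 p i j] by simp

lemma cf_monomial: "cf (varS ^ k * varT ^ l) i j = (if i = l \<and> j = k then 1 else 0)"
  unfolding cf_varS_power_mult by (auto simp: varT_power)

lemma formsD: "p \<in> forms m \<Longrightarrow> i + j \<noteq> m \<Longrightarrow> cf p i j = 0"
  by (auto simp: forms_def)

lemma formsI: "(\<And>i j. i + j \<noteq> m \<Longrightarrow> cf p i j = 0) \<Longrightarrow> p \<in> forms m"
  by (auto simp: forms_def)

lemma zero_in_forms [simp, intro]: "0 \<in> forms m"
  by (simp add: forms_def)

lemma add_in_forms [intro]: "p \<in> forms m \<Longrightarrow> q \<in> forms m \<Longrightarrow> p + q \<in> forms m"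
  by (intro formsI) (simp add: formsD)

lemma diff_in_forms [intro]: "p \<in> forms m \<Longrightarrow> q \<in> forms m \<Longrightarrow> p - q \<in> forms m"
  by (intro formsI) (simp add: formsD)

lemma uminus_in_forms [intro]: "p \<in> forms m \<Longrightarrow> - p \<in> forms m"
  by (intro formsI) (simp add: formsD)

lemma smult_in_forms [intro]: "p \<in> forms m \<Longrightarrow> smult [:c:] p \<in> forms m"
  by (intro formsI) (simp add: formsD)

lemma sum_in_forms [intro]: "(\<And>i. i \<in> I \<Longrightarrow> f i \<in> forms m) \<Longrightarrow> (\<Sum>i\<in>I. f i) \<in> forms m"
  by (induction I rule: infinite_finite_induct) auto

lemma mult_in_forms:
  assumes "p \<in> forms k" "q \<in> forms l"
  shows "p * q \<in> forms (k + l)"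
proof (rule formsI)
  fix i j :: nat assume *: "i + j \<noteq> k + l"
  show "cf (p * q) i j = 0" unfolding cf_mult
  proof (intro sum.neutral ballI)
    fix i' j' assume "i' \<in> {..i}" "j' \<in> {..j}"
    then have "i' + j' \<noteq> k \<or> (i - i') + (j - j') \<noteq> l" using * by auto
    then show "cf p i' j' * cf q (i - i') (j - j') = 0"
      using assms formsD by fastforce
  qed
qed

lemma mult_in_forms' [intro]: "p \<in> forms k \<Longrightarrow> q \<in> forms l \<Longrightarrow> m = k + l \<Longrightarrow> p * q \<in> forms m"
  by (simp add: mult_in_forms)

lemma one_in_forms [simp]: "1 \<in> forms 0"
  by (intro formsI) (auto simp: coeff_1 split: if_splits)

lemma varS_in_forms [simp, intro]: "varS \<in> forms (Suc 0)"
  by (intro formsI) (auto simp: varS_def coeff_pCons split: nat.splits)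

lemma varT_in_forms [simp, intro]: "varT \<in> forms (Suc 0)"
  by (intro formsI) (auto simp: varT_def coeff_pCons split: nat.splits)

lemma varS_power_in_forms [simp, intro]: "varS ^ k \<in> forms k"
  by (intro formsI) (auto simp: varS_power coeff_pCons split: nat.splits)

lemma varT_power_in_forms [simp, intro]: "varT ^ k \<in> forms k"
  by (intro formsI) (auto simp: varT_power)

lemma monomial_in_forms [intro]: "k + l = m \<Longrightarrow> varS ^ k * varT ^ l \<in> forms m"
  by (intro formsI) (auto simp: cf_monomial)

lemma forms_eqI:
  assumes "p \<in> forms m" "q \<in> forms m" "\<And>i. i \<le> m \<Longrightarrow> cf p i (m - i) = cf q i (m - i)"
  shows "p = q"
proof (rule poly_poly_eqI)
  fix i j
  show "cf p i j = cf q i j"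
  proof (cases "i + j = m")
    case True
    then show ?thesis using assms(3)[of i] by auto
  qed (use assms formsD in metis)
qed

definition form_of :: "nat \<Rightarrow> (nat \<Rightarrow> 'k::field) \<Rightarrow> 'k poly poly" where
  "form_of m c = (\<Sum>i\<le>m. smult [:c i:] (varS ^ (m - i) * varT ^ i))"

lemma form_of_in_forms [simp, intro]: "form_of m c \<in> forms m"
  unfolding form_of_def by (intro sum_in_forms smult_in_forms monomial_in_forms) auto

lemma cf_form_of: "cf (form_of m c) i j = (if i + j = m then c i else 0)"
proof -
  have "cf (form_of m c) i j = (\<Sum>k\<le>m. if k = i then (if j = m - i then c k else 0) else 0)"
    unfolding form_of_def cf_sum by (intro sum.cong) (auto simp: cf_monomial)
  then show ?thesis by auto
qed

lemma form_of_cf: "p \<in> forms m \<Longrightarrow> form_of m (\<lambda>i. cf p i (m - i)) = p"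
  by (intro forms_eqI) (auto simp: cf_form_of)

text \<open>The homogeneous component of degree \<open>m\<close> of an arbitrary polynomial. Members
  of an ideal are combinations with arbitrary coefficients; taking components turns them into
  combinations with forms.\<close>

definition hcomp :: "nat \<Rightarrow> 'k::field poly poly \<Rightarrow> 'k poly poly" where
  "hcomp m p = form_of m (\<lambda>i. cf p i (m - i))"

lemma hcomp_in_forms [simp, intro]: "hcomp m p \<in> forms m"
  by (simp add: hcomp_def)

lemma cf_hcomp: "cf (hcomp m p) i j = (if i + j = m then cf p i j else 0)"
  unfolding hcomp_def cf_form_of by auto

lemma hcomp_add: "hcomp m (p + q) = hcomp m p + hcomp m q"
  by (rule poly_poly_eqI) (simp add: cf_hcomp)

lemma hcomp_sum: "hcomp m (\<Sum>i\<in>I. f i) = (\<Sum>i\<in>I. hcomp m (f i))"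
  by (rule poly_poly_eqI) (simp add: cf_hcomp cf_sum)

lemma hcomp_form: "p \<in> forms m \<Longrightarrow> hcomp k p = (if k = m then p else 0)"
  by (rule poly_poly_eqI) (auto simp: cf_hcomp formsD)

lemma eq_0_if_hcomp: "(\<And>k. hcomp k p = 0) \<Longrightarrow> p = 0"
proof (rule poly_poly_eqI)
  fix i j assume "\<And>k. hcomp k p = 0"
  then have "cf (hcomp (i + j) p) i j = 0" by simp
  then show "cf p i j = cf 0 i j" by (simp add: cf_hcomp)
qed

lemma hcomp_mult:
  assumes "q \<in> forms e"
  shows "hcomp (k + e) (p * q) = hcomp k p * q"
proof (rule poly_poly_eqI)
  fix i j
  show "cf (hcomp (k + e) (p * q)) i j = cf (hcomp k p * q) i j"
  proof (cases "i + j = k + e")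
    case True
    have "cf p i' j' * cf q (i - i') (j - j') = cf (hcomp k p) i' j' * cf q (i - i') (j - j')"
      if "i' \<le> i" "j' \<le> j" for i' j'
    proof (cases "i' + j' = k")
      case False
      then have "(i - i') + (j - j') \<noteq> e" using that True by linarith
      then show ?thesis using formsD[OF assms] by simp
    qed (simp add: cf_hcomp)
    then have "cf (p * q) i j = cf (hcomp k p * q) i j"
      unfolding cf_mult by (intro sum.cong) auto
    with True show ?thesis by (simp add: cf_hcomp)
  next
    case False
    moreover have "hcomp k p * q \<in> forms (k + e)" using assms by auto
    ultimately show ?thesis by (simp add: cf_hcomp formsD)
  qed
qed

text \<open>Multiplication by \<open>h\<close> is injective and shifts homogeneous components by
  \<open>e\<close>, so \<open>q\<close> has no component outside degree
  \<open>m - e\<close>.\<close>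

lemma factor_in_forms:
  assumes "q * h \<in> forms m" "h \<in> forms e" "h \<noteq> 0" "q \<noteq> 0"
  shows "e \<le> m \<and> q \<in> forms (m - e)"
proof -
  have 0: "hcomp k q = 0" if "k + e \<noteq> m" for k
  proof -
    have "hcomp k q * h = 0"
      using hcomp_mult[OF assms(2), of k q] hcomp_form[OF assms(1)] that by simp
    then show ?thesis using assms(3) by simp
  qed
  have "e \<le> m"
  proof (rule ccontr)
    assume "\<not> e \<le> m"
    then have "hcomp k q = 0" for k using 0 by simp
    with assms(4) eq_0_if_hcomp show False by blast
  qed
  moreover have "q \<in> forms (m - e)"
  proof (rule formsI)
    fix i j assume "i + j \<noteq> m - e"
    then have "i + j + e \<noteq> m" using \<open>e \<le> m\<close> by linarith
    then have "cf (hcomp (i + j) q) i j = 0" using 0 by simp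
    then show "cf q i j = 0" by (simp add: cf_hcomp)
  qed
  ultimately show ?thesis by simp
qed

text \<open>The part of \<open>x\<close> free of \<open>varT\<close> must vanish, since the right
  side has none. This is exactness of the Koszul complex of the two variables, the base of the
  syzygy arguments below.\<close>

lemma varS_cancel_varT:
  fixes x y :: "'k::field poly poly"
  assumes "varS * x = varT * y"
  shows "\<exists>z. x = varT * z \<and> y = varS * z"
proof -
  have "cf x 0 j = 0" for j
  proof -
    have "cf x 0 j = cf (varS * x) 0 (Suc j)" by (simp only: cf_varS_mult) simp
    also have "\<dots> = 0" unfolding assms by (simp only: cf_varT_mult) simp
    finally show ?thesis .
  qed
  then have x0: "coeff x 0 = 0" by (simp add: poly_eq_iff)
  obtain c z where "x = pCons c z" by (cases x)
  with x0 have z: "x = varT * z" by (simp add: varT_def)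
  then have "varT * (varS * z) = varT * y" using assms by (metis mult.left_commute)
  then have "y = varS * z" by simp
  with z show ?thesis by blast
qed

lemma varS_mult_in_forms_iff: "varS * x \<in> forms (Suc m) \<longleftrightarrow> x \<in> forms m"
proof
  assume *: "varS * x \<in> forms (Suc m)"
  show "x \<in> forms m"
  proof (cases "x = 0")
    case False
    from factor_in_forms[of x varS "Suc m" "Suc 0"] * False show ?thesis by (simp add: mult.commute)
  qed auto
qed auto

text \<open>If the exponent of \<open>varT\<close> is below \<open>b\<close>, that of
  \<open>varS\<close> is at least \<open>m - b + 1\<close>, hence at least \<open>a\<close>. So each
  monomial can be assigned to one of the two summands.\<close>

lemma forms_decompose:
  assumes p: "p \<in> forms m" and ab: "a + b \<le> m + 1"
  shows "\<exists>x y. x \<in> forms (m - a) \<and> y \<in> forms (m - b) \<and> p = varS ^ a * x + varT ^ b * y"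
\<comment> \<open>For \<open>a\<close> or \<open>b\<close> equal to \<open>m + 1\<close> the degree
  \<open>m - a\<close> or \<open>m - b\<close> is truncated to 0, so the corresponding summand has
  to be zero.\<close>
proof (cases "a = m + 1 \<or> b = m + 1")
  case True
  then show ?thesis
  proof
    assume "a = m + 1"
    then have "b = 0" using ab by simp
    then show ?thesis using p by (intro exI[of _ 0] exI[of _ p]) simp
  next
    assume "b = m + 1"
    then have "a = 0" using ab by simp
    then show ?thesis using p by (intro exI[of _ 0] exI[of _ p]) simp
  qed
next
  case False
  then have le: "a \<le> m" "b \<le> m" using ab by auto
  define x where "x = form_of (m - a) (\<lambda>i. if i < b then cf p i (m - i) else 0)"
  define y where "y = form_of (m - b) (\<lambda>i. cf p (i + b) (m - (i + b)))"
  have xy: "x \<in> forms (m - a)" "y \<in> forms (m - b)" by (simp_all add: x_def y_def)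
  have "p = varS ^ a * x + varT ^ b * y"
  proof (rule forms_eqI[OF p])
    show "varS ^ a * x + varT ^ b * y \<in> forms m"
      using xy le by (intro add_in_forms mult_in_forms') auto
    fix i assume i: "i \<le> m"
    have "cf (varS ^ a * x) i (m - i) = (if i < b then cf p i (m - i) else 0)"
      unfolding cf_varS_power_mult x_def cf_form_of using i le ab by auto
    moreover have "cf (varT ^ b * y) i (m - i) = (if i < b then 0 else cf p i (m - i))"
      unfolding cf_varT_power_mult y_def cf_form_of using i le ab by auto
    ultimately show "cf p i (m - i) = cf (varS ^ a * x + varT ^ b * y) i (m - i)" by simp
  qed
  with xy show ?thesis by blast
qed

subsection \<open>Divisibility\<close>

text \<open>Coprime elements of \<open>k[s,t]\<close> need not generate the unit ideal, so no Bezout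
  combination is available. Instead \<open>y\<close> divides \<open>z\<close> times the gcd of the
  elements of \<open>X\<close>, and that gcd is a unit.\<close>

lemma ufd_dvd_if_dvd_mults:
  fixes y z :: "'a::ufd"
  assumes "finite X" "\<And>x. x \<in> X \<Longrightarrow> y dvd x * z" "\<And>g. (\<And>x. x \<in> X \<Longrightarrow> g dvd x) \<Longrightarrow> g dvd 1"
  shows "y dvd z"
proof -
  obtain xs where xs: "X = set xs" using finite_list[OF assms(1)] by auto
  let ?g = "some_gcd.listgcd xs"
  have y: "y dvd ?g * z"
    using assms(2) xs by (intro some_gcd.listgcd_greatest_mult) auto
  have "?g dvd 1"
    using some_gcd.listgcd xs by (intro assms(3)) auto
  then obtain k where "1 = ?g * k" by (elim dvdE)
  then have "z = ?g * z * k" by (metis mult.commute mult.left_commute mult_1_right)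
  with y show ?thesis by (metis dvd_mult2)
qed

lemma coprime_dvd_mult_forms:
  fixes h1 h2 :: "'k::field poly poly"
  assumes "Rings.coprime h1 h2" "h1 dvd v * h2"
  shows "h1 dvd v"
proof (rule ufd_dvd_if_dvd_mults[of "{h1, h2}"])
  fix g assume "\<And>x. x \<in> {h1, h2} \<Longrightarrow> g dvd x"
  then show "g dvd 1" using assms(1) by (auto simp: Rings.coprime_def)
qed (use assms in \<open>auto simp: mult.commute\<close>)

lemma coprime_forms_syzygy:
  fixes h1 h2 :: "'k::field poly poly"
  assumes "Rings.coprime h1 h2" "h1 \<noteq> 0" "h2 \<noteq> 0" "u * h1 + v * h2 = 0"
  shows "\<exists>c. v = c * h1 \<and> u = - c * h2"
proof -
  have "v * h2 = h1 * (- u)" using assms(4) by (simp add: eq_neg_iff_add_eq_0 algebra_simps)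
  then have "h1 dvd v * h2" by (metis dvd_triv_left)
  from coprime_dvd_mult_forms[OF assms(1) this] obtain c where c: "v = h1 * c" by (elim dvdE)
  then have "h1 * (u + c * h2) = 0" using assms(4) by (simp add: algebra_simps)
  then have "u + c * h2 = 0" using assms(2) by simp
  with c show ?thesis by (intro exI[of _ c]) (simp add: eq_neg_iff_add_eq_0 mult.commute)
qed

text \<open>Every syzygy of a coprime pair is a multiple of the Koszul syzygy, which lives in degree
  \<open>e1 + e2\<close>. Below that degree there is no room for a nonzero one, so the sum of the
  two multiples is direct.\<close>

lemma coprime_forms_unique:
  fixes h1 h2 :: "'k::field poly poly"
  assumes cop: "Rings.coprime h1 h2" and h: "h1 \<noteq> 0" "h2 \<noteq> 0" "h1 \<in> forms e1" "h2 \<in> forms e2"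
    and uv: "u * h1 + v * h2 = 0" "u * h1 \<in> forms m" "m < e1 + e2"
  shows "u = 0 \<and> v = 0"
proof -
  obtain c where c: "v = c * h1" "u = - c * h2" using coprime_forms_syzygy[OF cop h(1,2) uv(1)] by blast
  have "c = 0"
  proof (rule ccontr)
    assume "c \<noteq> 0"
    have "- c * (h2 * h1) \<in> forms m" using uv(2) c by (simp add: mult.assoc)
    from factor_in_forms[OF this mult_in_forms[OF h(4,3)]] \<open>c \<noteq> 0\<close> h uv(3) show False by simp
  qed
  with c show ?thesis by simp
qed

text \<open>The degree \<open>m\<close> part of the ideal generated by \<open>h1\<close> and
  \<open>h2\<close>. The degree conditions are put on the products, so that no truncated difference
  appears when \<open>m\<close> is below the degree of a generator.\<close>

definition gen2 :: "'k::field poly poly \<Rightarrow> 'k poly poly \<Rightarrow> nat \<Rightarrow> 'k poly poly set" where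
  "gen2 h1 h2 m = {u * h1 + v * h2 | u v. u * h1 \<in> forms m \<and> v * h2 \<in> forms m}"

lemma gen2I: "x = u * h1 + v * h2 \<Longrightarrow> u * h1 \<in> forms m \<Longrightarrow> v * h2 \<in> forms m \<Longrightarrow> x \<in> gen2 h1 h2 m"
  unfolding gen2_def by blast

lemma gen2_eq:
  assumes h: "h1 \<in> forms e1" "h2 \<in> forms e2" "h1 \<noteq> 0" "h2 \<noteq> 0" "e1 \<le> m" "e2 \<le> m"
  shows "gen2 h1 h2 m = {u * h1 + v * h2 | u v. u \<in> forms (m - e1) \<and> v \<in> forms (m - e2)}"
proof -
  have "u * h1 \<in> forms m \<longleftrightarrow> u \<in> forms (m - e1)" for u
    using factor_in_forms[of u h1 m e1] h by (cases "u = 0") auto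
  moreover have "v * h2 \<in> forms m \<longleftrightarrow> v \<in> forms (m - e2)" for v
    using factor_in_forms[of v h2 m e2] h by (cases "v = 0") auto
  ultimately show ?thesis unfolding gen2_def by simp
qed

lemma gen2_subset_forms: "gen2 h1 h2 m \<subseteq> forms m"
  by (auto simp: gen2_def)

text \<open>Multiplying the representation of \<open>varS * x\<close> by \<open>varT\<close> and
  that of \<open>varT * x\<close> by \<open>varS\<close> gives two representations of the same form
  in degree \<open>m + 2\<close>. Uniqueness there makes the coefficients of the first divisible by
  \<open>varS\<close>.\<close>

lemma gen2_descend:
  fixes h1 h2 :: "'k::field poly poly"
  assumes cop: "Rings.coprime h1 h2" and h: "h1 \<noteq> 0" "h2 \<noteq> 0" "h1 \<in> forms e1" "h2 \<in> forms e2"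
    and m: "m + 2 < e1 + e2"
    and S: "varS * x \<in> gen2 h1 h2 (Suc m)" and T: "varT * x \<in> gen2 h1 h2 (Suc m)"
  shows "x \<in> gen2 h1 h2 m"
proof -
  obtain u v where uv: "varS * x = u * h1 + v * h2" "u * h1 \<in> forms (Suc m)" "v * h2 \<in> forms (Suc m)"
    using S by (auto simp: gen2_def)
  obtain u' v' where uv': "varT * x = u' * h1 + v' * h2" "u' * h1 \<in> forms (Suc m)" "v' * h2 \<in> forms (Suc m)"
    using T by (auto simp: gen2_def)
  have "(varT * u - varS * u') * h1 + (varT * v - varS * v') * h2 =
     varT * (u * h1 + v * h2) - varS * (u' * h1 + v' * h2)" by (simp add: algebra_simps)
  also have "\<dots> = 0" unfolding uv(1)[symmetric] uv'(1)[symmetric] by (simp add: mult.left_commute)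
  finally have 0: "(varT * u - varS * u') * h1 + (varT * v - varS * v') * h2 = 0" .
  have "varT * (u * h1) - varS * (u' * h1) \<in> forms (m + 2)"
    using uv uv'
    by (intro diff_in_forms mult_in_forms'[OF varT_in_forms] mult_in_forms'[OF varS_in_forms]) auto
  then have "(varT * u - varS * u') * h1 \<in> forms (m + 2)"
    by (simp add: algebra_simps)
  from coprime_forms_unique[OF cop h 0 this m]
  have eq: "varS * u' = varT * u" "varS * v' = varT * v" by simp_all
  obtain w where w: "u = varS * w" using varS_cancel_varT[OF eq(1)] by blast
  obtain w' where w': "v = varS * w'" using varS_cancel_varT[OF eq(2)] by blast
  have "varS * x = varS * (w * h1 + w' * h2)"
    unfolding uv(1) w w' by (simp add: algebra_simps)
  then have "x = w * h1 + w' * h2" by simp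
  moreover have "varS * (w * h1) \<in> forms (Suc m)" "varS * (w' * h2) \<in> forms (Suc m)"
    using uv w w' by (simp_all only: mult.assoc)
  then have "w * h1 \<in> forms m" "w' * h2 \<in> forms m" unfolding varS_mult_in_forms_iff .
  ultimately show ?thesis by (rule gen2I)
qed

text \<open>The first of the \<open>k\<close> descents starts in degree \<open>m + k\<close> and
  compares representations in degree \<open>m + k + 1\<close>; this is the source of the
  bound.\<close>

lemma gen2_descend_many:
  fixes h1 h2 :: "'k::field poly poly"
  assumes cop: "Rings.coprime h1 h2" and h: "h1 \<noteq> 0" "h2 \<noteq> 0" "h1 \<in> forms e1" "h2 \<in> forms e2"
    and m: "m + k + 1 < e1 + e2"
    and x: "x \<in> forms m"
    and kx: "\<And>p q. p + q = k \<Longrightarrow> varS ^ p * varT ^ q * x \<in> gen2 h1 h2 (m + k)"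
  shows "x \<in> gen2 h1 h2 m"
  using m x kx
proof (induction k arbitrary: x m)
  case 0
  from 0(3)[of 0 0] show ?case by simp
next
  case (Suc k)
  show ?case
  proof (rule gen2_descend[OF cop h])
    show "m + 2 < e1 + e2" using Suc.prems by simp
    show "varS * x \<in> gen2 h1 h2 (Suc m)"
    proof (rule Suc.IH)
      fix p q assume "p + q = k"
      then have "varS ^ Suc p * varT ^ q * x \<in> gen2 h1 h2 (m + Suc k)" by (intro Suc.prems) auto
      then show "varS ^ p * varT ^ q * (varS * x) \<in> gen2 h1 h2 (Suc m + k)"
        by (simp add: algebra_simps)
    qed (use Suc.prems in auto)
    show "varT * x \<in> gen2 h1 h2 (Suc m)"
    proof (rule Suc.IH)
      fix p q assume "p + q = k"
      then have "varS ^ p * varT ^ Suc q * x \<in> gen2 h1 h2 (m + Suc k)" by (intro Suc.prems) auto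
      then show "varS ^ p * varT ^ q * (varT * x) \<in> gen2 h1 h2 (Suc m + k)"
        by (simp add: algebra_simps)
    qed (use Suc.prems in auto)
  qed
qed

subsection \<open>Forms with coefficients in a ring of functions\<close>

context fun_ring
begin

definition form_fun :: "('x \<Rightarrow> 'k poly poly) \<Rightarrow> bool" where
  "form_fun F \<longleftrightarrow> (\<forall>i j. (\<lambda>x. cf (F x) i j) \<in> A)"

lemma form_funD: "form_fun F \<Longrightarrow> (\<lambda>x. cf (F x) i j) \<in> A"
  by (simp add: form_fun_def)

lemma form_fun_const [simp, intro]: "form_fun (\<lambda>_. p)"
  by (simp add: form_fun_def)

lemma form_fun_add [intro]: "form_fun F \<Longrightarrow> form_fun G \<Longrightarrow> form_fun (\<lambda>x. F x + G x)"
  by (auto simp: form_fun_def)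

lemma form_fun_mult [intro]: "form_fun F \<Longrightarrow> form_fun G \<Longrightarrow> form_fun (\<lambda>x. F x * G x)"
  unfolding form_fun_def cf_mult by (intro allI sum mult) auto

lemma form_fun_smult [intro]: "f \<in> A \<Longrightarrow> form_fun G \<Longrightarrow> form_fun (\<lambda>x. smult [:f x:] (G x))"
  unfolding form_fun_def by auto

lemma form_fun_sum [intro]: "(\<And>i. i \<in> I \<Longrightarrow> form_fun (F i)) \<Longrightarrow> form_fun (\<lambda>x. \<Sum>i\<in>I. F i x)"
  unfolding form_fun_def cf_sum by auto

lemma form_fun_form_of [intro]: "(\<And>i. i \<le> m \<Longrightarrow> c i \<in> A) \<Longrightarrow> form_fun (\<lambda>x. form_of m (\<lambda>i. c i x))"
  unfolding form_of_def by (intro form_fun_sum form_fun_smult form_fun_const) auto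

text \<open>Comparing coefficients turns equations between forms into a scalar system whose rows are
  pairs of an equation and an exponent. The left inverse recovers each unknown, up to the common
  factor \<open>f\<close>, from the coefficients of the left-hand sides. That the entries are forms
  matters only at \<open>x0\<close>, where injectivity is translated into coefficients.\<close>

lemma form_system_left_inverse:
  fixes B :: "'i \<Rightarrow> 'x \<Rightarrow> 'q \<Rightarrow> 'k poly poly"
  assumes "finite I" "finite Q"
    and B: "\<And>i q. i \<in> I \<Longrightarrow> q \<in> Q \<Longrightarrow> B i x0 q \<in> forms (dg q)"
    and BA: "\<And>i q a. i \<in> I \<Longrightarrow> q \<in> Q \<Longrightarrow> a \<le> dg q \<Longrightarrow> (\<lambda>x. cf (B i x q) a (dg q - a)) \<in> A"
    and inj: "\<And>y. (\<forall>q\<in>Q. (\<Sum>i\<in>I. smult [:y i:] (B i x0 q)) = 0) \<Longrightarrow> \<forall>i\<in>I. y i = 0"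
  obtains f N where "f \<in> A" "f x0 \<noteq> 0" "\<And>i r. i \<in> I \<Longrightarrow> r \<in> Sigma Q (\<lambda>q. {..dg q}) \<Longrightarrow> N i r \<in> A"
    "\<And>x y i. i \<in> I \<Longrightarrow> f x * y i = (\<Sum>r\<in>Sigma Q (\<lambda>q. {..dg q}).
        N i r x * cf (\<Sum>j\<in>I. smult [:y j:] (B j x (fst r))) (snd r) (dg (fst r) - snd r))"
proof -
  let ?R = "Sigma Q (\<lambda>q. {..dg q})"
  define M where "M = (\<lambda>r i x. cf (B i x (fst r)) (snd r) (dg (fst r) - snd r))"
  have M: "(\<Sum>i\<in>I. M r i x * y i) = cf (\<Sum>j\<in>I. smult [:y j:] (B j x (fst r))) (snd r) (dg (fst r) - snd r)"
    for r x y unfolding cf_sum by (intro sum.cong) (auto simp: M_def)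
  have "\<exists>f\<in>A. f x0 \<noteq> 0 \<and> (\<exists>N. (\<forall>i\<in>I. \<forall>r\<in>?R. N i r \<in> A) \<and>
    (\<forall>x. \<forall>i\<in>I. \<forall>j\<in>I. (\<Sum>r\<in>?R. N i r x * M r j x) = (if i = j then f x else 0)))"
  proof (rule left_inverse_near_injective[OF \<open>finite I\<close>])
    show "finite ?R" using assms by auto
    show "M r i \<in> A" if "r \<in> ?R" "i \<in> I" for r i
      using that unfolding M_def by (intro BA) auto
    fix y assume y: "\<forall>r\<in>?R. (\<Sum>i\<in>I. M r i x0 * y i) = 0"
    have "(\<Sum>i\<in>I. smult [:y i:] (B i x0 q)) = 0" if "q \<in> Q" for q
    proof (rule forms_eqI)
      show "(\<Sum>i\<in>I. smult [:y i:] (B i x0 q)) \<in> forms (dg q)"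
        using B that by (intro sum_in_forms smult_in_forms) auto
      fix a assume "a \<le> dg q"
      then show "cf (\<Sum>i\<in>I. smult [:y i:] (B i x0 q)) a (dg q - a) = cf 0 a (dg q - a)"
        using bspec[OF y, of "(q, a)"] that unfolding M by simp
    qed simp
    then show "\<forall>i\<in>I. y i = 0" by (intro inj) auto
  qed
  then obtain f N where f: "f \<in> A" "f x0 \<noteq> 0" and NA: "\<forall>i\<in>I. \<forall>r\<in>?R. N i r \<in> A"
    and N: "\<forall>x. \<forall>i\<in>I. \<forall>j\<in>I. (\<Sum>r\<in>?R. N i r x * M r j x) = (if i = j then f x else 0)"
    by (elim bexE conjE exE)
  show thesis
  proof (rule that[OF f])
    show "N i r \<in> A" if "i \<in> I" "r \<in> ?R" for i r using NA that by blast
    fix x y i assume i: "i \<in> I"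
    have "(\<Sum>r\<in>?R. N i r x * (\<Sum>j\<in>I. M r j x * y j)) = (\<Sum>j\<in>I. (\<Sum>r\<in>?R. N i r x * M r j x) * y j)"
      unfolding sum_distrib_left sum_distrib_right by (subst sum.swap) (simp add: mult.assoc)
    also have "\<dots> = (\<Sum>j\<in>I. if i = j then f x * y j else 0)"
      using N i by (intro sum.cong) auto
    also have "\<dots> = f x * y i" using i \<open>finite I\<close> by simp
    finally show "f x * y i = (\<Sum>r\<in>?R. N i r x *
        cf (\<Sum>j\<in>I. smult [:y j:] (B j x (fst r))) (snd r) (dg (fst r) - snd r))"
      unfolding M by simp
  qed
qed

text \<open>Mostly read backwards: wherever the system has a nontrivial solution, \<open>f\<close>
  vanishes, although it does not vanish at \<open>x0\<close>.\<close>

lemma form_system_injective_near: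
  fixes B :: "'i \<Rightarrow> 'x \<Rightarrow> 'q \<Rightarrow> 'k poly poly"
  assumes "finite I" "finite Q"
    and "\<And>i q. i \<in> I \<Longrightarrow> q \<in> Q \<Longrightarrow> B i x0 q \<in> forms (dg q)"
    and "\<And>i q a. i \<in> I \<Longrightarrow> q \<in> Q \<Longrightarrow> a \<le> dg q \<Longrightarrow> (\<lambda>x. cf (B i x q) a (dg q - a)) \<in> A"
    and "\<And>y. (\<forall>q\<in>Q. (\<Sum>i\<in>I. smult [:y i:] (B i x0 q)) = 0) \<Longrightarrow> \<forall>i\<in>I. y i = 0"
  obtains f where "f \<in> A" "f x0 \<noteq> 0"
    "\<And>x y i. f x \<noteq> 0 \<Longrightarrow> (\<forall>q\<in>Q. (\<Sum>i\<in>I. smult [:y i:] (B i x q)) = 0) \<Longrightarrow> i \<in> I \<Longrightarrow> y i = 0"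
proof -
  obtain f N where f: "f \<in> A" "f x0 \<noteq> 0" and
    N: "\<And>x y i. i \<in> I \<Longrightarrow> f x * y i = (\<Sum>r\<in>Sigma Q (\<lambda>q. {..dg q}).
        N i r x * cf (\<Sum>j\<in>I. smult [:y j:] (B j x (fst r))) (snd r) (dg (fst r) - snd r))"
  proof (rule form_system_left_inverse[of I Q B x0 dg], goal_cases)
    case (3 i q)
    from 3(2,3) show ?case by (rule assms(3))
  next
    case (4 i q a)
    from 4(2-4) show ?case by (rule assms(4))
  next
    case (5 y)
    from 5(2) show ?case by (rule assms(5))
  qed (use assms(1,2) in blast)+
  show thesis
  proof (rule that[OF f])
    fix x y i assume *: "f x \<noteq> 0" "\<forall>q\<in>Q. (\<Sum>i\<in>I. smult [:y i:] (B i x q)) = 0" "i \<in> I"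
    have "f x * y i = 0" unfolding N[OF *(3)] using *(2) by (intro sum.neutral) auto
    with * show "y i = 0" by simp
  qed
qed

text \<open>A form of Cramer's rule: where \<open>f\<close> is nonzero, a solution equals a quotient
  of elements of the ring.\<close>

lemma form_system_solution:
  fixes B :: "'i \<Rightarrow> 'x \<Rightarrow> 'q \<Rightarrow> 'k poly poly"
  assumes "finite I" "finite Q"
    and "\<And>i q. i \<in> I \<Longrightarrow> q \<in> Q \<Longrightarrow> B i x0 q \<in> forms (dg q)"
    and "\<And>i q a. i \<in> I \<Longrightarrow> q \<in> Q \<Longrightarrow> a \<le> dg q \<Longrightarrow> (\<lambda>x. cf (B i x q) a (dg q - a)) \<in> A"
    and "\<And>y. (\<forall>q\<in>Q. (\<Sum>i\<in>I. smult [:y i:] (B i x0 q)) = 0) \<Longrightarrow> \<forall>i\<in>I. y i = 0"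
    and C: "\<And>q a. q \<in> Q \<Longrightarrow> a \<le> dg q \<Longrightarrow> (\<lambda>x. cf (C x q) a (dg q - a)) \<in> A"
    and sol: "\<And>x q. x \<in> X \<Longrightarrow> q \<in> Q \<Longrightarrow> (\<Sum>i\<in>I. smult [:y i x:] (B i x q)) = C x q"
  obtains f g where "f \<in> A" "f x0 \<noteq> 0" "\<And>i. i \<in> I \<Longrightarrow> g i \<in> A"
    "\<And>i x. i \<in> I \<Longrightarrow> x \<in> X \<Longrightarrow> f x * y i x = g i x"
proof -
  let ?R = "Sigma Q (\<lambda>q. {..dg q})"
  obtain f N where f: "f \<in> A" "f x0 \<noteq> 0" and NA: "\<And>i r. i \<in> I \<Longrightarrow> r \<in> ?R \<Longrightarrow> N i r \<in> A" and
    N: "\<And>x y i. i \<in> I \<Longrightarrow> f x * y i = (\<Sum>r\<in>?R.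
        N i r x * cf (\<Sum>j\<in>I. smult [:y j:] (B j x (fst r))) (snd r) (dg (fst r) - snd r))"
  proof (rule form_system_left_inverse[of I Q B x0 dg], goal_cases)
    case (3 i q)
    from 3(2,3) show ?case by (rule assms(3))
  next
    case (4 i q a)
    from 4(2-4) show ?case by (rule assms(4))
  next
    case (5 y)
    from 5(2) show ?case by (rule assms(5))
  qed (use assms(1,2) in blast)+
  define g where "g = (\<lambda>i x. \<Sum>r\<in>?R. N i r x * cf (C x (fst r)) (snd r) (dg (fst r) - snd r))"
  show thesis
  proof (rule that[OF f])
    show "g i \<in> A" if "i \<in> I" for i
      unfolding g_def using NA that C by (intro sum mult) auto
    show "f x * y i x = g i x" if "i \<in> I" "x \<in> X" for i x
      using N[OF that(1), of x "\<lambda>i. y i x"] sol[OF that(2)] by (auto simp: g_def intro!: sum.cong)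
  qed
qed

end

section \<open>Spaces of forms and their ancestors\<close>

subsection \<open>Finite-dimensional subspaces\<close>

locale vector_space' = vector_space
begin

lemma direct_sum_independent:
  assumes "independent A" "independent B" "finite A" "finite B"
    and 0: "\<And>x. x \<in> span A \<Longrightarrow> x \<in> span B \<Longrightarrow> x = 0"
  shows "independent (A \<union> B)" "A \<inter> B = {}"
proof -
  show disj: "A \<inter> B = {}"
    using 0 dependent_zero assms(1) span_base by blast
  show "independent (A \<union> B)"
  proof (rule independent_if_scalars_zero)
    show "finite (A \<union> B)" using assms by simp
    fix f x assume eq: "(\<Sum>x\<in>A \<union> B. f x *s x) = 0" and x: "x \<in> A \<union> B"
    have "(\<Sum>x\<in>A. f x *s x) + (\<Sum>x\<in>B. f x *s x) = 0"
      using eq unfolding sum.union_disjoint[OF assms(3,4) disj] .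
    then have *: "(\<Sum>x\<in>A. f x *s x) = (\<Sum>x\<in>B. (- f x) *s x)"
      by (simp add: eq_neg_iff_add_eq_0 sum_negf)
    have "(\<Sum>x\<in>A. f x *s x) \<in> span A" by (intro span_sum span_scale span_base)
    moreover have "(\<Sum>x\<in>A. f x *s x) \<in> span B"
      unfolding * by (intro span_sum span_scale span_base)
    ultimately have "(\<Sum>x\<in>A. f x *s x) = 0" by (rule 0)
    with * have "(\<Sum>x\<in>A. f x *s x) = 0" "(\<Sum>x\<in>B. (- f x) *s x) = 0" by simp_all
    then show "f x = 0"
      using independentD[OF assms(1,3) order_refl, of f x]
        independentD[OF assms(2,4) order_refl, of "\<lambda>x. - f x" x] x by auto
  qed
qed

text \<open>The space of all polynomials is infinite-dimensional. Dimension counts are therefore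
  made for subspaces inside the span of a finite set.\<close>

definition fin_sub :: "'b set \<Rightarrow> bool" where
  "fin_sub X \<longleftrightarrow> subspace X \<and> (\<exists>W. finite W \<and> X \<subseteq> span W)"

lemma fin_sub_subspace: "fin_sub X \<Longrightarrow> subspace X"
  by (simp add: fin_sub_def)

lemma fin_sub_subset: "fin_sub Y \<Longrightarrow> subspace X \<Longrightarrow> X \<subseteq> Y \<Longrightarrow> fin_sub X"
  by (auto simp: fin_sub_def)

lemma fin_sub_independent: "fin_sub X \<Longrightarrow> independent B \<Longrightarrow> B \<subseteq> X \<Longrightarrow> finite B"
  unfolding fin_sub_def using independent_span_bound by (meson subset_trans)

lemma fin_sub_span: "finite B \<Longrightarrow> fin_sub (span B)"
  by (auto simp: fin_sub_def)

lemma fin_sub_extend: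
  assumes "fin_sub X" "independent C" "C \<subseteq> X"
  obtains B where "C \<subseteq> B" "B \<subseteq> X" "independent B" "span B = X" "finite B" "card B = dim X"
proof -
  obtain B where B: "C \<subseteq> B" "B \<subseteq> X" "independent B" "X \<subseteq> span B"
    using maximal_independent_subset_extend[OF assms(3,2)] by blast
  have "span B \<subseteq> X" using B assms(1) by (intro span_minimal) (auto simp: fin_sub_def)
  then show thesis
    using B basis_card_eq_dim[OF B(2,4,3)] fin_sub_independent[OF assms(1) B(3,2)]
    by (intro that[of B]) auto
qed

lemma fin_sub_basis:
  assumes "fin_sub X"
  obtains B where "B \<subseteq> X" "independent B" "span B = X" "finite B" "card B = dim X"
  using fin_sub_extend[OF assms independent_empty] by auto

lemma fin_sub_complement:
  assumes X: "fin_sub X" and Y: "fin_sub Y" "X \<subseteq> Y"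
  obtains Z where "fin_sub Z" "Z \<subseteq> Y" "\<And>x. x \<in> X \<Longrightarrow> x \<in> Z \<Longrightarrow> x = 0"
    "Y = {x + z | x z. x \<in> X \<and> z \<in> Z}" "dim Y = dim X + dim Z"
proof -
  obtain B where B: "B \<subseteq> X" "independent B" "span B = X" "finite B" "card B = dim X"
    using fin_sub_basis[OF X] .
  have "B \<subseteq> Y" using B(1) Y(2) by blast
  then obtain C where C: "B \<subseteq> C" "C \<subseteq> Y" "independent C" "span C = Y" "finite C" "card C = dim Y"
    using fin_sub_extend[OF Y(1) B(2)] by metis
  let ?D = "C - B"
  have D: "independent ?D" "finite ?D" using C(3,5) independent_mono[of C ?D] by auto
  have CBD: "B \<union> ?D = C" "B \<inter> ?D = {}" using C(1) by auto
  show thesis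
  proof (rule that[of "span ?D"])
    show "fin_sub (span ?D)" using D by (intro fin_sub_span)
    show "span ?D \<subseteq> Y" using C(4) span_mono[of ?D C] by blast
    show "Y = {x + z | x z. x \<in> X \<and> z \<in> span ?D}"
      using C(4) span_Un[of B ?D] CBD B(3) by simp
    show "dim Y = dim X + dim (span ?D)"
      using C(5,6) B(4,5) D dim_eq_card_independent[OF D(1)] card_Un_disjoint[OF B(4) D(2) CBD(2)] CBD(1)
      by simp
    fix x assume "x \<in> X" "x \<in> span ?D"
    then have "x \<in> range (\<lambda>f. \<Sum>v\<in>B. f v *s v)" "x \<in> range (\<lambda>f. \<Sum>v\<in>?D. f v *s v)"
      using span_finite[OF B(4)] span_finite[OF D(2)] B(3) by simp_all
    then obtain f g where f: "x = (\<Sum>v\<in>B. f v *s v)" and g: "x = (\<Sum>v\<in>?D. g v *s v)"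
      by blast
    let ?k = "\<lambda>v. if v \<in> B then f v else - g v"
    have "(\<Sum>v\<in>C. ?k v *s v) = (\<Sum>v\<in>B. ?k v *s v) + (\<Sum>v\<in>?D. ?k v *s v)"
      using sum.union_disjoint[OF B(4) D(2) CBD(2), of "\<lambda>v. ?k v *s v"]
      unfolding CBD(1) .
    also have "(\<Sum>v\<in>B. ?k v *s v) = x" unfolding f by (intro sum.cong) auto
    also have "(\<Sum>v\<in>?D. ?k v *s v) = - x" unfolding g sum_negf[symmetric] by (intro sum.cong) auto
    finally have "(\<Sum>v\<in>C. ?k v *s v) = 0" by simp
    from independentD[OF C(3,5) order_refl this] have "?k v = 0" if "v \<in> C" for v using that .
    then have "f v = 0" if "v \<in> B" for v using that C(1) by (metis subsetD)
    then show "x = 0" unfolding f by simp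
  qed
qed

lemma fin_sub_dim_mono: "fin_sub Y \<Longrightarrow> subspace X \<Longrightarrow> X \<subseteq> Y \<Longrightarrow> dim X \<le> dim Y"
  using fin_sub_complement[OF fin_sub_subset, of Y X] by (metis le_add1)

lemma fin_sub_dim_eq:
  assumes "fin_sub Y" "subspace X" "X \<subseteq> Y" "dim Y \<le> dim X"
  shows "X = Y"
proof -
  note X = fin_sub_subset[OF assms(1-3)]
  obtain B where B: "B \<subseteq> X" "independent B" "span B = X" "finite B" "card B = dim X"
    using fin_sub_basis[OF X] .
  have "B \<subseteq> Y" using B assms by blast
  then obtain C where C: "B \<subseteq> C" "C \<subseteq> Y" "independent C" "span C = Y" "finite C" "card C = dim Y"
    using fin_sub_extend[OF assms(1) B(2)] by metis
  have "B = C" using card_seteq[OF C(5,1)] C(6) B(5) assms(4) by simp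
  with B C show ?thesis by simp
qed

lemma dim_direct_sum:
  assumes X: "fin_sub X" and Y: "fin_sub Y" and 0: "\<And>x. x \<in> X \<Longrightarrow> x \<in> Y \<Longrightarrow> x = 0"
  shows "dim {x + y | x y. x \<in> X \<and> y \<in> Y} = dim X + dim Y"
proof -
  obtain B where B: "B \<subseteq> X" "independent B" "span B = X" "finite B" "card B = dim X"
    using fin_sub_basis[OF X] .
  obtain C where C: "C \<subseteq> Y" "independent C" "span C = Y" "finite C" "card C = dim Y"
    using fin_sub_basis[OF Y] .
  have BC: "independent (B \<union> C)" "B \<inter> C = {}"
    using direct_sum_independent[OF B(2) C(2) B(4) C(4)] 0 B(3) C(3) by auto
  have "{x + y | x y. x \<in> X \<and> y \<in> Y} = span (B \<union> C)"
    unfolding span_Un B(3) C(3) by simp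
  then show ?thesis
    using dim_eq_card_independent[OF BC(1)] card_Un_disjoint[OF B(4) C(4) BC(2)] B(5) C(5) by simp
qed

lemma fin_sub_sum:
  assumes "fin_sub X" "fin_sub Y"
  shows "fin_sub {x + y | x y. x \<in> X \<and> y \<in> Y}"
proof -
  obtain B where B: "span B = X" "finite B" using fin_sub_basis[OF assms(1)] by metis
  obtain C where C: "span C = Y" "finite C" using fin_sub_basis[OF assms(2)] by metis
  have "{x + y | x y. x \<in> X \<and> y \<in> Y} = span (B \<union> C)" unfolding span_Un B C by simp
  then show ?thesis using B C by (simp add: fin_sub_span)
qed

lemma dim_0 [simp]: "dim {0} = 0"
  using dim_eq_card_independent[OF independent_empty] dim_span[of "{}"] by simp

lemma linear_injective_image:
  assumes f: "Vector_Spaces.linear scale scale f" and inj: "\<And>x. f x = 0 \<Longrightarrow> x = 0" and X: "fin_sub X"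
  shows "fin_sub (f ` X)" "dim (f ` X) = dim X"
proof -
  interpret f: module_hom scale scale f using f by (simp add: Vector_Spaces.linear_def)
  obtain B where B: "B \<subseteq> X" "independent B" "span B = X" "finite B" "card B = dim X"
    using fin_sub_basis[OF X] .
  have i: "inj f" using inj f.inj_iff_eq_0 by blast
  then have "independent (f ` B)" using f.independent_inj_image B(2) by blast
  moreover have s: "span (f ` B) = f ` X" using f.span_image[of B] B(3) by simp
  ultimately show "dim (f ` X) = dim X"
    using dim_eq_card[of "f ` B" "f ` X"] B(5) card_image[of f B] i subspace_span[of "f ` B"]
    by (metis inj_on_subset span_span subset_UNIV)
  show "fin_sub (f ` X)" unfolding s[symmetric] using B(4) by (intro fin_sub_span) simp
qed

lemma dim_indexed_basis:
  assumes "finite I" and V: "V = range (\<lambda>c. \<Sum>i\<in>I. c i *s w i)"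
    and ind: "\<And>c. (\<Sum>i\<in>I. c i *s w i) = 0 \<Longrightarrow> \<forall>i\<in>I. c i = 0"
  shows "dim V = card I" "fin_sub V"
proof -
  have inj: "inj_on w I"
  proof (rule inj_onI, rule ccontr)
    fix i j assume ij: "i \<in> I" "j \<in> I" "w i = w j" "i \<noteq> j"
    have "(\<Sum>k\<in>I. (if k = i then 1 else if k = j then - 1 else 0) *s w k) =
      (\<Sum>k\<in>I. (if k = i then w k else 0) + (if k = j then - w k else 0))"
      using ij by (intro sum.cong) auto
    also have "\<dots> = 0" using ij assms(1) by (simp add: sum.distrib)
    finally have "\<forall>k\<in>I. (if k = i then 1 else if k = j then - 1 else 0) = (0::'a)"
      by (intro ind)
    with ij(1) show False by auto
  qed
  have sum: "(\<Sum>v\<in>w ` I. f v *s v) = (\<Sum>i\<in>I. f (w i) *s w i)" for f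
    using sum.reindex[OF inj, of "\<lambda>v. f v *s v"] by simp
  have "independent (w ` I)"
  proof (rule independent_if_scalars_zero)
    fix f x assume "(\<Sum>x\<in>w ` I. f x *s x) = 0" "x \<in> w ` I"
    then show "f x = 0" unfolding sum using ind[of "\<lambda>i. f (w i)"] by auto
  qed (use assms in auto)
  moreover have "span (w ` I) = V"
  proof -
    have "V \<subseteq> span (w ` I)"
      unfolding V by (intro image_subsetI span_sum span_scale span_base imageI)
    moreover have "span (w ` I) \<subseteq> V"
      unfolding V span_finite[OF finite_imageI[OF assms(1)]] sum by auto
    ultimately show ?thesis by blast
  qed
  ultimately show "dim V = card I" "fin_sub V"
    using dim_eq_card_independent[of "w ` I"] card_image[OF inj] fin_sub_span[of "w ` I"] assms(1)
    by auto
qed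

end

interpretation vs: vector_space' "\<lambda>(c::'k::field) (p::'k poly poly). smult [:c:] p"
proof unfold_locales
  show "smult [:a + b:] p = smult [:a:] p + smult [:b:] p" for a b :: 'k and p
    by (metis add_pCons add_0 smult_add_left)
qed (simp_all add: smult_add_right mult.commute)

lemma forms_range: "forms m = range (\<lambda>c. \<Sum>i\<le>m. smult [:c i:] (varS ^ (m - i) * varT ^ i))"
proof -
  have "p \<in> range (form_of m)" if "p \<in> forms m" for p :: "'a poly poly"
    using form_of_cf[OF that] by (metis rangeI)
  then show ?thesis unfolding form_of_def[symmetric] by auto
qed

lemma dim_forms: "vs.dim (forms m :: 'k::field poly poly set) = Suc m"
  and fin_sub_forms [simp]: "vs.fin_sub (forms m :: 'k::field poly poly set)"
proof -
  have "\<forall>i\<in>{..m}. c i = 0" if "(\<Sum>i\<le>m. smult [:c i:] (varS ^ (m - i) * varT ^ i)) = 0" for c :: "nat \<Rightarrow> 'k"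
  proof
    fix i assume "i \<in> {..m}"
    then have "c i = cf (form_of m c) i (m - i)" by (simp add: cf_form_of)
    then show "c i = 0" using that by (simp add: form_of_def)
  qed
  from vs.dim_indexed_basis[OF finite_atMost forms_range[of m] this]
  show "vs.dim (forms m :: 'k poly poly set) = Suc m" "vs.fin_sub (forms m :: 'k poly poly set)"
    by simp_all
qed

lemma fin_sub_in_forms: "vs.subspace V \<Longrightarrow> V \<subseteq> forms m \<Longrightarrow> vs.fin_sub V"
  using vs.fin_sub_subset[OF fin_sub_forms] .

lemma linear_mult_form: "Vector_Spaces.linear (\<lambda>(c::'k::field) p. smult [:c:] p) (\<lambda>c p. smult [:c:] p) (\<lambda>p. p * h)"
  unfolding Vector_Spaces.linear_iff using vs.vector_space_axioms by (auto simp: algebra_simps)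

subsection \<open>The colon space \<open>V : R_1\<close>\<close>

definition down :: "'k::field poly poly set \<Rightarrow> 'k poly poly set" where
  "down V = {h. varS * h \<in> V \<and> varT * h \<in> V}"

lemma down_subspace: "vs.subspace V \<Longrightarrow> vs.subspace (down V)"
  by (intro vs.subspaceI) (auto simp: down_def algebra_simps intro: vs.subspace_0 vs.subspace_add vs.subspace_scale)

lemma down_in_forms:
  assumes "V \<subseteq> forms (Suc m)"
  shows "down V \<subseteq> forms m"
proof
  fix h assume "h \<in> down V"
  then have "varS * h \<in> forms (Suc m)" using assms by (auto simp: down_def)
  then show "h \<in> forms m" unfolding varS_mult_in_forms_iff .
qed

lemma down_forms_0:
  assumes "V \<subseteq> forms 0"
  shows "down V \<subseteq> {0}"
proof
  fix h assume "h \<in> down V"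
  then have "h * varS \<in> forms 0" using assms by (auto simp: down_def mult.commute)
  then show "h \<in> {0}" using factor_in_forms[of h varS 0 "Suc 0"] by auto
qed

lemma down_in_forms': "V \<subseteq> forms m \<Longrightarrow> down V \<subseteq> forms (m - 1)"
  using down_in_forms[of V "m - 1"] down_forms_0[of V] by (cases m) auto

lemma mult_image_dim:
  assumes "h \<noteq> 0" "vs.fin_sub X"
  shows "vs.fin_sub ((\<lambda>p. p * h) ` X)" "vs.dim ((\<lambda>p. p * h) ` X) = vs.dim X"
  using vs.linear_injective_image[OF linear_mult_form _ assms(2), of h] assms(1) by auto

text \<open>Otherwise multiplication by \<open>varS\<close> maps \<open>down V\<close> onto
  \<open>V\<close>. If \<open>z\<close> is in \<open>down V\<close>, then \<open>varT * z\<close>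
  lies in \<open>V\<close> and is again divisible by \<open>varS\<close>; iterating, every element
  of \<open>V\<close> is divisible by all powers of \<open>varS\<close>, which is impossible for a
  nonzero form of degree \<open>m\<close>.\<close>

lemma down_dim_less:
  assumes V: "vs.subspace V" "V \<subseteq> forms m" and "V \<noteq> {0}"
  shows "vs.dim (down V) < vs.dim V"
proof (rule ccontr)
  assume nless: "\<not> ?thesis"
  note fV = fin_sub_in_forms[OF V]
  have fD: "vs.fin_sub (down V)"
    using fin_sub_in_forms[OF down_subspace[OF V(1)] down_in_forms'[OF V(2)]] .
  have sub: "(\<lambda>p. p * varS) ` down V \<subseteq> V" by (auto simp: down_def mult.commute)
  have eq: "(\<lambda>p. p * varS) ` down V = V"
    using vs.fin_sub_dim_eq[OF fV vs.fin_sub_subspace sub] mult_image_dim[OF varS_neq_0 fD] nless by simp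
  have dvd: "\<exists>y. x = varS ^ k * y" if "x \<in> V" for k x
    using that
  proof (induction k arbitrary: x)
    case (Suc k)
    from Suc.prems obtain z where z: "x = z * varS" "z \<in> down V" using eq by blast
    then have "varT * z \<in> V" by (simp add: down_def)
    from Suc.IH[OF this] obtain y where y: "varT * z = varS ^ k * y" by blast
    have "\<exists>z'. z = varS ^ k * z'" using y
    proof (induction k arbitrary: z y)
      case (Suc k)
      from Suc.prems have "varS * (varS ^ k * y) = varT * z" by (simp add: mult.assoc)
      from varS_cancel_varT[OF this] obtain w where w: "varS ^ k * y = varT * w" "z = varS * w" by blast
      from Suc.IH[OF w(1)[symmetric]] w(2) show ?case by (auto simp: mult.assoc)
    qed simp
    with z show ?case by (auto simp: mult_ac)
  qed simp
  obtain x where x: "x \<in> V" "x \<noteq> 0" using assms(3) vs.subspace_0[OF V(1)] by blast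
  obtain y where y: "x = y * varS ^ Suc m" using dvd[OF x(1), of "Suc m"] by (auto simp: mult.commute)
  have "y * varS ^ Suc m \<in> forms m" using x V y by blast
  from factor_in_forms[OF this varS_power_in_forms] x y show False by auto
qed

text \<open>With \<open>U = down V\<close>, the map from pairs in \<open>U\<close> to
  \<open>V\<close> sending \<open>(x, y)\<close> to \<open>varS * x + varT * y\<close> has kernel
  isomorphic to \<open>down U\<close>, because its kernel consists of Koszul relations. The
  inequality is rank-nullity, and equality means surjectivity. A complement \<open>Z\<close> of the
  multiples of \<open>varS\<close> replaces the kernel computation.\<close>

lemma down_dim_convex:
  assumes V: "vs.subspace V" "V \<subseteq> forms m"
  shows "2 * vs.dim (down V) \<le> vs.dim V + vs.dim (down (down V))"
    and "vs.dim V + vs.dim (down (down V)) \<le> 2 * vs.dim (down V) \<Longrightarrow>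
      V = {varS * x + varT * y | x y. x \<in> down V \<and> y \<in> down V}"
proof -
  let ?U = "down V" and ?U' = "down (down V)"
  note sU = down_subspace[OF V(1)]
  note fV = fin_sub_in_forms[OF V]
  have fU: "vs.fin_sub ?U" using fin_sub_in_forms[OF sU down_in_forms'[OF V(2)]] .
  have fU': "vs.fin_sub ?U'"
    using fin_sub_in_forms[OF down_subspace[OF sU] down_in_forms'[OF down_in_forms'[OF V(2)]]] .
  have sub: "(\<lambda>p. p * varS) ` ?U' \<subseteq> ?U" by (auto simp: down_def mult.commute)
  obtain Z where Z: "vs.fin_sub Z" "Z \<subseteq> ?U" "\<And>x. x \<in> (\<lambda>p. p * varS) ` ?U' \<Longrightarrow> x \<in> Z \<Longrightarrow> x = 0"
    "vs.dim ?U = vs.dim ((\<lambda>p. p * varS) ` ?U') + vs.dim Z"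
    by (rule vs.fin_sub_complement[OF mult_image_dim(1)[OF varS_neq_0 fU'] fU sub]) blast
  let ?X = "(\<lambda>p. p * varS) ` ?U" and ?Y = "(\<lambda>p. p * varT) ` Z"
  let ?W = "{x + y | x y. x \<in> ?X \<and> y \<in> ?Y}"
  have X: "vs.fin_sub ?X" "vs.dim ?X = vs.dim ?U" using mult_image_dim[OF varS_neq_0 fU] .
  have Y: "vs.fin_sub ?Y" "vs.dim ?Y = vs.dim Z" using mult_image_dim[OF varT_neq_0 Z(1)] .
  have "x = 0" if xX: "x \<in> ?X" and xY: "x \<in> ?Y" for x
  proof -
    obtain u z where u: "u \<in> ?U" "x = u * varS" and z: "z \<in> Z" "x = z * varT"
      using xX xY by blast
    have "varS * u = varT * z" using u(2) z(2) by (simp add: mult.commute)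
    from varS_cancel_varT[OF this] obtain w where w: "u = varT * w" "z = varS * w" by blast
    have "w \<in> ?U'" using u(1) z(1) Z(2) w by (auto simp: down_def[of "down V"])
    then have "z \<in> (\<lambda>p. p * varS) ` ?U'" using w(2) by (auto simp: mult.commute)
    from Z(3)[OF this z(1)] z(2) show "x = 0" by simp
  qed
  then have dW: "vs.dim ?W = vs.dim ?U + vs.dim Z"
    using vs.dim_direct_sum[OF X(1) Y(1)] X(2) Y(2) by simp
  have WV: "?W \<subseteq> V"
  proof
    fix x assume "x \<in> ?W"
    then obtain u z where u: "u \<in> down V" "z \<in> Z" "x = u * varS + z * varT" by blast
    then have "z \<in> down V" using Z(2) by blast
    with u show "x \<in> V" using vs.subspace_add[OF V(1)] by (simp add: down_def mult.commute)
  qed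
  have sW: "vs.subspace ?W" using vs.fin_sub_subspace[OF vs.fin_sub_sum[OF X(1) Y(1)]] .
  have dim: "vs.dim ?W + vs.dim ?U' = 2 * vs.dim ?U"
    using dW Z(4) mult_image_dim(2)[OF varS_neq_0 fU'] by simp
  then show "2 * vs.dim (down V) \<le> vs.dim V + vs.dim (down (down V))"
    using vs.fin_sub_dim_mono[OF fV sW WV] by linarith
  assume "vs.dim V + vs.dim ?U' \<le> 2 * vs.dim ?U"
  then have W: "?W = V" using vs.fin_sub_dim_eq[OF fV sW WV] dim by linarith
  show "V = {varS * x + varT * y | x y. x \<in> down V \<and> y \<in> down V}"
  proof
    show "V \<subseteq> {varS * x + varT * y | x y. x \<in> down V \<and> y \<in> down V}"
    proof
      fix x assume "x \<in> V"
      then have "x \<in> ?W" by (simp only: W)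
      then obtain u z where u: "u \<in> down V" "z \<in> Z" "x = u * varS + z * varT" by blast
      then have "z \<in> down V" using Z(2) by blast
      with u show "x \<in> {varS * x + varT * y | x y. x \<in> down V \<and> y \<in> down V}"
        by (intro CollectI exI[of _ u] exI[of _ z]) (simp add: mult.commute)
    qed
    show "{varS * x + varT * y | x y. x \<in> down V \<and> y \<in> down V} \<subseteq> V"
      using vs.subspace_add[OF V(1)] by (auto simp: down_def)
  qed
qed

lemma forms_0_const: "p \<in> forms 0 \<longleftrightarrow> (\<exists>c. p = [:[:c:]:])"
proof
  assume "p \<in> forms 0"
  from form_of_cf[OF this] show "\<exists>c. p = [:[:c:]:]"
    by (intro exI[of _ "cf p 0 0"]) (simp add: form_of_def)
qed (auto intro!: formsI simp: coeff_pCons split: nat.splits)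

lemma const_in_forms [simp]: "[:[:c:]:] \<in> forms 0"
  by (auto simp: forms_0_const)

lemma const_multiples: "{u * h | u. u \<in> forms 0} = range (\<lambda>k. smult [:k:] h)"
proof (intro subset_antisym subsetI)
  fix x assume "x \<in> {u * h | u. u \<in> forms 0}"
  then obtain c where "x = [:[:c:]:] * h" by (auto simp only: forms_0_const)
  then have "x = smult [:c:] h" by simp
  then show "x \<in> range (\<lambda>k. smult [:k:] h)" by blast
next
  fix x assume "x \<in> range (\<lambda>k. smult [:k:] h)"
  then obtain c where "x = smult [:c:] h" by blast
  then have "x = [:[:c:]:] * h" by simp
  then show "x \<in> {u * h | u. u \<in> forms 0}" using const_in_forms by blast
qed

lemma forms_Suc_decompose:
  assumes "p \<in> forms (Suc m)"
  shows "\<exists>x\<in>forms m. \<exists>y\<in>forms m. p = varS * x + varT * y"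
  using forms_decompose[OF assms, of 1 1] by auto

text \<open>Convexity and strict decrease force a drop of 1 to repeat at every further step, until a
  line spanned by \<open>h\<close> remains. Each step is an equality in the convexity estimate, so
  \<open>V\<close> is rebuilt from that line by multiplication with the variables.\<close>

lemma down_dim_pred_imp_principal:
  assumes "vs.subspace V" "V \<subseteq> forms m" "vs.dim V = Suc w" "vs.dim (down V) = w"
  shows "\<exists>h. h \<noteq> 0 \<and> w \<le> m \<and> h \<in> forms (m - w) \<and> V = {u * h | u. u \<in> forms w}"
  using assms
proof (induction w arbitrary: V m)
  case 0
  obtain B where B: "B \<subseteq> V" "vs.independent B" "vs.span B = V" "card B = 1"
    using vs.fin_sub_basis[OF fin_sub_in_forms[OF 0(1,2)]] 0(3) by (metis One_nat_def)
  then obtain h where h: "B = {h}" using card_1_singletonE by blast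
  have V: "V = {u * h | u. u \<in> forms 0}"
    unfolding B(3)[symmetric] h vs.span_singleton const_multiples ..
  have "h \<noteq> 0" using B(2) h by (simp add: vs.dependent_zero)
  moreover have "h \<in> forms m" using B(1) 0(2) h by blast
  ultimately show ?case by (intro exI[of _ h] conjI V) simp_all
next
  case (Suc w)
  note V = Suc.prems
  let ?U = "down V"
  have "m \<noteq> 0"
  proof
    assume "m = 0"
    then have "down V = {0}" using down_forms_0[of V] V(2) vs.subspace_0[OF down_subspace[OF V(1)]] by auto
    then show False using V(4) by simp
  qed
  then obtain m' where m': "m = Suc m'" by (cases m) auto
  have U: "vs.subspace ?U" "?U \<subseteq> forms m'" using down_subspace[OF V(1)] down_in_forms V(2) m' by auto
  have "?U \<noteq> {0}" using V(4) by auto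
  then have "vs.dim (down ?U) < Suc w" using down_dim_less[OF U] V(4) by simp
  moreover have "w \<le> vs.dim (down ?U)" using down_dim_convex(1)[OF V(1,2)] V(3,4) by simp
  ultimately have dU: "vs.dim (down ?U) = w" by simp
  from Suc.IH[OF U V(4) dU] obtain h where h: "h \<noteq> 0" "w \<le> m'" "h \<in> forms (m' - w)" "?U = {u * h | u. u \<in> forms w}"
    by (elim exE conjE)
  have "V = {varS * x + varT * y | x y. x \<in> ?U \<and> y \<in> ?U}"
    using down_dim_convex(2)[OF V(1,2)] V(3,4) dU by simp
  also have "\<dots> = {u * h | u. u \<in> forms (Suc w)}"
  proof (intro subset_antisym subsetI)
    fix z assume "z \<in> {varS * x + varT * y | x y. x \<in> ?U \<and> y \<in> ?U}"
    then obtain u v where "u \<in> forms w" "v \<in> forms w" "z = (varS * u + varT * v) * h"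
      unfolding h(4) by (auto simp: distrib_right mult.assoc)
    moreover have "varS * u + varT * v \<in> forms (Suc w)"
      using \<open>u \<in> forms w\<close> \<open>v \<in> forms w\<close>
      by (intro add_in_forms mult_in_forms'[OF varS_in_forms] mult_in_forms'[OF varT_in_forms]) auto
    ultimately show "z \<in> {u * h | u. u \<in> forms (Suc w)}" by blast
  next
    fix z assume "z \<in> {u * h | u. u \<in> forms (Suc w)}"
    then obtain u where "u \<in> forms (Suc w)" "z = u * h" by blast
    moreover then obtain x y where "x \<in> forms w" "y \<in> forms w" "u = varS * x + varT * y"
      using forms_Suc_decompose by blast
    ultimately have "z = varS * (x * h) + varT * (y * h)" "x * h \<in> ?U" "y * h \<in> ?U"
      unfolding h(4) by (auto simp: distrib_right mult.assoc)
    then show "z \<in> {varS * x + varT * y | x y. x \<in> ?U \<and> y \<in> ?U}" by blast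
  qed
  finally have V_eq: "V = {u * h | u. u \<in> forms (Suc w)}" .
  show ?case by (intro exI[of _ h] conjI V_eq) (use h(1-3) m' in auto)
qed

text \<open>By convexity the next drop is 1 or 2. A drop of 2 is equality, and the generators of
  \<open>down V\<close> also generate \<open>V\<close>. A drop of 1 makes \<open>down V\<close>
  consist of the multiples of one form \<open>h\<close>; the multiples of \<open>h\<close> then have
  codimension 1 in \<open>V\<close>, and a second generator \<open>h1\<close> appears in degree
  \<open>m\<close> itself.\<close>

lemma down_dim_pred2_imp_gen2:
  assumes "vs.subspace V" "V \<subseteq> forms m" "vs.dim V = w + 2" "vs.dim (down V) = w"
  shows "\<exists>h1 h2 e1 e2. h1 \<noteq> 0 \<and> h2 \<noteq> 0 \<and> h1 \<in> forms e1 \<and> h2 \<in> forms e2 \<and> e2 \<le> e1 \<and> e1 \<le> m \<and>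
    (m + 1 - e1) + (m + 1 - e2) = w + 2 \<and> V = gen2 h1 h2 m"
  using assms
proof (induction w arbitrary: V m rule: less_induct)
  case (less w)
  note V = less.prems
  let ?U = "down V"
  note fV = fin_sub_in_forms[OF V(1,2)]
  show ?case
  proof (cases "w = 0")
    case True
    obtain B where B: "B \<subseteq> V" "vs.independent B" "vs.span B = V" "card B = 2"
      using vs.fin_sub_basis[OF fV] V(3) True by (metis add_0)
    then obtain h1 h2 where h: "B = {h1, h2}" "h1 \<noteq> h2" by (auto simp: card_2_iff)
    have h0: "h1 \<noteq> 0" "h2 \<noteq> 0" using B(2) h vs.dependent_zero by auto
    have hm: "h1 \<in> forms m" "h2 \<in> forms m" using B(1) V(2) h by auto
    have "vs.span ({h1} \<union> {h2}) = gen2 h1 h2 m"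
      unfolding vs.span_Un vs.span_singleton gen2_eq[OF hm h0 order_refl order_refl] diff_self_eq_0
        const_multiples[symmetric] by blast
    then have "V = gen2 h1 h2 m" using B(3) h(1) by (simp add: insert_commute)
    with h0 hm True show ?thesis
      by (intro exI[of _ h1] exI[of _ h2] exI[of _ m]) auto
  next
    case False
    have "m \<noteq> 0"
    proof
      assume "m = 0"
      then have "down V = {0}" using down_forms_0[of V] V(2) vs.subspace_0[OF down_subspace[OF V(1)]] by auto
      then show False using V(4) False by simp
    qed
    then obtain m' where m': "m = Suc m'" by (cases m) auto
    have U: "vs.subspace ?U" "?U \<subseteq> forms m'" using down_subspace[OF V(1)] down_in_forms V(2) m' by auto
    have "?U \<noteq> {0}" using V(4) False by auto
    then have lt: "vs.dim (down ?U) < w" using down_dim_less[OF U] V(4) by simp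
    have ge: "2 * w \<le> w + 2 + vs.dim (down ?U)" using down_dim_convex(1)[OF V(1,2)] V(3,4) by simp
    show ?thesis
    proof (cases "vs.dim (down ?U) = w - 1")
      case True
      obtain w' where w': "w = Suc w'" using False by (cases w) auto
      have "vs.dim ?U = Suc w'" "vs.dim (down ?U) = w'" using V(4) True w' by simp_all
      from down_dim_pred_imp_principal[OF U this] obtain h where
        h: "h \<noteq> 0" "w' \<le> m'" "h \<in> forms (m' - w')" "?U = {u * h | u. u \<in> forms w'}"
        by (elim exE conjE)
      let ?X = "(\<lambda>p. p * h) ` forms w"
      have X: "vs.fin_sub ?X" "vs.dim ?X = Suc w"
        using mult_image_dim[OF h(1) fin_sub_forms] by (simp_all add: dim_forms)
      have XV: "?X \<subseteq> V"
      proof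
        fix z assume "z \<in> ?X"
        then obtain u where u: "u \<in> forms (Suc w')" "z = u * h" using w' by blast
        then obtain x y where xy: "x \<in> forms w'" "y \<in> forms w'" "u = varS * x + varT * y"
          using forms_Suc_decompose by blast
        then have "x * h \<in> ?U" "y * h \<in> ?U" using h(4) by auto
        then have "varS * (x * h) + varT * (y * h) \<in> V"
          using vs.subspace_add[OF V(1)] by (simp add: down_def)
        then show "z \<in> V" using u xy by (simp add: algebra_simps)
      qed
      obtain Z where Z: "vs.fin_sub Z" "Z \<subseteq> V" "V = {x + z | x z. x \<in> ?X \<and> z \<in> Z}"
          "vs.dim V = vs.dim ?X + vs.dim Z"
        by (rule vs.fin_sub_complement[OF X(1) fV XV]) blast
      have "vs.dim Z = 1" using Z(4) X(2) V(3) by simp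
      then obtain B where B: "B \<subseteq> Z" "vs.independent B" "vs.span B = Z" "card B = 1"
        using vs.fin_sub_basis[OF Z(1)] by metis
      then obtain h1 where h1: "B = {h1}" using card_1_singletonE by blast
      have h1': "h1 \<noteq> 0" "h1 \<in> forms m"
        using B(1,2) Z(2) V(2) h1 vs.dependent_zero by auto
      have hm: "h \<in> forms (m - w)" "m - (m - w) = w" using h(2,3) m' w' by auto
      have "V = gen2 h1 h m"
        unfolding gen2_eq[OF h1'(2) hm(1) h1'(1) h(1) order_refl diff_le_self]
        unfolding Z(3) B(3)[symmetric] h1 vs.span_singleton diff_self_eq_0 const_multiples[symmetric] hm(2)
      proof (intro subset_antisym subsetI)
        fix z assume "z \<in> {x + z | x z. x \<in> ?X \<and> z \<in> {u * h1 | u. u \<in> forms 0}}"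
        then obtain p u where "p \<in> forms w" "u \<in> forms 0" "z = u * h1 + p * h" by (auto simp: add.commute)
        then show "z \<in> {u * h1 + v * h | u v. u \<in> forms 0 \<and> v \<in> forms w}" by blast
      next
        fix z assume "z \<in> {u * h1 + v * h | u v. u \<in> forms 0 \<and> v \<in> forms w}"
        then obtain p u where "p \<in> forms w" "u \<in> forms 0" "z = p * h + u * h1" by (auto simp: add.commute)
        then show "z \<in> {x + z | x z. x \<in> ?X \<and> z \<in> {u * h1 | u. u \<in> forms 0}}" by blast
      qed
      then show ?thesis using h1' hm h(1,2) m' w'
        by (intro exI[of _ h1] exI[of _ h] exI[of _ m] exI[of _ "m - w"]) auto
    next
      case False
      define w' where "w' = vs.dim (down ?U)"
      have w': "w = w' + 2" "vs.dim (down ?U) = w'" using lt ge False unfolding w'_def by linarith+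
      have "w' < w" "vs.dim ?U = w' + 2" using V(4) w'(1) by simp_all
      from less.IH[OF this(1) U this(2) w'(2)] obtain h1 h2 e1 e2 where
        h: "h1 \<noteq> 0" "h2 \<noteq> 0" "h1 \<in> forms e1" "h2 \<in> forms e2" "e2 \<le> e1" "e1 \<le> m'"
          "(m' + 1 - e1) + (m' + 1 - e2) = w' + 2" and Ueq: "?U = gen2 h1 h2 m'"
        by (elim exE conjE)
      have V': "V = {varS * x + varT * y | x y. x \<in> ?U \<and> y \<in> ?U}"
        using down_dim_convex(2)[OF V(1,2)] V(3,4) w' by simp
      have "V = gen2 h1 h2 m"
      proof (intro subset_antisym subsetI)
        fix z assume "z \<in> V"
        then have "z \<in> {varS * x + varT * y | x y. x \<in> ?U \<and> y \<in> ?U}" by (simp only: V'[symmetric])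
        then obtain u v u' v' where uv: "z = varS * (u * h1 + v * h2) + varT * (u' * h1 + v' * h2)"
          "u * h1 \<in> forms m'" "v * h2 \<in> forms m'" "u' * h1 \<in> forms m'" "v' * h2 \<in> forms m'"
          unfolding Ueq gen2_def by blast
        show "z \<in> gen2 h1 h2 m"
        proof (rule gen2I)
          show "z = (varS * u + varT * u') * h1 + (varS * v + varT * v') * h2"
            unfolding uv(1) by (simp add: algebra_simps)
          show "(varS * u + varT * u') * h1 \<in> forms m" "(varS * v + varT * v') * h2 \<in> forms m"
            using uv m' unfolding distrib_right mult.assoc
            by (auto intro!: add_in_forms intro: mult_in_forms'[OF varS_in_forms] mult_in_forms'[OF varT_in_forms])
        qed
      next
        fix z assume "z \<in> gen2 h1 h2 m"
        then obtain u v where uv: "z = u * h1 + v * h2" "u \<in> forms (Suc (m' - e1))" "v \<in> forms (Suc (m' - e2))"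
          using gen2_eq[OF h(3,4,1,2), of m] h(5,6) m' by (auto simp: Suc_diff_le)
        obtain x y where x: "x \<in> forms (m' - e1)" "y \<in> forms (m' - e1)" "u = varS * x + varT * y"
          using forms_Suc_decompose[OF uv(2)] by blast
        obtain x' y' where x': "x' \<in> forms (m' - e2)" "y' \<in> forms (m' - e2)" "v = varS * x' + varT * y'"
          using forms_Suc_decompose[OF uv(3)] by blast
        have "x * h1 + x' * h2 \<in> ?U" "y * h1 + y' * h2 \<in> ?U"
          unfolding Ueq using x x' h gen2_eq[OF h(3,4,1,2), of m'] by auto
        moreover have "z = varS * (x * h1 + x' * h2) + varT * (y * h1 + y' * h2)"
          unfolding uv(1) x(3) x'(3) by (simp add: algebra_simps)
          ultimately have "z \<in> {varS * x + varT * y | x y. x \<in> ?U \<and> y \<in> ?U}" by blast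
        then show "z \<in> V" by (simp only: V'[symmetric])
      qed
      then show ?thesis using h(1-7) m' w'(1)
        by (intro exI[of _ h1] exI[of _ h2] exI[of _ e1] exI[of _ e2]) auto
    qed
  qed
qed

section \<open>Tuples of minimal type\<close>

subsection \<open>Ideals generated by forms\<close>

interpretation rm: Modules.module "(*) :: 'k::field poly poly \<Rightarrow> 'k poly poly \<Rightarrow> 'k poly poly"
  by (rule module_times)

declare rm.scale_scale [simp del]

lemma ideal_gen_image:
  fixes a :: "nat \<Rightarrow> 'k::field poly poly"
  shows "ideal_gen (a ` {..d}) = range (\<lambda>r. \<Sum>i\<le>d. r i * a i)"
proof
  have "rm.subspace (range (\<lambda>r. \<Sum>i\<le>d. r i * a i))"
  proof (rule rm.subspaceI)
    show "0 \<in> range (\<lambda>r. \<Sum>i\<le>d. r i * a i)" by (rule range_eqI[of _ _ "\<lambda>_. 0"]) simp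
  next
    fix x y assume "x \<in> range (\<lambda>r. \<Sum>i\<le>d. r i * a i)" "y \<in> range (\<lambda>r. \<Sum>i\<le>d. r i * a i)"
    then obtain r s where "x = (\<Sum>i\<le>d. r i * a i)" "y = (\<Sum>i\<le>d. s i * a i)" by blast
    then have "x + y = (\<Sum>i\<le>d. (r i + s i) * a i)" by (simp add: distrib_right sum.distrib)
    then show "x + y \<in> range (\<lambda>r. \<Sum>i\<le>d. r i * a i)" by (rule range_eqI[of _ _ "\<lambda>i. r i + s i"])
  next
    fix c x assume "x \<in> range (\<lambda>r. \<Sum>i\<le>d. r i * a i)"
    then obtain r where "x = (\<Sum>i\<le>d. r i * a i)" by blast
    then have "c * x = (\<Sum>i\<le>d. (c * r i) * a i)" by (simp add: sum_distrib_left mult.assoc)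
    then show "c * x \<in> range (\<lambda>r. \<Sum>i\<le>d. r i * a i)" by (rule range_eqI[of _ _ "\<lambda>i. c * r i"])
  qed
  moreover have "a i \<in> range (\<lambda>r. \<Sum>i\<le>d. r i * a i)" if "i \<le> d" for i
  proof (rule range_eqI[of _ _ "\<lambda>j. if j = i then 1 else 0"])
    have "(\<Sum>j\<le>d. (if j = i then 1 else 0) * a j) = (\<Sum>j\<le>d. if j = i then a j else 0)"
      by (intro sum.cong) auto
    then show "a i = (\<Sum>j\<le>d. (if j = i then 1 else 0) * a j)" using that by simp
  qed
  ultimately show "ideal_gen (a ` {..d}) \<subseteq> range (\<lambda>r. \<Sum>i\<le>d. r i * a i)"
    by (intro rm.span_minimal) auto
  show "range (\<lambda>r. \<Sum>i\<le>d. r i * a i) \<subseteq> ideal_gen (a ` {..d})"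
    by (intro image_subsetI rm.span_sum rm.span_scale rm.span_base imageI)
qed

lemma ideal_gen_pair:
  fixes h1 h2 :: "'k::field poly poly"
  shows "ideal_gen {h1, h2} = {u * h1 + v * h2 | u v. True}"
proof -
  have "ideal_gen ({h1} \<union> {h2}) = {u * h1 + v * h2 | u v. True}"
    unfolding rm.span_Un rm.span_singleton by blast
  then show ?thesis by (simp add: insert_commute)
qed

lemma hcomp_mult_below:
  assumes "q \<in> forms e" "m < e"
  shows "hcomp m (p * q) = 0"
proof (rule poly_poly_eqI)
  fix i j
  have "cf p i' j' * cf q (i - i') (j - j') = 0" if "i + j = m" for i' j'
  proof -
    have "(i - i') + (j - j') \<noteq> e" using that assms(2) by linarith
    then show ?thesis using formsD[OF assms(1)] by simp
  qed
  then show "cf (hcomp m (p * q)) i j = cf 0 i j"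
    unfolding cf_hcomp cf_mult by (auto intro!: sum.neutral)
qed

lemma hcomp_multiple:
  assumes "q \<in> forms e"
  shows "\<exists>p'. hcomp m (p * q) = p' * q"
  using hcomp_mult[OF assms, of "m - e" p] hcomp_mult_below[OF assms, of m p]
  by (cases "m < e") auto

lemma ideal_gen_pair_forms:
  assumes "h1 \<in> forms e1" "h2 \<in> forms e2"
  shows "ideal_gen {h1, h2} \<inter> forms m = gen2 h1 h2 m"
proof (intro subset_antisym subsetI)
  fix x assume x: "x \<in> ideal_gen {h1, h2} \<inter> forms m"
  then obtain u v where uv: "x = u * h1 + v * h2" unfolding ideal_gen_pair by blast
  have "x = hcomp m x" using x hcomp_form[of x m m] by simp
  then have eq: "x = hcomp m (u * h1) + hcomp m (v * h2)" by (simp add: uv hcomp_add)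
  obtain u' v' where "hcomp m (u * h1) = u' * h1" "hcomp m (v * h2) = v' * h2"
    using hcomp_multiple assms by metis
  with eq show "x \<in> gen2 h1 h2 m"
    by (intro gen2I[of _ u' _ v']) (metis hcomp_in_forms)+
next
  fix x assume "x \<in> gen2 h1 h2 m"
  then show "x \<in> ideal_gen {h1, h2} \<inter> forms m"
    using gen2_subset_forms[of h1 h2 m] unfolding ideal_gen_pair gen2_def by blast
qed

lemma ideal_gen_image_forms:
  fixes a :: "nat \<Rightarrow> 'k::field poly poly"
  assumes "\<And>i. i \<le> d \<Longrightarrow> a i \<in> forms n"
  shows "ideal_gen (a ` {..d}) \<inter> forms n = range (\<lambda>c. \<Sum>i\<le>d. smult [:c i:] (a i))"
proof (intro subset_antisym subsetI)
  fix x assume x: "x \<in> ideal_gen (a ` {..d}) \<inter> forms n"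
  then obtain r where r: "x = (\<Sum>i\<le>d. r i * a i)" unfolding ideal_gen_image by blast
  have "x = hcomp n x" using x hcomp_form[of x n n] by simp
  also have "\<dots> = (\<Sum>i\<le>d. hcomp n (r i * a i))" by (simp add: r hcomp_sum)
  also have "\<dots> = (\<Sum>i\<le>d. smult [:cf (r i) 0 0:] (a i))"
  proof (intro sum.cong refl)
    fix i assume "i \<in> {..d}"
    then have "hcomp n (r i * a i) = hcomp 0 (r i) * a i"
      using hcomp_mult[OF assms, of i 0 "r i"] by simp
    also have "hcomp 0 (r i) = [:[:cf (r i) 0 0:]:]"
      by (simp add: hcomp_def form_of_def)
    finally show "hcomp n (r i * a i) = smult [:cf (r i) 0 0:] (a i)" by simp
  qed
  finally show "x \<in> range (\<lambda>c. \<Sum>i\<le>d. smult [:c i:] (a i))"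
    by (rule range_eqI[of _ _ "\<lambda>i. cf (r i) 0 0"])
next
  fix x assume "x \<in> range (\<lambda>c. \<Sum>i\<le>d. smult [:c i:] (a i))"
  then obtain c where c: "x = (\<Sum>i\<le>d. smult [:c i:] (a i))" by blast
  then have "x = (\<Sum>i\<le>d. [:[:c i:]:] * a i)" by simp
  then have "x \<in> ideal_gen (a ` {..d})" 
    unfolding ideal_gen_image by (rule range_eqI[of _ _ "\<lambda>i. [:[:c i:]:]"])
  moreover have "x \<in> forms n" unfolding c using assms by (intro sum_in_forms smult_in_forms) auto
  ultimately show "x \<in> ideal_gen (a ` {..d}) \<inter> forms n" by simp
qed

text \<open>The decomposition with exponents \<open>m - b + 1\<close> and \<open>b\<close> just
  meets its bound \<open>m + 1\<close>. The quotient of the \<open>varS\<close> part has degree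
  \<open>b - 1\<close> and supplies the monomials with \<open>l < b\<close>; the \<open>varT\<close>
  part supplies \<open>l = b\<close>.\<close>

lemma form_monomial_combination:
  assumes "p \<in> forms m" "b \<le> m"
  shows "\<exists>c. (\<forall>l\<le>b. c l \<in> forms (m - b)) \<and> p = (\<Sum>l\<le>b. c l * (varS ^ (b - l) * varT ^ l))"
proof (cases b)
  case 0
  then show ?thesis using assms by (intro exI[of _ "\<lambda>_. p"]) simp
next
  case (Suc b')
  obtain x y where xy: "x \<in> forms (m - (m - b'))" "y \<in> forms (m - b)"
    "p = varS ^ (m - b') * x + varT ^ b * y"
    using forms_decompose[OF assms(1), of "m - b'" b] Suc assms(2) by auto
  have x: "x \<in> forms b'" using xy(1) Suc assms(2) by simp
  define c where "c = (\<lambda>l. if l = b then y else smult [:cf x l (b' - l):] (varS ^ (m - b)))"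
  have "varS ^ (m - b') * x = varS ^ (m - b') * form_of b' (\<lambda>l. cf x l (b' - l))"
    using form_of_cf[OF x] by simp
  also have "\<dots> = (\<Sum>l\<le>b'. c l * (varS ^ (b - l) * varT ^ l))"
    unfolding form_of_def sum_distrib_left
  proof (intro sum.cong refl)
    fix l assume l: "l \<in> {..b'}"
    have "varS ^ (m - b') * varS ^ (b' - l) = varS ^ (m - b) * (varS ^ (b - l) :: 'a poly poly)"
      using l Suc assms(2) by (simp flip: power_add)
    then show "varS ^ (m - b') * smult [:cf x l (b' - l):] (varS ^ (b' - l) * varT ^ l) =
       c l * (varS ^ (b - l) * varT ^ l)"
      using l Suc by (auto simp: c_def simp flip: mult.assoc)
  qed
  finally have x_sum: "varS ^ (m - b') * x = (\<Sum>l\<le>b'. c l * (varS ^ (b - l) * varT ^ l))" .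
  have "(\<Sum>l\<le>b. f l) = (\<Sum>l\<le>b'. f l) + f b" for f :: "nat \<Rightarrow> 'a poly poly"
    by (simp add: Suc)
  moreover have "c b = y" by (simp add: c_def)
  ultimately have "p = (\<Sum>l\<le>b. c l * (varS ^ (b - l) * varT ^ l))"
    using xy(3) x_sum by (simp only: diff_self_eq_0 power_0 mult_1 mult.commute[of y])
  moreover have "\<forall>l\<le>b. c l \<in> forms (m - b)" using xy(2) by (auto simp: c_def)
  ultimately show ?thesis by blast
qed

text \<open>\<open>C l\<close> is the multiple of the Koszul relation between the monomials
  \<open>l - 1\<close> and \<open>l\<close>. All monomials but the last are divisible by
  \<open>varS\<close>, so the last coefficient is too, and a multiple of the last relation removes
  it. The zeros at both ends keep the formula uniform.\<close>

lemma monomial_syzygies: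
  fixes B :: "nat \<Rightarrow> 'k::field poly poly"
  assumes "(\<Sum>l\<le>b. B l * (varS ^ (b - l) * varT ^ l)) = 0"
  shows "\<exists>C. C 0 = 0 \<and> C (Suc b) = 0 \<and> (\<forall>l\<le>b. B l = varT * C (Suc l) - varS * C l)"
  using assms
proof (induction b arbitrary: B)
  case 0
  then show ?case by (intro exI[of _ "\<lambda>_. 0"]) simp
next
  case (Suc b)
  let ?s = "\<Sum>l\<le>b. B l * (varS ^ (b - l) * varT ^ l)"
  have S: "(\<Sum>l\<le>b. B l * (varS ^ (Suc b - l) * varT ^ l)) = varS * ?s"
    unfolding sum_distrib_left
    by (intro sum.cong refl) (simp only: atMost_iff Suc_diff_le power_Suc mult.assoc mult.left_commute[of _ varS])
  have eq: "varS * ?s + B (Suc b) * varT ^ Suc b = 0"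
    using Suc.prems by (simp only: sum.atMost_Suc S diff_self_eq_0 power_0 mult_1)
  have "\<exists>C. B (Suc b) = varS * C \<and> ?s = - C * varT ^ Suc b"
  proof -
    have "\<exists>C. x = varS * C \<and> s = - C * varT ^ k" if "varS * s + x * varT ^ k = 0"
      for s x :: "'k poly poly" and k
      using that
    proof (induction k arbitrary: s)
      case 0
      then show ?case by (intro exI[of _ "- s"]) (simp add: eq_neg_iff_add_eq_0 add.commute)
    next
      case (Suc k)
      have "varS * s = - (x * varT ^ Suc k)"
        using Suc.prems by (simp only: eq_neg_iff_add_eq_0)
      also have "\<dots> = varT * (- x * varT ^ k)"
        by (simp only: power_Suc mult_minus_left mult_minus_right mult.left_commute[of x])
      finally have "varS * s = varT * (- x * varT ^ k)" .
      from varS_cancel_varT[OF this] obtain z where z: "s = varT * z" "- x * varT ^ k = varS * z" by blast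
      then have "varS * z + x * varT ^ k = 0" by (metis add.commute add.right_inverse mult_minus_left)
      from Suc.IH[OF this] obtain C where "x = varS * C" "z = - C * varT ^ k" by blast
      with z show ?case by (intro exI[of _ C]) (simp add: mult.left_commute)
    qed
    from this[OF eq] show ?thesis by simp
  qed
  then obtain D where D: "B (Suc b) = varS * D" "?s = - D * varT ^ Suc b" by blast
  \<comment> \<open>Cancelling \<open>B (Suc b) = varS * D\<close> by the last relation moves
    \<open>varT * D\<close> to the preceding coefficient.\<close>
  define B' where "B' = (\<lambda>l. if l = b then B b + varT * D else B l)"
  have "(\<Sum>l\<le>b. B' l * (varS ^ (b - l) * varT ^ l)) =
     (\<Sum>l\<le>b. B l * (varS ^ (b - l) * varT ^ l) + (if l = b then D * varT ^ Suc b else 0))"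
    by (intro sum.cong) (auto simp: B'_def algebra_simps)
  also have "\<dots> = 0" unfolding sum.distrib D(2) by simp
  finally obtain C where C: "C 0 = 0" "C (Suc b) = 0" "\<forall>l\<le>b. B' l = varT * C (Suc l) - varS * C l"
    using Suc.IH[of B'] by blast
  let ?C = "\<lambda>l. if l = Suc b then - D else if l = Suc (Suc b) then 0 else C l"
  have "B l = varT * ?C (Suc l) - varS * ?C l" if "l \<le> Suc b" for l
  proof (cases "l = Suc b")
    case False
    with that have "l \<le> b" by simp
    then have "B' l = varT * C (Suc l) - varS * C l" using C(3) by blast
    with \<open>l \<le> b\<close> C(2) show ?thesis by (auto simp: B'_def algebra_simps eq_neg_iff_add_eq_0)
  qed (simp add: D)
  with C(1) show ?case by (intro exI[of _ ?C]) auto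
qed

lemma sum_split_atMost: "(\<Sum>l\<le>p + q + 1. f l) = (\<Sum>l\<le>p. f l) + (\<Sum>l\<le>q. f (p + 1 + l))"
  for f :: "nat \<Rightarrow> 'a::comm_monoid_add"
  by (induction q) (simp_all add: add_ac)

subsection \<open>Tuples in \<open>R_{n - e1} h1 + R_{n - e2} h2\<close>\<close>

text \<open>Only degrees are prescribed, so the condition is easy to keep along a curve.
  Nonvanishing and coprimality of \<open>h1\<close> and \<open>h2\<close> are inherited from a
  relatively prime tuple.\<close>

definition split_rep :: "nat \<Rightarrow> nat \<Rightarrow> nat \<Rightarrow> nat \<Rightarrow> (nat \<Rightarrow> 'k::field poly poly) \<Rightarrow> bool" where
  "split_rep n d e1 e2 a \<longleftrightarrow> (\<exists>h1 h2 u v. h1 \<in> forms e1 \<and> h2 \<in> forms e2 \<and>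
     (\<forall>i\<le>d. u i \<in> forms (n - e1) \<and> v i \<in> forms (n - e2) \<and> a i = u i * h1 + v i * h2))"

definition tuple_span :: "nat \<Rightarrow> (nat \<Rightarrow> 'k::field poly poly) \<Rightarrow> 'k poly poly set" where
  "tuple_span d a = range (\<lambda>c. \<Sum>i\<le>d. smult [:c i:] (a i))"

lemma tuple_span_in_forms: "a \<in> form_tuples n d \<Longrightarrow> tuple_span d a \<subseteq> forms n"
  by (auto simp: tuple_span_def form_tuples_def intro!: sum_in_forms smult_in_forms)

lemma tuple_in_tuple_span: "i \<le> d \<Longrightarrow> a i \<in> tuple_span d a"
  unfolding tuple_span_def
proof (rule range_eqI[of _ _ "\<lambda>j. if j = i then 1 else 0"])
  assume "i \<le> d"
  have "(\<Sum>j\<le>d. smult [:if j = i then 1 else 0:] (a j)) = (\<Sum>j\<le>d. if j = i then a j else 0)"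
    by (intro sum.cong) auto
  then show "a i = (\<Sum>j\<le>d. smult [:if j = i then 1 else 0:] (a j))" using \<open>i \<le> d\<close> by simp
qed

lemma tuple_span_dim:
  assumes "lin_indep_tuple d a"
  shows "vs.dim (tuple_span d a) = Suc d" "vs.fin_sub (tuple_span d a)"
  using vs.dim_indexed_basis[OF finite_atMost tuple_span_def[of d a]] assms
  by (auto simp: lin_indep_tuple_def)

lemma unit_form_degree:
  fixes h :: "'k::field poly poly"
  assumes "is_unit h" "h \<in> forms e"
  shows "e = 0"
proof -
  obtain k where "1 = h * k" using assms(1) by (elim dvdE)
  then have k: "k * h = 1" by (simp add: mult.commute)
  then have "k \<noteq> 0" "h \<noteq> 0" by auto
  with factor_in_forms[of k h 0 e] assms(2) k show ?thesis by simp
qed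

locale split_tuple =
  fixes n d e1 e2 :: nat and a :: "nat \<Rightarrow> 'k::field poly poly"
    and h1 h2 :: "'k poly poly" and u v :: "nat \<Rightarrow> 'k poly poly"
  assumes n: "n \<ge> d + 1" and e: "e2 \<le> e1" "e1 \<le> n" "(n + 1 - e1) + (n + 1 - e2) = d + 1"
    and a: "a \<in> form_tuples n d" and ind: "lin_indep_tuple d a" and prime: "rel_prime_tuple d a"
    and h: "h1 \<in> forms e1" "h2 \<in> forms e2"
    and uv: "\<And>i. i \<le> d \<Longrightarrow> u i \<in> forms (n - e1)" "\<And>i. i \<le> d \<Longrightarrow> v i \<in> forms (n - e2)"
      "\<And>i. i \<le> d \<Longrightarrow> a i = u i * h1 + v i * h2"
begin

lemma nonzero: "h1 \<noteq> 0" "h2 \<noteq> 0"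
proof -
  show "h1 \<noteq> 0"
  proof
    assume "h1 = 0"
    then have "is_unit h2" using prime uv(3) by (auto simp: rel_prime_tuple_def)
    then have "e2 = 0" using unit_form_degree h(2) by blast
    then show False using n e by simp
  qed
  show "h2 \<noteq> 0"
  proof
    assume "h2 = 0"
    then have "is_unit h1" using prime uv(3) by (auto simp: rel_prime_tuple_def)
    then have "e1 = 0" using unit_form_degree h(1) by blast
    then show False using n e by simp
  qed
qed

lemma coprime: "Rings.coprime h1 h2"
  unfolding Rings.coprime_def
proof (intro allI impI)
  fix g assume "g dvd h1" "g dvd h2"
  then have "\<forall>i\<le>d. g dvd a i" using uv(3) by (simp add: dvd_add dvd_mult)
  then show "is_unit g" using prime by (simp add: rel_prime_tuple_def)
qed

definition b1 :: nat where "b1 = n - e1"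
definition b2 :: nat where "b2 = n - e2"

text \<open>The bound on \<open>n\<close> gives \<open>e1 + e2 = 2 * n + 1 - d\<close>, hence at
  least \<open>n + 2\<close>. This is what directness in degree \<open>n\<close> and the descent
  from degree \<open>n\<close> require.\<close>

lemma degrees: "d = b1 + b2 + 1" "b1 + e1 = n" "b2 + e2 = n" "e1 + e2 = 2 * n + 1 - d" "n < e1 + e2"
  "b1 < e2" "b2 < e1" "e2 - b1 = n - d + 1" "e1 - b2 = n - d + 1"
  using e n by (auto simp: b1_def b2_def)

lemma unique:
  assumes "x \<in> forms b1" "y \<in> forms b2" "x * h1 + y * h2 = 0"
  shows "x = 0 \<and> y = 0"
proof -
  have "x * h1 \<in> forms n" using assms(1) h(1) degrees(2) by (intro mult_in_forms') auto
  from coprime_forms_unique[OF coprime nonzero h assms(3) this degrees(5)] show ?thesis .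
qed

lemma gen2: "gen2 h1 h2 n = {x * h1 + y * h2 | x y. x \<in> forms b1 \<and> y \<in> forms b2}"
  using gen2_eq[OF h nonzero] e unfolding b1_def b2_def by simp

text \<open>The inclusion is clear, and both spaces have dimension \<open>d + 1\<close>: the sum on
  the right is direct, with summands of dimensions \<open>b1 + 1\<close> and
  \<open>b2 + 1\<close>.\<close>

lemma tuple_span: "tuple_span d a = gen2 h1 h2 n"
proof -
  let ?X = "(\<lambda>p. p * h1) ` forms b1" and ?Y = "(\<lambda>p. p * h2) ` forms b2"
  have X: "vs.fin_sub ?X" "vs.dim ?X = Suc b1" and Y: "vs.fin_sub ?Y" "vs.dim ?Y = Suc b2"
    using mult_image_dim[OF nonzero(1) fin_sub_forms] mult_image_dim[OF nonzero(2) fin_sub_forms]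
    by (simp_all add: dim_forms)
  have G: "gen2 h1 h2 n = {x + y | x y. x \<in> ?X \<and> y \<in> ?Y}" unfolding gen2 by blast
  have "z = 0" if zX: "z \<in> ?X" and zY: "z \<in> ?Y" for z
  proof -
    obtain x y where xy: "x \<in> forms b1" "z = x * h1" "y \<in> forms b2" "z = y * h2" using zX zY by blast
    then have "x * h1 + (- y) * h2 = 0" by simp
    then show "z = 0" using unique[of x "- y"] xy by auto
  qed
  then have dG: "vs.dim (gen2 h1 h2 n) = Suc d"
    unfolding G using vs.dim_direct_sum[OF X(1) Y(1)] X(2) Y(2) degrees(1) by simp
  have fG: "vs.fin_sub (gen2 h1 h2 n)" unfolding G by (rule vs.fin_sub_sum[OF X(1) Y(1)])
  have sub: "tuple_span d a \<subseteq> gen2 h1 h2 n"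
    unfolding tuple_span_def
  proof (intro image_subsetI vs.subspace_sum vs.subspace_scale)
    show "vs.subspace (gen2 h1 h2 n)" by (rule vs.fin_sub_subspace[OF fG])
    then show "vs.subspace (gen2 h1 h2 n)" .
    show "a i \<in> gen2 h1 h2 n" if "i \<in> {..d}" for i
      unfolding gen2 using uv that unfolding b1_def b2_def by blast
  qed
  show ?thesis
    using vs.fin_sub_dim_eq[OF fG vs.fin_sub_subspace[OF tuple_span_dim(2)[OF ind]] sub]
      tuple_span_dim(1)[OF ind] dG by simp
qed

lemma ideal_gen_forms: "ideal_gen (a ` {..d}) \<inter> forms n = gen2 h1 h2 n"
  using ideal_gen_image_forms[of d a n] a tuple_span unfolding tuple_span_def form_tuples_def by auto

lemma ideal_gen_high_forms:
  assumes "m \<ge> n"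
  shows "ideal_gen {h1, h2} \<inter> forms m = ideal_gen (a ` {..d}) \<inter> forms m"
proof (intro subset_antisym subsetI)
  fix x assume "x \<in> ideal_gen (a ` {..d}) \<inter> forms m"
  moreover have "ideal_gen (a ` {..d}) \<subseteq> ideal_gen {h1, h2}"
  proof (rule rm.span_minimal[OF _ rm.subspace_span], rule image_subsetI)
    fix i assume "i \<in> {..d}"
    then show "a i \<in> ideal_gen {h1, h2}" using uv(3) unfolding ideal_gen_pair by auto
  qed
  ultimately show "x \<in> ideal_gen {h1, h2} \<inter> forms m" by blast
next
  let ?I = "ideal_gen (a ` {..d})"
  \<comment> \<open>A form of degree \<open>m - e'\<close> is a combination of monomials of degree
    \<open>n - e'\<close>, so it is enough that the multiples of \<open>h'\<close> in degree
    \<open>n\<close> belong to the ideal.\<close>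
  have *: "p * h' \<in> ?I" if p: "p \<in> forms (m - e')" and e': "e' \<le> n"
    and h': "\<And>q. q \<in> forms (n - e') \<Longrightarrow> q * h' \<in> ?I" for p h' e'
  proof -
    obtain c where "p = (\<Sum>l\<le>n - e'. c l * (varS ^ (n - e' - l) * varT ^ l))"
      using form_monomial_combination[OF p diff_le_mono[OF assms]] by (elim exE conjE)
    then have "p * h' = (\<Sum>l\<le>n - e'. c l * ((varS ^ (n - e' - l) * varT ^ l) * h'))"
      by (simp add: sum_distrib_right mult.assoc)
    also have "\<dots> \<in> ?I" by (intro rm.span_sum rm.span_scale h' monomial_in_forms) auto
    finally show ?thesis .
  qed
  have I: "gen2 h1 h2 n \<subseteq> ?I" using ideal_gen_forms by blast
  have q1: "q * h1 \<in> ?I" if "q \<in> forms (n - e1)" for q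
    using that subsetD[OF I] unfolding gen2 b1_def b2_def
    by (metis (mono_tags, lifting) mem_Collect_eq add.right_neutral mult_zero_left zero_in_forms)
  have q2: "q * h2 \<in> ?I" if "q \<in> forms (n - e2)" for q
    using that subsetD[OF I] unfolding gen2 b1_def b2_def
    by (metis (mono_tags, lifting) mem_Collect_eq add.left_neutral mult_zero_left zero_in_forms)
  fix x assume "x \<in> ideal_gen {h1, h2} \<inter> forms m"
  then have x: "x \<in> gen2 h1 h2 m" "x \<in> forms m" unfolding ideal_gen_pair_forms[OF h] using gen2_subset_forms by auto
  then obtain p q where pq: "x = p * h1 + q * h2" "p \<in> forms (m - e1)" "q \<in> forms (m - e2)"
    using gen2_eq[OF h nonzero, of m] assms e by auto
  have "p * h1 \<in> ?I" "q * h2 \<in> ?I"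
    using *[OF pq(2) e(2) q1] *[OF pq(3) _ q2] e by auto
  then have "x \<in> ?I" unfolding pq(1) by (rule rm.span_add)
  then show "x \<in> ?I \<inter> forms m" using x by simp
qed

text \<open>Maximality is the descent: a generator of degree \<open>m < n\<close> of a competing
  ideal has all its monomial multiples of degree \<open>n\<close> in \<open>gen2 h1 h2 n\<close>,
  hence lies in \<open>gen2 h1 h2 m\<close>.\<close>

lemma ancestor_ideal: "ancestor_ideal n (ideal_gen (a ` {..d})) = ideal_gen {h1, h2}"
  unfolding ancestor_ideal_def
proof (rule Greatest_equality)
  show "homogeneous_ideal (ideal_gen {h1, h2}) \<and>
    (\<forall>m\<ge>n. ideal_gen {h1, h2} \<inter> forms m = ideal_gen (a ` {..d}) \<inter> forms m)"
    unfolding homogeneous_ideal_def using h ideal_gen_high_forms by (intro conjI exI[of _ "{h1, h2}"]) auto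
next
  fix J assume J: "homogeneous_ideal J \<and> (\<forall>m\<ge>n. J \<inter> forms m = ideal_gen (a ` {..d}) \<inter> forms m)"
  then obtain S where S: "S \<subseteq> (\<Union>m. forms m)" "J = ideal_gen S" unfolding homogeneous_ideal_def by blast
  have "x \<in> ideal_gen {h1, h2}" if xS: "x \<in> S" for x
  proof -
    obtain m where m: "x \<in> forms m" using S xS by blast
    have xJ: "x \<in> J" unfolding S(2) using xS by (rule rm.span_base)
    show ?thesis
    proof (cases "m \<ge> n")
      case True
      then have "x \<in> ideal_gen {h1, h2} \<inter> forms m"
        using J xJ m ideal_gen_high_forms[OF True] by blast
      then show ?thesis by simp
    next
      case False
      have "x \<in> gen2 h1 h2 m"
      proof (rule gen2_descend_many[OF coprime nonzero h _ m, of "n - m"])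
        show "m + (n - m) + 1 < e1 + e2" using False degrees n by simp
        fix p q assume pq: "p + q = n - m"
        have "varS ^ p * varT ^ q * x \<in> J" unfolding S(2) using xS by (intro rm.span_scale rm.span_base)
        moreover have "varS ^ p * varT ^ q * x \<in> forms n"
          using False pq m by (intro mult_in_forms'[of _ "n - m" _ m] monomial_in_forms) auto
        ultimately show "varS ^ p * varT ^ q * x \<in> gen2 h1 h2 (m + (n - m))"
          using J ideal_gen_forms False by auto
      qed
      then show ?thesis unfolding ideal_gen_pair_forms[OF h, symmetric] by simp
    qed
  qed
  then show "J \<subseteq> ideal_gen {h1, h2}"
    unfolding S(2) by (intro rm.span_minimal) auto
qed

lemma ancestor_partition: "ancestor_partition n d a (n + 1 - e1, n + 1 - e2)"
  unfolding ancestor_partition_def Let_def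
proof (intro exI conjI)
  show "Rings.coprime h1 h2" by (rule coprime)
  show "ideal_gen (a ` {..d}) \<inter> forms n =
      {u * h1 + v * h2 |u v. u \<in> forms (n - e1) \<and> v \<in> forms (n - e2)}"
    unfolding ideal_gen_forms gen2 b1_def b2_def ..
  show "\<forall>u\<in>forms (n - e1). \<forall>v\<in>forms (n - e2). u * h1 + v * h2 = 0 \<longrightarrow> u = 0 \<and> v = 0"
    using unique unfolding b1_def b2_def by blast
qed (use nonzero h e ancestor_ideal in auto)

text \<open>The monomial multiples of \<open>h1\<close>, then those of \<open>h2\<close>, in one
  list of length \<open>d + 1\<close>. In the second block the exponent \<open>d - l\<close> equals
  \<open>b2 - (l - b1 - 1)\<close>.\<close>

definition bas :: "nat \<Rightarrow> 'k poly poly" where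
  "bas l = (if l \<le> b1 then varS ^ (b1 - l) * varT ^ l * h1
     else varS ^ (d - l) * varT ^ (l - b1 - 1) * h2)"

lemma sum_bas: "(\<Sum>l\<le>d. B l * bas l) =
   (\<Sum>l\<le>b1. B l * (varS ^ (b1 - l) * varT ^ l)) * h1 +
   (\<Sum>l\<le>b2. B (b1 + 1 + l) * (varS ^ (b2 - l) * varT ^ l)) * h2"
proof -
  have "d - (b1 + 1 + l) = b2 - l" for l using degrees(1) by simp
  then have 2: "bas (b1 + 1 + l) = varS ^ (b2 - l) * varT ^ l * h2" for l
    unfolding bas_def by simp
  have "(\<Sum>l\<le>d. B l * bas l) = (\<Sum>l\<le>b1. B l * bas l) + (\<Sum>l\<le>b2. B (b1 + 1 + l) * bas (b1 + 1 + l))"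
    by (subst degrees(1)) (rule sum_split_atMost)
  also have "(\<Sum>l\<le>b1. B l * bas l) = (\<Sum>l\<le>b1. B l * (varS ^ (b1 - l) * varT ^ l)) * h1"
    unfolding sum_distrib_right by (rule sum.cong) (simp_all add: bas_def mult.assoc)
  also have "(\<Sum>l\<le>b2. B (b1 + 1 + l) * bas (b1 + 1 + l)) =
      (\<Sum>l\<le>b2. B (b1 + 1 + l) * (varS ^ (b2 - l) * varT ^ l)) * h2"
    unfolding sum_distrib_right 2 by (rule sum.cong) (simp_all only: mult.assoc)
  finally show ?thesis .
qed

lemma bas_independent:
  assumes "(\<Sum>l\<le>d. [:[:c l:]:] * bas l) = 0" "l \<le> d"
  shows "c l = 0"
proof -
  have *: "(\<Sum>l\<le>b. [:[:c l:]:] * (varS ^ (b - l) * varT ^ l)) = form_of b c" for b and c :: "nat \<Rightarrow> 'k"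
    by (simp add: form_of_def)
  have "form_of b1 c = 0 \<and> form_of b2 (\<lambda>l. c (b1 + 1 + l)) = 0"
    using assms(1) unfolding sum_bas * by (intro unique) auto
  then have "cf (form_of b1 c) l (b1 - l) = 0"
    "cf (form_of b2 (\<lambda>l. c (b1 + 1 + l))) (l - b1 - 1) (b2 - (l - b1 - 1)) = 0"
    by simp_all
  then show ?thesis using assms(2) degrees(1) unfolding cf_form_of by (cases "l \<le> b1") auto
qed

lemma bas_in_tuple_span:
  assumes "l \<le> d"
  shows "bas l \<in> tuple_span d a"
proof (cases "l \<le> b1")
  case True
  then have "varS ^ (b1 - l) * varT ^ l \<in> forms b1" by (intro monomial_in_forms) auto
  with True show ?thesis unfolding tuple_span gen2 bas_def
    by (intro CollectI exI[of _ "varS ^ (b1 - l) * varT ^ l"] exI[of _ 0]) simp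
next
  case False
  then have "varS ^ (d - l) * varT ^ (l - b1 - 1) \<in> forms b2"
    using assms degrees(1) by (intro monomial_in_forms) auto
  with False show ?thesis unfolding tuple_span gen2 bas_def
    by (intro CollectI exI[of _ "varS ^ (d - l) * varT ^ (l - b1 - 1)"] exI[of _ 0]) simp
qed

text \<open>Row \<open>j\<close> is the Koszul relation between the consecutive elements \<open>j - 1\<close> and \<open>j\<close> of the
  basis, except at the position \<open>b1 + 1\<close> where the two blocks meet: there it is the relation
  \<open>h2 h1 = h1 h2\<close>, with \<open>h2\<close> and \<open>h1\<close> expanded by \<open>s\<close>.\<close>

definition syz :: "(nat \<Rightarrow> 'k poly poly) \<Rightarrow> nat \<Rightarrow> nat \<Rightarrow> 'k poly poly" where
  "syz s j l = (if j = b1 + 1 then s l else if l + 1 = j then varT else if l = j then - varS else 0)"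

lemma syz_sum:
  assumes "l \<le> d"
  shows "(\<Sum>j=1..d. C j * syz s j l) = C (b1 + 1) * s l +
    (if l < d \<and> l \<noteq> b1 then varT * C (l + 1) else 0) - (if 1 \<le> l \<and> l \<noteq> b1 + 1 then varS * C l else 0)"
proof -
  have "(\<Sum>j=1..d. C j * syz s j l) = (\<Sum>j=1..d. (if j = b1 + 1 then C (b1 + 1) * s l else 0) +
     (if j = l + 1 then (if l \<noteq> b1 then varT * C (l + 1) else 0) else 0) -
     (if j = l then (if l \<noteq> b1 + 1 then varS * C l else 0) else 0))"
    by (intro sum.cong) (auto simp: syz_def)
  also have "\<dots> = (if b1 + 1 \<in> {1..d} then C (b1 + 1) * s l else 0) +
     (if l + 1 \<in> {1..d} then (if l \<noteq> b1 then varT * C (l + 1) else 0) else 0) -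
     (if l \<in> {1..d} then (if l \<noteq> b1 + 1 then varS * C l else 0) else 0)"
    by (simp only: sum.distrib sum_subtractf sum.delta finite_atLeastAtMost)
  finally show ?thesis using assms degrees(1) by (simp add: Suc_le_eq)
qed

text \<open>The Koszul relation of \<open>h1\<close> and \<open>h2\<close>, written in the basis by
  expanding \<open>h2\<close> in monomials of degree \<open>b1\<close> and \<open>h1\<close> in
  monomials of degree \<open>b2\<close>. The coefficients have degree
  \<open>e2 - b1 = e1 - b2 = n - d + 1\<close>, the last entry of \<open>mu_min\<close>.\<close>

lemma block_relation:
  obtains s where "\<And>l. l \<le> d \<Longrightarrow> s l \<in> forms (n - d + 1)"
    "(\<Sum>l\<le>b1. s l * (varS ^ (b1 - l) * varT ^ l)) = h2"
    "(\<Sum>l\<le>b2. s (b1 + 1 + l) * (varS ^ (b2 - l) * varT ^ l)) = - h1"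
proof -
  obtain c where c: "\<forall>l\<le>b1. c l \<in> forms (e2 - b1)" "h2 = (\<Sum>l\<le>b1. c l * (varS ^ (b1 - l) * varT ^ l))"
    using form_monomial_combination[OF h(2) less_imp_le[OF degrees(6)]] by (elim exE conjE)
  obtain c' where c': "\<forall>l\<le>b2. c' l \<in> forms (e1 - b2)" "h1 = (\<Sum>l\<le>b2. c' l * (varS ^ (b2 - l) * varT ^ l))"
    using form_monomial_combination[OF h(1) less_imp_le[OF degrees(7)]] by (elim exE conjE)
  let ?s = "\<lambda>l. if l \<le> b1 then c l else - c' (l - b1 - 1)"
  show thesis
  proof (rule that[of ?s])
    show "?s l \<in> forms (n - d + 1)" if "l \<le> d" for l
      using c(1) c'(1) degrees that by (auto intro!: uminus_in_forms)
    show "(\<Sum>l\<le>b1. ?s l * (varS ^ (b1 - l) * varT ^ l)) = h2"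
      unfolding c(2) by (intro sum.cong) auto
    show "(\<Sum>l\<le>b2. ?s (b1 + 1 + l) * (varS ^ (b2 - l) * varT ^ l)) = - h1"
      unfolding c'(2) sum_negf[symmetric] by (intro sum.cong) auto
  qed
qed

text \<open>The resolution is written down for the basis \<open>bas\<close>, where its rows are
  explicit, and then carried over to the tuple by an invertible matrix of constants.\<close>

lemma has_mu_type: "has_mu_type d a (mu_min n d)"
proof -
  obtain s where s: "\<And>l. l \<le> d \<Longrightarrow> s l \<in> forms (n - d + 1)"
    "(\<Sum>l\<le>b1. s l * (varS ^ (b1 - l) * varT ^ l)) = h2"
    "(\<Sum>l\<le>b2. s (b1 + 1 + l) * (varS ^ (b2 - l) * varT ^ l)) = - h1"
    by (rule block_relation) blast
  \<comment> \<open>Renumbers the rows so that the block relation, whose degree is the largest,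
    comes last as \<open>mu_min\<close> demands; \<open>\<tau>\<close> is the inverse.\<close>
  define \<sigma> where "\<sigma> = (\<lambda>i. if i \<le> b1 then i else if i < d then i + 1 else b1 + 1)"
  define \<tau> where "\<tau> = (\<lambda>j. if j \<le> b1 then j else if j = b1 + 1 then d else j - 1)"
  have \<sigma>\<tau>: "\<sigma> (\<tau> j) = j" "\<tau> j \<in> {1..d}" if "j \<in> {1..d}" for j
    using that degrees(1) by (auto simp: \<sigma>_def \<tau>_def)
  have \<tau>\<sigma>: "\<tau> (\<sigma> j) = j" "\<sigma> j \<in> {1..d}" if "j \<in> {1..d}" for j
    using that degrees(1) by (auto simp: \<sigma>_def \<tau>_def)
  have bij: "bij_betw \<sigma> {1..d} {1..d}"
    by (rule bij_betw_byWitness[where f' = \<tau>]) (use \<sigma>\<tau> \<tau>\<sigma> in blast)+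
  have reindex: "(\<Sum>i=1..d. C i * syz s (\<sigma> i) l) = (\<Sum>j=1..d. C (\<tau> j) * syz s j l)" for C l
  proof -
    have "(\<Sum>i=1..d. C i * syz s (\<sigma> i) l) = (\<Sum>i=1..d. C (\<tau> (\<sigma> i)) * syz s (\<sigma> i) l)"
      by (intro sum.cong refl) (simp only: \<tau>\<sigma>)
    also have "\<dots> = (\<Sum>j=1..d. C (\<tau> j) * syz s j l)"
      by (rule sum.reindex_bij_betw[OF bij])
    finally show ?thesis .
  qed
  have syz0: "(\<Sum>l\<le>d. syz s j l * bas l) = 0" if j: "j \<in> {1..d}" for j
  proof (cases "j = b1 + 1")
    case True
    then have "(\<Sum>l\<le>d. syz s j l * bas l) = (\<Sum>l\<le>d. s l * bas l)" by (simp add: syz_def)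
    also have "\<dots> = 0" unfolding sum_bas s(2,3) by (simp add: mult.commute)
    finally show ?thesis .
  next
    case False
    then have "(\<Sum>l\<le>d. syz s j l * bas l) =
      (\<Sum>l\<le>d. (if l = j - 1 then varT * bas (j - 1) else 0) - (if l = j then varS * bas j else 0))"
      using j by (intro sum.cong) (auto simp: syz_def)
    also have "\<dots> = varT * bas (j - 1) - varS * bas j" using j by (auto simp: sum_subtractf)
    also have "\<dots> = 0"
    proof (cases "j \<le> b1")
      case True
      then have "b1 - (j - 1) = Suc (b1 - j)" "j = Suc (j - 1)" using j by auto
      then have "varT * varT ^ (j - 1) = (varT ^ j :: 'k poly poly)"
        "varS ^ (b1 - (j - 1)) = varS * (varS ^ (b1 - j) :: 'k poly poly)" by (metis power_Suc)+
      moreover have "j - 1 \<le> b1" using True by simp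
      ultimately show ?thesis using True by (simp add: bas_def algebra_simps)
    next
      case F: False
      then have le: "\<not> j - 1 \<le> b1" using False by auto
      have "d - (j - 1) = Suc (d - j)" "j - b1 - 1 = Suc (j - 1 - b1 - 1)" using F False j by auto
      then have "varT * varT ^ (j - 1 - b1 - 1) = (varT ^ (j - b1 - 1) :: 'k poly poly)"
        "varS ^ (d - (j - 1)) = varS * (varS ^ (d - j) :: 'k poly poly)" by (metis power_Suc)+
      with F le show ?thesis by (simp add: bas_def algebra_simps)
    qed
    finally show ?thesis .
  qed
  \<comment> \<open>Coprimality exhibits the two blocks of a syzygy as \<open>- c * h2\<close> and
    \<open>c * h1\<close>. Adding \<open>c\<close> times the block relation makes both vanish, and
    each block becomes a syzygy of monomials alone.\<close>
  have exact: "\<exists>C. \<forall>l\<le>d. B l = (\<Sum>j=1..d. C j * syz s j l)" if B: "(\<Sum>l\<le>d. B l * bas l) = 0" for B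
  proof -
    obtain c where c: "(\<Sum>l\<le>b2. B (b1 + 1 + l) * (varS ^ (b2 - l) * varT ^ l)) = c * h1"
      "(\<Sum>l\<le>b1. B l * (varS ^ (b1 - l) * varT ^ l)) = - c * h2"
      using coprime_forms_syzygy[OF coprime nonzero] B unfolding sum_bas by blast
    have "(\<Sum>l\<le>b1. (B l + c * s l) * (varS ^ (b1 - l) * varT ^ l)) = - c * h2 + c * h2"
      unfolding c(2)[symmetric] unfolding s(2)[symmetric] by (simp add: distrib_right sum.distrib sum_distrib_left mult.assoc)
    then obtain C1 where C1: "C1 0 = 0" "C1 (Suc b1) = 0" "\<forall>l\<le>b1. B l + c * s l = varT * C1 (Suc l) - varS * C1 l"
      using monomial_syzygies[of "\<lambda>l. B l + c * s l" b1] by auto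
    have "(\<Sum>l\<le>b2. (B (b1 + 1 + l) + c * s (b1 + 1 + l)) * (varS ^ (b2 - l) * varT ^ l)) = c * h1 + c * (- h1)"
      unfolding c(1)[symmetric] unfolding s(3)[symmetric] by (simp add: distrib_right sum.distrib sum_distrib_left mult.assoc)
    then obtain C2 where C2: "C2 0 = 0" "C2 (Suc b2) = 0"
      "\<forall>l\<le>b2. B (b1 + 1 + l) + c * s (b1 + 1 + l) = varT * C2 (Suc l) - varS * C2 l"
      using monomial_syzygies[of "\<lambda>l. B (b1 + 1 + l) + c * s (b1 + 1 + l)" b2] by auto
    define C where "C = (\<lambda>j. if j \<le> b1 then C1 j else if j = b1 + 1 then - c else C2 (j - b1 - 1))"
    have "B l = (\<Sum>j=1..d. C j * syz s j l)" if l: "l \<le> d" for l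
    proof (cases "l \<le> b1")
      case True
      have "B l + c * s l = varT * C1 (Suc l) - varS * C1 l" using C1(3) True by blast
      then have "B l = - c * s l + varT * C1 (Suc l) - varS * C1 l" by (simp add: algebra_simps)
      then show ?thesis unfolding syz_sum[OF l] using True C1(1,2) degrees(1)
        by (cases "l = 0"; cases "l = b1") (auto simp: C_def)
    next
      case False
      define k where "k = l - b1 - 1"
      have k: "l = b1 + 1 + k" "k \<le> b2" using False l degrees(1) by (auto simp: k_def)
      have "B l + c * s l = varT * C2 (Suc k) - varS * C2 k" using C2(3) k by blast
      then have "B l = - c * s l + varT * C2 (Suc k) - varS * C2 k" by (simp add: algebra_simps)
      then show ?thesis unfolding syz_sum[OF l] using k C2(1,2) degrees(1)
        by (cases "k = 0"; cases "k = b2") (auto simp: C_def)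
    qed
    then show ?thesis by blast
  qed
  \<comment> \<open>Pairing with the monomials of the first block kills every row except the block
    relation, which contributes \<open>h2\<close>; so its multiplier vanishes. The remaining
    multipliers vanish one after the other, since column \<open>l\<close> expresses
    \<open>varT * C (l + 1)\<close> by the previous one.\<close>
  have inj: "C j = 0" if C: "\<forall>l\<le>d. (\<Sum>j=1..d. C j * syz s j l) = 0" and j: "j \<in> {1..d}" for C j
  proof -
    have "0 = (\<Sum>l\<le>b1. (\<Sum>j=1..d. C j * syz s j l) * (varS ^ (b1 - l) * varT ^ l))"
      using C degrees(1) by (intro sum.neutral[symmetric]) auto
    also have "\<dots> = (\<Sum>j=1..d. C j * (\<Sum>l\<le>b1. syz s j l * (varS ^ (b1 - l) * varT ^ l)))"
      unfolding sum_distrib_left sum_distrib_right by (subst sum.swap) (simp add: mult.assoc)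
    also have "\<dots> = (\<Sum>j=1..d. if j = b1 + 1 then C j * h2 else 0)"
    proof (intro sum.cong refl)
      fix j assume j: "j \<in> {1..d}"
      have "(\<Sum>l\<le>b1. syz s j l * (varS ^ (b1 - l) * varT ^ l)) = 0" if "j \<noteq> b1 + 1"
      proof (cases "j \<le> b1")
        case True
        have "(\<Sum>l\<le>b1. syz s j l * (varS ^ (b1 - l) * varT ^ l)) = (\<Sum>l\<le>b1.
            (if l = j - 1 then varT * (varS ^ (b1 - (j - 1)) * varT ^ (j - 1)) else 0) -
            (if l = j then varS * (varS ^ (b1 - j) * varT ^ j) else 0))"
          using True j by (intro sum.cong) (auto simp: syz_def)
        also have "\<dots> = varT * (varS ^ (b1 - (j - 1)) * varT ^ (j - 1)) - varS * (varS ^ (b1 - j) * varT ^ j)"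
          using True j by (auto simp: sum_subtractf)
        also have "\<dots> = 0"
        proof -
          have "b1 - (j - 1) = Suc (b1 - j)" "j = Suc (j - 1)" using j True by auto
          then have "varT * varT ^ (j - 1) = (varT ^ j :: 'k poly poly)"
            "varS ^ (b1 - (j - 1)) = varS * (varS ^ (b1 - j) :: 'k poly poly)" by (metis power_Suc)+
          then show ?thesis by (simp add: algebra_simps)
        qed
        finally show ?thesis .
      next
        case False
        with that show ?thesis by (intro sum.neutral) (auto simp: syz_def)
      qed
      then show "C j * (\<Sum>l\<le>b1. syz s j l * (varS ^ (b1 - l) * varT ^ l)) = (if j = b1 + 1 then C j * h2 else 0)"
        using s(2) by (auto simp: syz_def)
    qed
    also have "\<dots> = C (b1 + 1) * h2" using degrees(1) by simp
    finally have 0: "C (b1 + 1) = 0" using nonzero by simp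
    have "j \<in> {1..d} \<Longrightarrow> C j = 0" for j
    proof (induction j)
      case (Suc l)
      show ?case
      proof (cases "l = b1")
        case False
        have "0 = C (b1 + 1) * s l + varT * C (l + 1) - (if 1 \<le> l \<and> l \<noteq> b1 + 1 then varS * C l else 0)"
          using C syz_sum[of l C s] Suc.prems False by simp
        also have "\<dots> = varT * C (Suc l)" using 0 Suc by auto
        finally show ?thesis by simp
      qed (use 0 in simp)
    qed simp
    with j show ?thesis by blast
  qed
  \<comment> \<open>Coordinates of the tuple in the basis \<open>bas\<close>; \<open>g'\<close>
    below holds those of the basis in the tuple, and the two matrices are inverse to each
    other.\<close>
  define g where "g = (\<lambda>i l. if l \<le> b1 then cf (u i) l (b1 - l) else cf (v i) (l - b1 - 1) (d - l))"
  have g: "a i = (\<Sum>l\<le>d. [:[:g i l:]:] * bas l)" if "i \<le> d" for i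
  proof -
    have "(\<Sum>l\<le>b1. [:[:g i l:]:] * (varS ^ (b1 - l) * varT ^ l)) = form_of b1 (\<lambda>l. cf (u i) l (b1 - l))"
      unfolding form_of_def by (intro sum.cong) (auto simp: g_def)
    moreover have "(\<Sum>l\<le>b2. [:[:g i (b1 + 1 + l):]:] * (varS ^ (b2 - l) * varT ^ l)) =
        form_of b2 (\<lambda>l. cf (v i) l (b2 - l))"
      unfolding form_of_def by (intro sum.cong) (auto simp: g_def degrees(1))
    moreover have "u i \<in> forms b1" "v i \<in> forms b2" using uv[OF that] by (simp_all add: b1_def b2_def)
    note this[THEN form_of_cf]
    ultimately show ?thesis unfolding sum_bas using uv(3)[OF that] by simp
  qed
  have "\<exists>c. bas l = (\<Sum>i\<le>d. [:[:c i:]:] * a i)" if "l \<le> d" for l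
    using bas_in_tuple_span[OF that] unfolding tuple_span_def by auto
  then obtain g' where g': "\<And>l. l \<le> d \<Longrightarrow> bas l = (\<Sum>j\<le>d. [:[:g' l j:]:] * a j)" by metis
  have const_add: "[:[:x + y:]:] = [:[:x:]:] + [:[:y:]:]" for x y :: 'k by simp
  have const_diff: "[:[:x - (if P then 1 else 0):]:] * y = [:[:x:]:] * y - (if P then y else 0)"
    for x :: 'k and P y
  proof -
    have "[:[:x - 1:]:] = [:[:x:]:] - (1 :: 'k poly poly)"
      by (rule poly_poly_eqI) (auto simp: coeff_pCons coeff_1 split: nat.splits)
    then have "[:[:x - 1:]:] * y = [:[:x:]:] * y - y" by (simp only: left_diff_distrib mult_1)
    then show ?thesis by simp
  qed
  have const_sum: "[:[:\<Sum>l\<in>I. f l * f' l:]:] = (\<Sum>l\<in>I. [:[:f l:]:] * [:[:f' l:]:])"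
    for f f' :: "nat \<Rightarrow> 'k" and I
    by (induction I rule: infinite_finite_induct) (simp_all add: const_add del: add_pCons)
  have gg': "(\<Sum>l\<le>d. [:[:g i l:]:] * [:[:g' l j:]:]) = (if i = j then 1 else 0)" if ij: "i \<le> d" "j \<le> d" for i j
  proof -
    let ?c = "\<lambda>j. (\<Sum>l\<le>d. g i l * g' l j) - (if i = j then 1 else 0)"
    have "(\<Sum>j\<le>d. smult [:?c j:] (a j)) = (\<Sum>j\<le>d. [:[:?c j:]:] * a j)" by simp
    also have "\<dots> = (\<Sum>j\<le>d. (\<Sum>l\<le>d. [:[:g i l:]:] * [:[:g' l j:]:]) * a j - (if i = j then a j else 0))"
      unfolding const_sum[symmetric] const_diff ..
    also have "\<dots> = (\<Sum>l\<le>d. [:[:g i l:]:] * (\<Sum>j\<le>d. [:[:g' l j:]:] * a j)) - a i"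
      using ij unfolding sum_subtractf sum_distrib_left sum_distrib_right
      by (subst sum.swap) (simp add: mult.assoc)
    also have "\<dots> = 0" using g[OF ij(1)] g' by simp
    finally have 0: "(\<Sum>j\<le>d. smult [:?c j:] (a j)) = 0" .
    have "?c j = 0" by (rule ind[unfolded lin_indep_tuple_def, rule_format, of ?c, OF 0 ij(2)])
    then show ?thesis unfolding const_sum[symmetric] by (auto simp: pCons_one)
  qed
  have g'g: "(\<Sum>j\<le>d. [:[:g' l j:]:] * [:[:g j k:]:]) = (if l = k then 1 else 0)" if lk: "l \<le> d" "k \<le> d" for l k
  proof -
    let ?c = "\<lambda>k. (\<Sum>j\<le>d. g' l j * g j k) - (if l = k then 1 else 0)"
    have "(\<Sum>k\<le>d. [:[:?c k:]:] * bas k) = (\<Sum>k\<le>d. (\<Sum>j\<le>d. [:[:g' l j:]:] * [:[:g j k:]:]) * bas k - (if l = k then bas k else 0))"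
      unfolding const_sum[symmetric] const_diff ..
    also have "\<dots> = (\<Sum>j\<le>d. [:[:g' l j:]:] * (\<Sum>k\<le>d. [:[:g j k:]:] * bas k)) - bas l"
      using lk unfolding sum_subtractf sum_distrib_left sum_distrib_right
      by (subst sum.swap) (simp add: mult.assoc)
    also have "\<dots> = 0" using g'[OF lk(1)] g by simp
    finally have 0: "(\<Sum>k\<le>d. [:[:?c k:]:] * bas k) = 0" .
    have "?c k = 0" by (rule bas_independent[of ?c, OF 0 lk(2)])
    then show ?thesis unfolding const_sum[symmetric] by (auto simp: pCons_one)
  qed
  \<comment> \<open>The rows of the resolution, reordered by \<open>\<sigma>\<close> and rewritten
    as relations between the members of the tuple.\<close>
  define p where "p = (\<lambda>i j. \<Sum>l\<le>d. syz s (\<sigma> i) l * [:[:g' l j:]:])"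
  have swap: "(\<Sum>i\<in>I. \<Sum>j\<in>J. f i j * h j) = (\<Sum>j\<in>J. (\<Sum>i\<in>I. f i j) * h j)"
    for f :: "nat \<Rightarrow> nat \<Rightarrow> 'k poly poly" and h I J
    by (subst sum.swap) (simp add: sum_distrib_right)
  show ?thesis
    unfolding has_mu_type_def
  proof (intro conjI exI[of _ p] ballI allI impI)
    show "1 \<le> mu_min n d i" for i by (simp add: mu_min_def)
    show "mono_on {1..d} (mu_min n d)" by (intro mono_onI) (auto simp: mu_min_def)
  next
    fix i j assume i: "i \<in> {1..d}" and j: "j \<le> d"
    have "syz s (\<sigma> i) l \<in> forms (mu_min n d i)" if "l \<le> d" for l
      using i s(1)[OF that] degrees(1)
      by (auto simp: syz_def \<sigma>_def mu_min_def intro!: uminus_in_forms)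
    then show "p i j \<in> forms (mu_min n d i)"
      unfolding p_def by (intro sum_in_forms mult_in_forms'[OF _ const_in_forms]) auto
  next
    fix i assume i: "i \<in> {1..d}"
    have "(\<Sum>j\<le>d. p i j * a j) = (\<Sum>l\<le>d. syz s (\<sigma> i) l * (\<Sum>j\<le>d. [:[:g' l j:]:] * a j))"
      unfolding p_def sum_distrib_left sum_distrib_right by (subst sum.swap) (simp add: mult.assoc)
    also have "\<dots> = (\<Sum>l\<le>d. syz s (\<sigma> i) l * bas l)" using g' by simp
    also have "\<dots> = 0" using syz0 \<tau>\<sigma>(2)[OF i] by blast
    finally show "(\<Sum>j\<le>d. p i j * a j) = 0" .
  next
    fix b assume b: "(\<Sum>j\<le>d. b j * a j) = 0"
    define B where "B = (\<lambda>l. \<Sum>j\<le>d. b j * [:[:g j l:]:])"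
    have "(\<Sum>l\<le>d. B l * bas l) = (\<Sum>j\<le>d. b j * (\<Sum>l\<le>d. [:[:g j l:]:] * bas l))"
      unfolding B_def sum_distrib_left sum_distrib_right by (subst sum.swap) (simp add: mult.assoc)
    also have "\<dots> = 0" using g b by simp
    finally obtain C where C: "\<forall>l\<le>d. B l = (\<Sum>j=1..d. C j * syz s j l)" using exact by blast
    have bk: "b k = (\<Sum>i=1..d. C (\<sigma> i) * p i k)" if k: "k \<le> d" for k
    proof -
      have "b k = (\<Sum>j\<le>d. b j * (if j = k then 1 else 0))"
        using k by (simp add: if_distrib[of "\<lambda>x. _ * x"] cong: if_cong)
      also have "\<dots> = (\<Sum>j\<le>d. b j * (\<Sum>l\<le>d. [:[:g j l:]:] * [:[:g' l k:]:]))"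
        using gg' k by (intro sum.cong) auto
      also have "\<dots> = (\<Sum>l\<le>d. B l * [:[:g' l k:]:])"
        unfolding B_def sum_distrib_left sum_distrib_right by (subst sum.swap) (simp only: mult.assoc)
      also have "\<dots> = (\<Sum>l\<le>d. (\<Sum>i=1..d. C (\<sigma> i) * syz s (\<sigma> i) l) * [:[:g' l k:]:])"
      proof (intro sum.cong refl)
        fix l assume "l \<in> {..d}"
        then have "B l = (\<Sum>j=1..d. C (\<sigma> (\<tau> j)) * syz s j l)"
          using C \<sigma>\<tau>(1) by simp
        then show "B l * [:[:g' l k:]:] = (\<Sum>i=1..d. C (\<sigma> i) * syz s (\<sigma> i) l) * [:[:g' l k:]:]"
          using reindex[of "\<lambda>i. C (\<sigma> i)" l] by simp
      qed
      also have "\<dots> = (\<Sum>i=1..d. C (\<sigma> i) * p i k)"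
        unfolding p_def sum_distrib_left sum_distrib_right by (subst sum.swap) (simp only: mult.assoc)
      finally show ?thesis .
    qed
    show "\<exists>c. \<forall>j\<le>d. b j = (\<Sum>i=1..d. c i * p i j)"
      by (intro exI[of _ "\<lambda>i. C (\<sigma> i)"] allI impI bk)
  next
    fix C i assume C: "\<forall>j\<le>d. (\<Sum>i=1..d. C i * p i j) = 0" and i: "i \<in> {1..d}"
    have "(\<Sum>j=1..d. C (\<tau> j) * syz s j k) = 0" if k: "k \<le> d" for k
    proof -
      have "(\<Sum>i=1..d. C i * syz s (\<sigma> i) k) = (\<Sum>i=1..d. C i * (\<Sum>l\<le>d. syz s (\<sigma> i) l * (if l = k then 1 else 0)))"
        using k by (simp add: if_distrib[of "\<lambda>x. _ * x"] cong: if_cong)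
      also have "\<dots> = (\<Sum>i=1..d. C i * (\<Sum>l\<le>d. syz s (\<sigma> i) l * (\<Sum>j\<le>d. [:[:g' l j:]:] * [:[:g j k:]:])))"
        using g'g k by (intro sum.cong refl arg_cong2[of _ _ _ _ "(*)"]) auto
      also have "\<dots> = (\<Sum>i=1..d. C i * (\<Sum>j\<le>d. p i j * [:[:g j k:]:]))"
      proof -
        have "(\<Sum>l\<le>d. syz s (\<sigma> i) l * (\<Sum>j\<le>d. [:[:g' l j:]:] * [:[:g j k:]:])) = (\<Sum>j\<le>d. p i j * [:[:g j k:]:])" for i
          unfolding p_def sum_distrib_left sum_distrib_right by (subst sum.swap) (simp only: mult.assoc)
        then show ?thesis by simp
      qed
      also have "\<dots> = (\<Sum>j\<le>d. (\<Sum>i=1..d. C i * p i j) * [:[:g j k:]:])"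
        unfolding sum_distrib_left sum_distrib_right by (subst sum.swap) (simp only: mult.assoc)
      also have "\<dots> = 0" using C by simp
      finally show ?thesis unfolding reindex .
    qed
    then have "C (\<tau> (\<sigma> i)) = 0"
      by (intro inj[of "\<lambda>j. C (\<tau> j)", OF _ \<tau>\<sigma>(2)[OF i]] allI impI)
    then show "C i = 0" using \<tau>\<sigma>(1)[OF i] by simp
  qed
qed

lemma in_P_mu_min_part: "a \<in> P_mu_min_part n d (n + 1 - e1, n + 1 - e2)"
  unfolding P_mu_min_part_def P_mu_def
  using a ind prime has_mu_type ancestor_partition by simp

end

subsection \<open>The strata\<close>

lemma P_mu_min_part_imp_split_rep:
  assumes "a \<in> P_mu_min_part n d (\<alpha>1, \<alpha>2)"
  shows "a \<in> form_tuples n d" "lin_indep_tuple d a" "rel_prime_tuple d a"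
    "split_rep n d (n + 1 - \<alpha>1) (n + 1 - \<alpha>2) a"
proof -
  show a: "a \<in> form_tuples n d" and "lin_indep_tuple d a" "rel_prime_tuple d a"
    using assms by (simp_all add: P_mu_min_part_def P_mu_def)
  obtain h1 h2 e1 e2 where h: "h1 \<in> forms e1" "h2 \<in> forms e2" "e2 \<le> e1" "e1 \<le> n"
    and I: "ideal_gen (a ` {..d}) \<inter> forms n = {u * h1 + v * h2 | u v. u \<in> forms (n - e1) \<and> v \<in> forms (n - e2)}"
    and A: "(\<alpha>1, \<alpha>2) = (n + 1 - e1, n + 1 - e2)"
    using assms unfolding P_mu_min_part_def ancestor_partition_def Let_def mem_Collect_eq
    by (elim conjE exE)
  have e: "e1 = n + 1 - \<alpha>1" "e2 = n + 1 - \<alpha>2" using A h by auto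
  have "\<exists>u v. u \<in> forms (n - e1) \<and> v \<in> forms (n - e2) \<and> a i = u * h1 + v * h2" if "i \<le> d" for i
  proof -
    have "a i \<in> ideal_gen (a ` {..d}) \<inter> forms n"
      using a that by (auto simp: form_tuples_def intro!: rm.span_base)
    then show ?thesis unfolding I by blast
  qed
  then show "split_rep n d (n + 1 - \<alpha>1) (n + 1 - \<alpha>2) a"
    unfolding split_rep_def e[symmetric] using h by metis
qed

lemma split_tuple_if:
  assumes A: "(\<alpha>1, \<alpha>2) \<in> two_part_partitions (d + 1)" and n: "n \<ge> d + 1"
    and a: "a \<in> form_tuples n d" "lin_indep_tuple d a" "rel_prime_tuple d a"
      "split_rep n d (n + 1 - \<alpha>1) (n + 1 - \<alpha>2) a"
  shows "\<exists>h1 h2 u v. split_tuple n d (n + 1 - \<alpha>1) (n + 1 - \<alpha>2) a h1 h2 u v"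
proof -
  obtain h1 h2 u v where h: "h1 \<in> forms (n + 1 - \<alpha>1)" "h2 \<in> forms (n + 1 - \<alpha>2)"
    "\<forall>i\<le>d. u i \<in> forms (n - (n + 1 - \<alpha>1)) \<and> v i \<in> forms (n - (n + 1 - \<alpha>2)) \<and> a i = u i * h1 + v i * h2"
    using a(4) unfolding split_rep_def by (elim exE conjE)
  have "split_tuple n d (n + 1 - \<alpha>1) (n + 1 - \<alpha>2) a h1 h2 u v"
    by unfold_locales (use a(1-3) h A n in \<open>auto simp: two_part_partitions_def\<close>)
  then show ?thesis by blast
qed

text \<open>Both the type and the ancestor ideal follow from a split representation, so the later
  arguments can check this elementary criterion instead.\<close>

lemma P_mu_min_part_iff:
  assumes A: "(\<alpha>1, \<alpha>2) \<in> two_part_partitions (d + 1)" and n: "n \<ge> d + 1"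
  shows "a \<in> P_mu_min_part n d (\<alpha>1, \<alpha>2) \<longleftrightarrow> a \<in> form_tuples n d \<and> lin_indep_tuple d a \<and>
    rel_prime_tuple d a \<and> split_rep n d (n + 1 - \<alpha>1) (n + 1 - \<alpha>2) a"
proof (intro iffI)
  assume *: "a \<in> form_tuples n d \<and> lin_indep_tuple d a \<and>
    rel_prime_tuple d a \<and> split_rep n d (n + 1 - \<alpha>1) (n + 1 - \<alpha>2) a"
  then obtain h1 h2 u v where s: "split_tuple n d (n + 1 - \<alpha>1) (n + 1 - \<alpha>2) a h1 h2 u v"
    using split_tuple_if[OF A n] by blast
  have "n + 1 - (n + 1 - \<alpha>1) = \<alpha>1" "n + 1 - (n + 1 - \<alpha>2) = \<alpha>2"
    using A n by (auto simp: two_part_partitions_def)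
  then show "a \<in> P_mu_min_part n d (\<alpha>1, \<alpha>2)"
    using split_tuple.in_P_mu_min_part[OF s] by simp
qed (use P_mu_min_part_imp_split_rep in blast)

text \<open>The linear syzygies of \<open>a\<close> correspond to the elements of the colon space of its span:
  a syzygy \<open>\<Sum> (u j varS + v j varT) a j = 0\<close> gives the form \<open>w\<close> with \<open>\<Sum> u j a j = varT w\<close>
  and \<open>\<Sum> v j a j = - varS w\<close>.\<close>

lemma mu_min_down_dim:
  assumes a: "a \<in> P_mu n d (mu_min n d)" and n: "n \<ge> d + 1"
  shows "vs.dim (down (tuple_span d a)) = d - 1"
proof -
  let ?V = "tuple_span d a"
  have af: "a i \<in> forms n" if "i \<le> d" for i using a that by (auto simp: P_mu_def form_tuples_def)
  have ind: "lin_indep_tuple d a" using a by (simp add: P_mu_def)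
  have sV: "vs.subspace ?V" using tuple_span_dim(2)[OF ind] by (rule vs.fin_sub_subspace)
  obtain p where p: "\<forall>i\<in>{1..d}. \<forall>j\<le>d. p i j \<in> forms (mu_min n d i)"
    and syz: "\<forall>i\<in>{1..d}. (\<Sum>j\<le>d. p i j * a j) = 0"
    and exact: "\<forall>b. (\<Sum>j\<le>d. b j * a j) = 0 \<longrightarrow> (\<exists>c. \<forall>j\<le>d. b j = (\<Sum>i=1..d. c i * p i j))"
    and inj: "\<forall>c. (\<forall>j\<le>d. (\<Sum>i=1..d. c i * p i j) = 0) \<longrightarrow> (\<forall>i\<in>{1..d}. c i = 0)"
    using a unfolding P_mu_def has_mu_type_def mem_Collect_eq by (elim conjE exE)
  define u v where "u = (\<lambda>i j. cf (p i j) 0 1)" and "v = (\<lambda>i j. cf (p i j) 1 0)"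
  have puv: "p i j = smult [:u i j:] varS + smult [:v i j:] varT" if "i \<in> {1..<d}" "j \<le> d" for i j
  proof -
    have "p i j \<in> forms (mu_min n d i)" using p that by simp
    then have "p i j \<in> forms 1" using that by (simp add: mu_min_def)
    from form_of_cf[OF this] show ?thesis by (simp add: form_of_def u_def v_def)
  qed
  have ex_w: "\<exists>w. (\<Sum>j\<le>d. smult [:u i j:] (a j)) = varT * w \<and> (\<Sum>j\<le>d. smult [:v i j:] (a j)) = - (varS * w)"
    if i: "i \<in> {1..<d}" for i
  proof -
    have "varS * (\<Sum>j\<le>d. smult [:u i j:] (a j)) + varT * (\<Sum>j\<le>d. smult [:v i j:] (a j)) = (\<Sum>j\<le>d. p i j * a j)"
      using puv[OF i] by (simp add: sum_distrib_left distrib_right sum.distrib)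
    also have "\<dots> = 0" using syz i by simp
    finally have "varS * (\<Sum>j\<le>d. smult [:u i j:] (a j)) = varT * (- (\<Sum>j\<le>d. smult [:v i j:] (a j)))"
      by (simp add: eq_neg_iff_add_eq_0)
    from varS_cancel_varT[OF this] obtain w where
      w: "(\<Sum>j\<le>d. smult [:u i j:] (a j)) = varT * w" "- (\<Sum>j\<le>d. smult [:v i j:] (a j)) = varS * w" by blast
    from arg_cong[OF w(2), of uminus] w(1) show ?thesis
      by (intro exI[of _ w] conjI) (simp_all only: minus_minus)
  qed
  have "\<forall>i\<in>{1..<d}. \<exists>w. (\<Sum>j\<le>d. smult [:u i j:] (a j)) = varT * w \<and>
      (\<Sum>j\<le>d. smult [:v i j:] (a j)) = - (varS * w)"
    by (intro ballI ex_w)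
  from bchoice[OF this] obtain w where "\<forall>i\<in>{1..<d}. (\<Sum>j\<le>d. smult [:u i j:] (a j)) = varT * w i \<and>
      (\<Sum>j\<le>d. smult [:v i j:] (a j)) = - (varS * w i)"
    by (elim exE)
  then have wT: "(\<Sum>j\<le>d. smult [:u i j:] (a j)) = varT * w i"
    and wS: "(\<Sum>j\<le>d. smult [:v i j:] (a j)) = - (varS * w i)" if "i \<in> {1..<d}" for i
    using that by blast+
  have V: "(\<Sum>j\<le>d. smult [:c j:] (a j)) \<in> ?V" for c by (simp add: tuple_span_def)
  have w_down: "w i \<in> down ?V" if "i \<in> {1..<d}" for i
  proof -
    have "- (varS * w i) \<in> ?V" using V[of "v i"] unfolding wS[OF that] .
    from vs.subspace_neg[OF sV this] have "varS * w i \<in> ?V" by simp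
    moreover have "varT * w i \<in> ?V" using V[of "u i"] unfolding wT[OF that] .
    ultimately show ?thesis by (simp add: down_def)
  qed
  have combine: "(\<Sum>j\<le>d. smult [:\<Sum>i=1..<d. c i * x i j:] (a j)) =
      (\<Sum>i=1..<d. smult [:c i:] (\<Sum>j\<le>d. smult [:x i j:] (a j)))" for c and x :: "nat \<Rightarrow> nat \<Rightarrow> 'a"
  proof -
    have "smult [:\<Sum>i=1..<d. c i * x i j:] (a j) = (\<Sum>i=1..<d. smult [:c i:] (smult [:x i j:] (a j)))" for j
      unfolding vs.scale_sum_left by (simp add: mult.commute)
    then show ?thesis unfolding vs.scale_sum_right by (simp add: sum.swap[of _ "{..d}"])
  qed
  have coeffs_eq: "x j = y j" if "(\<Sum>j\<le>d. smult [:x j:] (a j)) = (\<Sum>j\<le>d. smult [:y j:] (a j))" "j \<le> d" for x y j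
  proof -
    have "(\<Sum>j\<le>d. smult [:x j - y j:] (a j)) = 0"
      using that(1) by (simp add: vs.scale_left_diff_distrib sum_subtractf)
    then have "x j - y j = 0" using ind[unfolded lin_indep_tuple_def, rule_format, of "\<lambda>j. x j - y j"] that(2) by blast
    then show ?thesis by simp
  qed
  have "down ?V = range (\<lambda>c. \<Sum>i\<in>{1..<d}. smult [:c i:] (w i))"
  proof (intro subset_antisym subsetI)
    fix h assume "h \<in> down ?V"
    then obtain c c' where c: "varS * h = (\<Sum>j\<le>d. smult [:c j:] (a j))" and c': "varT * h = (\<Sum>j\<le>d. smult [:c' j:] (a j))"
      unfolding down_def tuple_span_def by blast
    \<comment> \<open>The two expansions satisfy
      \<open>varT * (varS * h) = varS * (varT * h)\<close>, so an element \<open>h\<close> of the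
      colon space yields a linear syzygy.\<close>
    let ?b = "\<lambda>j. smult [:c j:] varT - smult [:c' j:] varS"
    have "(\<Sum>j\<le>d. ?b j * a j) = varT * (\<Sum>j\<le>d. smult [:c j:] (a j)) - varS * (\<Sum>j\<le>d. smult [:c' j:] (a j))"
      by (simp add: sum_distrib_left left_diff_distrib sum_subtractf)
    also have "\<dots> = 0" unfolding c[symmetric] c'[symmetric] by (simp add: mult.left_commute)
    finally have "(\<Sum>j\<le>d. ?b j * a j) = 0" .
    from exact[THEN spec, of ?b, THEN mp, OF this]
    obtain C where C: "\<forall>j\<le>d. ?b j = (\<Sum>i=1..d. C i * p i j)" by (elim exE)
    define g where "g = (\<lambda>i. cf (C i) 0 0)"
    \<comment> \<open>In degree 1 only the constant terms of the multipliers of linear rows count.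
      The last row has degree \<open>n - d + 1\<close>, at least 2, and does not contribute.\<close>
    have bj: "?b j = (\<Sum>i=1..<d. smult [:g i:] (p i j))" if j: "j \<le> d" for j
    proof -
      have "?b j \<in> forms 1" by auto
      then have "?b j = hcomp 1 (?b j)" using hcomp_form[of "?b j" 1 1] by simp
      also have "\<dots> = hcomp 1 (\<Sum>i=1..d. C i * p i j)"
        using C j by (intro arg_cong[of _ _ "hcomp 1"]) blast
      also have "\<dots> = (\<Sum>i=1..d. hcomp 1 (C i * p i j))" by (rule hcomp_sum)
      also have "\<dots> = (\<Sum>i=1..d. if i < d then smult [:g i:] (p i j) else 0)"
      proof (intro sum.cong refl)
        fix i assume i: "i \<in> {1..d}"
        show "hcomp 1 (C i * p i j) = (if i < d then smult [:g i:] (p i j) else 0)"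
        proof (cases "i < d")
          case True
          have "p i j \<in> forms (mu_min n d i)" using p i j by simp
          then have "p i j \<in> forms 1" using True by (simp add: mu_min_def)
          from hcomp_mult[OF this, of 0 "C i"] have "hcomp 1 (C i * p i j) = hcomp 0 (C i) * p i j" by simp
          also have "hcomp 0 (C i) = [:[:g i:]:]" by (simp add: hcomp_def form_of_def g_def)
          finally show ?thesis using True by simp
        next
          case False
          have "p i j \<in> forms (mu_min n d i)" using p i j by simp
          then have "p i j \<in> forms (n - d + 1)" using False by (simp add: mu_min_def)
          from hcomp_mult_below[OF this, of 1 "C i"] False n show ?thesis by simp
        qed
      qed
      also have "\<dots> = (\<Sum>i=1..<d. smult [:g i:] (p i j))"
        by (rule sum.mono_neutral_cong_right) auto
      finally show ?thesis .
    qed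
    have cj: "c j = (\<Sum>i=1..<d. g i * v i j)" if j: "j \<le> d" for j
    proof -
      have T: "cf (varT :: 'a poly poly) 1 0 = 1" "cf (varS :: 'a poly poly) 1 0 = 0"
        using cf_monomial[of 0 1 1 0, where 'a = 'a] cf_monomial[of 1 0 1 0, where 'a = 'a] by simp_all
      have "c j = cf (?b j) 1 0" using T by simp
      also have "\<dots> = (\<Sum>i=1..<d. g i * v i j)"
        unfolding bj[OF j] cf_sum by (simp add: v_def)
      finally show ?thesis .
    qed
    have "varS * h = (\<Sum>j\<le>d. smult [:\<Sum>i=1..<d. g i * v i j:] (a j))"
      unfolding c using cj by (intro sum.cong) auto
    also have "\<dots> = (\<Sum>i=1..<d. smult [:g i:] (- (varS * w i)))"
      unfolding combine using wS by simp
    also have "\<dots> = varS * (\<Sum>i=1..<d. smult [:- g i:] (w i))"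
      by (simp add: sum_distrib_left sum_negf)
    finally have "h = (\<Sum>i=1..<d. smult [:- g i:] (w i))" by simp
    then show "h \<in> range (\<lambda>c. \<Sum>i\<in>{1..<d}. smult [:c i:] (w i))"
      by (intro range_eqI[of _ _ "\<lambda>i. - g i"]) simp
  next
    fix h assume "h \<in> range (\<lambda>c. \<Sum>i\<in>{1..<d}. smult [:c i:] (w i))"
    then obtain c where "h = (\<Sum>i\<in>{1..<d}. smult [:c i:] (w i))" by blast
    then show "h \<in> down ?V"
      using w_down by (auto intro!: vs.subspace_sum[OF down_subspace[OF sV]] vs.subspace_scale[OF down_subspace[OF sV]])
  qed
  \<comment> \<open>A relation between the \<open>w i\<close> would make the same combination of the
    linear rows vanish, in its \<open>varS\<close> part and in its \<open>varT\<close> part, against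
    injectivity of the resolution.\<close>
  moreover have "\<forall>i\<in>{1..<d}. c i = 0" if 0: "(\<Sum>i\<in>{1..<d}. smult [:c i:] (w i)) = 0" for c
  proof -
    have "(\<Sum>j\<le>d. smult [:\<Sum>i=1..<d. c i * u i j:] (a j)) = (\<Sum>i=1..<d. smult [:c i:] (varT * w i))"
      unfolding combine using wT by simp
    also have "\<dots> = varT * (\<Sum>i=1..<d. smult [:c i:] (w i))" by (simp add: sum_distrib_left)
    also have "\<dots> = (\<Sum>j\<le>d. smult [:0:] (a j))" using 0 by simp
    finally have u0: "(\<Sum>i=1..<d. c i * u i j) = 0" if "j \<le> d" for j
      using coeffs_eq[of "\<lambda>j. \<Sum>i=1..<d. c i * u i j" "\<lambda>_. 0" j] that by blast
    have "(\<Sum>j\<le>d. smult [:\<Sum>i=1..<d. c i * v i j:] (a j)) = (\<Sum>i=1..<d. smult [:c i:] (- (varS * w i)))"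
      unfolding combine using wS by simp
    also have "\<dots> = - (varS * (\<Sum>i=1..<d. smult [:c i:] (w i)))" by (simp add: sum_distrib_left sum_negf)
    also have "\<dots> = (\<Sum>j\<le>d. smult [:0:] (a j))" using 0 by simp
    finally have v0: "(\<Sum>i=1..<d. c i * v i j) = 0" if "j \<le> d" for j
      using coeffs_eq[of "\<lambda>j. \<Sum>i=1..<d. c i * v i j" "\<lambda>_. 0" j] that by blast
    let ?C = "\<lambda>i. if i < d then [:[:c i:]:] else 0"
    have "(\<Sum>i=1..d. ?C i * p i j) = 0" if j: "j \<le> d" for j
    proof -
      have "(\<Sum>i=1..d. ?C i * p i j) = (\<Sum>i=1..<d. smult [:c i:] (p i j))"
        by (rule sum.mono_neutral_cong_right) auto
      also have "\<dots> = (\<Sum>i=1..<d. smult [:c i * u i j:] varS + smult [:c i * v i j:] varT)"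
        using puv j by (intro sum.cong) (auto simp: smult_add_right mult.commute)
      also have "\<dots> = smult [:\<Sum>i=1..<d. c i * u i j:] varS + smult [:\<Sum>i=1..<d. c i * v i j:] varT"
        unfolding vs.scale_sum_left sum.distrib ..
      also have "\<dots> = 0" using u0 v0 j by simp
      finally show ?thesis .
    qed
    then have C0: "\<forall>i\<in>{1..d}. ?C i = 0" by (intro inj[THEN spec, of ?C, THEN mp] allI impI)
    show ?thesis
    proof
      fix i assume "i \<in> {1..<d}"
      with bspec[OF C0, of i] show "c i = 0" by simp
    qed
  qed
  ultimately have "vs.dim (down ?V) = card {1..<d}"
    by (intro vs.dim_indexed_basis(1)) auto
  then show ?thesis by simp
qed

text \<open>The \<open>d - 1\<close> linear syzygies say that passing from the span, of dimension
  \<open>d + 1\<close>, to its colon space lowers the dimension by exactly 2, the situation of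
  \<open>down_dim_pred2_imp_gen2\<close>.\<close>

lemma P_mu_min_eq_Union:
  assumes n: "n \<ge> d + 1" and d: "d \<ge> 1"
  shows "P_mu n d (mu_min n d) = (\<Union>A\<in>two_part_partitions (d + 1). P_mu_min_part n d A)"
proof (intro subset_antisym subsetI)
  fix a assume a: "a \<in> P_mu n d (mu_min n d)"
  let ?V = "tuple_span d a"
  have a': "a \<in> form_tuples n d" "lin_indep_tuple d a" "rel_prime_tuple d a" using a by (simp_all add: P_mu_def)
  have V: "vs.subspace ?V" "?V \<subseteq> forms n" "vs.dim ?V = d - 1 + 2" "vs.dim (down ?V) = d - 1"
    using tuple_span_dim[OF a'(2)] tuple_span_in_forms[OF a'(1)] mu_min_down_dim[OF a n] d
    by (simp_all add: vs.fin_sub_subspace)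
  obtain h1 h2 e1 e2 where h: "h1 \<noteq> 0" "h2 \<noteq> 0" "h1 \<in> forms e1" "h2 \<in> forms e2" "e2 \<le> e1" "e1 \<le> n"
    "(n + 1 - e1) + (n + 1 - e2) = d - 1 + 2" and Veq: "?V = gen2 h1 h2 n"
    using down_dim_pred2_imp_gen2[OF V] by (elim exE conjE)
  have A: "(n + 1 - e1, n + 1 - e2) \<in> two_part_partitions (d + 1)"
    using h d by (auto simp: two_part_partitions_def)
  have e: "n + 1 - (n + 1 - e1) = e1" "n + 1 - (n + 1 - e2) = e2" using h by auto
  have "\<exists>u v. u \<in> forms (n - e1) \<and> v \<in> forms (n - e2) \<and> a i = u * h1 + v * h2" if "i \<le> d" for i
  proof -
    have "a i \<in> gen2 h1 h2 n" using tuple_in_tuple_span[OF that, of a] by (simp only: Veq)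
    then show ?thesis using gen2_eq[OF h(3,4,1,2), of n] h(5,6) by auto
  qed
  then have "split_rep n d e1 e2 a" unfolding split_rep_def using h by metis
  then have "a \<in> P_mu_min_part n d (n + 1 - e1, n + 1 - e2)"
    unfolding P_mu_min_part_iff[OF A n] e using a' by simp
  then show "a \<in> (\<Union>A\<in>two_part_partitions (d + 1). P_mu_min_part n d A)" using A by blast
qed (auto simp: P_mu_min_part_def)

subsection \<open>Openness of linear independence and of coprimality\<close>

lemma top_component:
  fixes p :: "'k::field poly poly"
  assumes "p \<noteq> 0"
  obtains k where "hcomp k p \<noteq> 0" "\<And>m. m > k \<Longrightarrow> hcomp m p = 0"
proof -
  let ?E = "{(i, j). cf p i j \<noteq> 0}"
  have "?E \<subseteq> Sigma {..degree p} (\<lambda>i. {..degree (coeff p i)})"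
    by (auto intro!: le_degree)
  then have fin: "finite ?E" by (rule finite_subset) auto
  have "?E \<noteq> {}"
  proof
    assume "?E = {}"
    then have "p = 0" by (intro poly_poly_eqI) auto
    with assms show False by simp
  qed
  define k where "k = Max ((\<lambda>(i, j). i + j) ` ?E)"
  have "k \<in> (\<lambda>(i, j). i + j) ` ?E" unfolding k_def using fin \<open>?E \<noteq> {}\<close> by (intro Max_in) auto
  then obtain i j where ij: "cf p i j \<noteq> 0" "k = i + j" by auto
  have le: "i + j \<le> k" if "cf p i j \<noteq> 0" for i j
    unfolding k_def using fin that by (intro Max_ge) force+
  show thesis
  proof (rule that[of k])
    have "cf (hcomp k p) i j \<noteq> 0" using ij by (simp add: cf_hcomp)
    then show "hcomp k p \<noteq> 0" by auto
    fix m assume "m > k"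
    have "cf p i j = 0" if "i + j = m" for i j
      using le[of i j] \<open>m > k\<close> that by force
    then show "hcomp m p = 0"
      by (intro poly_poly_eqI) (auto simp: cf_hcomp)
  qed
qed

lemma hcomp_top_mult:
  assumes "\<And>m. m > k \<Longrightarrow> hcomp m p = 0" "\<And>m. m > l \<Longrightarrow> hcomp m q = 0"
  shows "hcomp (k + l) (p * q) = hcomp k p * hcomp l q"
proof (rule poly_poly_eqI)
  fix i j
  have p0: "cf p i j = 0" if "i + j > k" for i j
    using arg_cong[OF assms(1)[OF that], of "\<lambda>x. cf x i j"] by (simp add: cf_hcomp)
  have q0: "cf q i j = 0" if "i + j > l" for i j
    using arg_cong[OF assms(2)[OF that], of "\<lambda>x. cf x i j"] by (simp add: cf_hcomp)
  show "cf (hcomp (k + l) (p * q)) i j = cf (hcomp k p * hcomp l q) i j"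
  proof (cases "i + j = k + l")
    case True
    have "cf p i' j' * cf q (i - i') (j - j') = cf (hcomp k p) i' j' * cf (hcomp l q) (i - i') (j - j')"
      if le: "i' \<le> i" "j' \<le> j" for i' j'
    proof -
      consider "i' + j' > k" | "i' + j' = k" "(i - i') + (j - j') = l" | "(i - i') + (j - j') > l" "i' + j' \<noteq> k"
        using True le by linarith
      then show ?thesis by cases (auto simp: cf_hcomp p0 q0)
    qed
    then have "cf (p * q) i j = cf (hcomp k p * hcomp l q) i j"
      unfolding cf_mult by (intro sum.cong) auto
    with True show ?thesis by (simp add: cf_hcomp)
  next
    case False
    moreover have "hcomp k p * hcomp l q \<in> forms (k + l)" by auto
    ultimately show ?thesis by (simp add: cf_hcomp formsD)
  qed
qed

lemma polynomial_functions_coord_monomial: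
  assumes "i \<le> d" "k + l + n = m" "b \<le> m"
  shows "(\<lambda>x. cf (varS ^ k * varT ^ l * x i) b (m - b)) \<in> polynomial_functions n d"
proof -
  have eq: "cf (varS ^ k * varT ^ l * p) b (m - b) =
      (if k \<le> m - b \<and> l \<le> b then cf p (b - l) (n - (b - l)) else 0)" for p :: "'a poly poly"
  proof -
    have "m - b - k = n - (b - l)" if "k \<le> m - b" "l \<le> b" using assms that by linarith
    then show ?thesis unfolding mult.assoc cf_varS_power_mult cf_varT_power_mult by auto
  qed
  show ?thesis
  proof (cases "k \<le> m - b \<and> l \<le> b")
    case True
    then have "b - l \<le> n" using assms by linarith
    from polynomial_functions.coord[OF assms(1) this] show ?thesis
      by (simp only: eq True simp_thms if_True)
  qed (auto simp only: eq if_False intro: polynomial_functions.const)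
qed

lemma lin_indep_open:
  fixes a0 :: "nat \<Rightarrow> 'k::field poly poly"
  assumes a0: "a0 \<in> form_tuples n d" "lin_indep_tuple d a0"
  obtains f where "f \<in> polynomial_functions n d" "f a0 \<noteq> 0" "\<And>a. f a \<noteq> 0 \<Longrightarrow> lin_indep_tuple d a"
proof -
  interpret fun_ring "polynomial_functions n d :: ((nat \<Rightarrow> 'k poly poly) \<Rightarrow> 'k) set"
    by (rule fun_ring_polynomial_functions)
  show thesis
  proof (rule form_system_injective_near[of "{..d}" "{()}" "\<lambda>i x _. x i" a0 "\<lambda>_. n"], goal_cases)
    case (3 i q)
    then show ?case using a0 by (auto simp: form_tuples_def)
  next
    case (4 i q b)
    then show ?case by (auto intro: polynomial_functions.coord)
  next
    case (5 y)
    then show ?case using a0(2) by (auto simp: lin_indep_tuple_def)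
  next
    case (6 f)
    show ?case
    proof (rule that[OF 6(1,2)])
      fix a assume "f a \<noteq> 0"
      then show "lin_indep_tuple d a" unfolding lin_indep_tuple_def using 6(3)[of a] by auto
    qed
  qed simp_all
qed

text \<open>A tuple with a common divisor of positive degree has proportional tuples \<open>q\<close> of smaller
  degree; the equations \<open>q i a j = q j a i\<close> are linear in \<open>q\<close>.\<close>

lemma rel_prime_open:
  fixes a0 :: "nat \<Rightarrow> 'k::field poly poly"
  assumes a0: "a0 \<in> form_tuples n d" "lin_indep_tuple d a0" "rel_prime_tuple d a0" and n: "n \<ge> 1"
  obtains f where "f \<in> polynomial_functions n d" "f a0 \<noteq> 0"
    "\<And>a. f a \<noteq> 0 \<Longrightarrow> a \<in> form_tuples n d \<Longrightarrow> lin_indep_tuple d a \<Longrightarrow> rel_prime_tuple d a"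
proof -
  interpret fun_ring "polynomial_functions n d :: ((nat \<Rightarrow> 'k poly poly) \<Rightarrow> 'k) set"
    by (rule fun_ring_polynomial_functions)
  define M where "M = (\<lambda>k. varS ^ (n - 1 - k) * varT ^ k :: 'k poly poly)"
  \<comment> \<open>The unknowns are the coefficients of forms \<open>q i\<close> of degree
    \<open>n - 1\<close>; equation \<open>(p, r)\<close> is
    \<open>q p * x r - q r * x p = 0\<close>, in degree \<open>2 * n - 1\<close>.\<close>
  define B :: "nat \<times> nat \<Rightarrow> (nat \<Rightarrow> 'k poly poly) \<Rightarrow> nat \<times> nat \<Rightarrow> 'k poly poly" where
    "B = (\<lambda>(i, k) x (p, r). (if p = i then M k * x r else 0) - (if r = i then M k * x p else 0))"
  define I where "I = {..d} \<times> {..n - 1}"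
  define q :: "(nat \<times> nat \<Rightarrow> 'k) \<Rightarrow> nat \<Rightarrow> 'k poly poly" where
    "q = (\<lambda>y i. form_of (n - 1) (\<lambda>k. y (i, k)))"
  have nonzero: "a i \<noteq> 0" if "lin_indep_tuple d a" "i \<le> d" for a :: "nat \<Rightarrow> 'k poly poly" and i
  proof
    assume "a i = 0"
    then have "(\<Sum>j\<le>d. smult [:if j = i then 1 else 0:] (a j)) = 0" by (intro sum.neutral) auto
    from that(1)[unfolded lin_indep_tuple_def, rule_format, OF this that(2)] show False by simp
  qed
  have sumB: "(\<Sum>i\<in>I. smult [:y i:] (B i x pr)) = q y (fst pr) * x (snd pr) - q y (snd pr) * x (fst pr)"
    if pr: "pr \<in> {..d} \<times> {..d}" for y x pr
  proof -
    obtain p r where pr': "pr = (p, r)" "p \<le> d" "r \<le> d" using pr by auto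
    have *: "(\<Sum>i\<le>d. \<Sum>k\<le>n - 1. if p = i then smult [:y (i, k):] (M k * z) else 0) = q y p * z" if "p \<le> d" for p z
    proof -
      have "(\<Sum>i\<le>d. \<Sum>k\<le>n - 1. if p = i then smult [:y (i, k):] (M k * z) else 0) =
        (\<Sum>i\<le>d. if p = i then \<Sum>k\<le>n - 1. smult [:y (i, k):] (M k * z) else 0)"
        by (intro sum.cong) auto
      also have "\<dots> = (\<Sum>k\<le>n - 1. smult [:y (p, k):] (M k * z))" using that by simp
      also have "\<dots> = q y p * z" by (simp add: q_def form_of_def sum_distrib_right M_def)
      finally show ?thesis .
    qed
    have "(\<Sum>i\<in>I. smult [:y i:] (B i x pr)) = (\<Sum>i\<le>d. \<Sum>k\<le>n - 1. smult [:y (i, k):] (B (i, k) x pr))"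
      unfolding I_def by (simp add: sum.cartesian_product case_prod_unfold)
    also have "\<dots> = (\<Sum>i\<le>d. \<Sum>k\<le>n - 1. (if p = i then smult [:y (i, k):] (M k * x r) else 0) -
        (if r = i then smult [:y (i, k):] (M k * x p) else 0))"
      unfolding pr' by (intro sum.cong) (auto simp: B_def smult_diff_right)
    also have "\<dots> = q y p * x r - q y r * x p"
      unfolding sum_subtractf using pr' * by simp
    finally show ?thesis using pr' by simp
  qed
  have Mf: "M k \<in> forms (n - 1)" if "k \<le> n - 1" for k using that unfolding M_def by (intro monomial_in_forms) auto
  have Mc: "(\<lambda>x. cf (M k * x i) b (2 * n - 1 - b)) \<in> polynomial_functions n d"
    if "k \<le> n - 1" "i \<le> d" "b \<le> 2 * n - 1" for k i b
    unfolding M_def using that n by (intro polynomial_functions_coord_monomial) auto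
  show thesis
  proof (rule form_system_injective_near[of I "{..d} \<times> {..d}" B a0 "\<lambda>_. 2 * n - 1"], goal_cases)
    case 1 show ?case by (simp add: I_def)
  next
    case 2 show ?case by simp
  next
    case (3 i pr)
    have "M k * a0 j \<in> forms (2 * n - 1)" if "k \<le> n - 1" "j \<le> d" for k j
      using Mf[OF that(1)] a0(1) that n by (intro mult_in_forms'[of _ "n - 1" _ n]) (auto simp: form_tuples_def)
    then show ?case using 3 by (auto simp: B_def I_def)
  next
    case (4 i pr b)
    obtain j k p r where jk: "i = (j, k)" "pr = (p, r)" by (cases i; cases pr)
    have eq: "cf (B i x pr) b (2 * n - 1 - b) = (if p = j then cf (M k * x r) b (2 * n - 1 - b) else 0) -
       (if r = j then cf (M k * x p) b (2 * n - 1 - b) else 0)" for x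
      by (simp add: B_def jk)
    show ?case unfolding eq using 4 jk Mc by (cases "p = j"; cases "r = j") (auto simp: I_def)
  next
    case (5 y)
    have eq: "q y p * a0 r = q y r * a0 p" if "p \<le> d" "r \<le> d" for p r
      using 5[rule_format, of "(p, r)"] sumB[of "(p, r)" y a0] that by simp
    have "q y p = 0" if p: "p \<le> d" for p
    proof (rule ccontr)
      assume q0: "q y p \<noteq> 0"
      \<comment> \<open>Coprimality of the whole tuple makes \<open>a0 p\<close> a divisor of
        \<open>q y p\<close>, whose degree is too small.\<close>
      have "a0 p dvd q y p"
      proof (rule ufd_dvd_if_dvd_mults[of "a0 ` {..d}"])
        fix x assume "x \<in> a0 ` {..d}"
        then obtain r where r: "r \<le> d" "x = a0 r" by auto
        have "x * q y p = q y r * a0 p" using eq[OF p r(1)] r(2) by (simp add: mult.commute)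
        then show "a0 p dvd x * q y p" by simp
      next
        fix g assume "\<And>x. x \<in> a0 ` {..d} \<Longrightarrow> g dvd x"
        then show "g dvd 1" using a0(3) by (auto simp: rel_prime_tuple_def)
      qed simp
      then obtain c where c: "q y p = c * a0 p" by (metis dvdE mult.commute)
      have "c * a0 p \<in> forms (n - 1)" unfolding c[symmetric] by (simp add: q_def)
      moreover have "a0 p \<in> forms n" using a0(1) p by (auto simp: form_tuples_def)
      ultimately show False using factor_in_forms[of c "a0 p" "n - 1" n] q0 c n by auto
    qed
    then have "y (p, k) = 0" if "p \<le> d" "k \<le> n - 1" for p k
      using cf_form_of[of "n - 1" "\<lambda>k. y (p, k)" k "n - 1 - k"] that n by (simp add: q_def split: if_splits)
    then show ?case by (auto simp: I_def)
  next
    case (6 f)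
    show ?case
    proof (rule that[OF 6(1,2)])
      fix a :: "nat \<Rightarrow> 'k poly poly"
      assume fa: "f a \<noteq> 0" and a: "a \<in> form_tuples n d" "lin_indep_tuple d a"
      have af: "a i \<in> forms n" if "i \<le> d" for i using a(1) that by (auto simp: form_tuples_def)
      show "rel_prime_tuple d a"
        unfolding rel_prime_tuple_def
      proof (intro allI impI)
        fix g assume "\<forall>i\<le>d. g dvd a i"
        then have "\<forall>i\<le>d. \<exists>c. a i = g * c" by (auto simp: dvd_def)
        then obtain c where c: "\<And>i. i \<le> d \<Longrightarrow> a i = g * c i" by metis
        \<comment> \<open>The cofactors \<open>c i\<close> are not known to be forms. Their
          components of degree \<open>m\<close>, raised to degree \<open>n - 1\<close> by a power of
          \<open>varS\<close>, satisfy the proportionality equations and therefore vanish.\<close>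
        have low: "hcomp m (c i) = 0" if m: "m \<le> n - 1" and i: "i \<le> d" for m i
        proof -
          let ?y = "\<lambda>(i, k). cf (varS ^ (n - 1 - m) * hcomp m (c i)) k (n - 1 - k)"
          have "varS ^ (n - 1 - m) * hcomp m (c i) \<in> forms (n - 1)" for i
            using m by (intro mult_in_forms') auto
          from form_of_cf[OF this] have qy: "q ?y i = varS ^ (n - 1 - m) * hcomp m (c i)" for i
            by (simp add: q_def)
          have "q ?y p * a r - q ?y r * a p = 0" if pr: "p \<le> d" "r \<le> d" for p r
          proof -
            have "hcomp m (c p) * a r = hcomp (m + n) (c p * a r)" using hcomp_mult[OF af[OF pr(2)]] by simp
            also have "c p * a r = c r * a p" using c pr by simp
            also have "hcomp (m + n) (c r * a p) = hcomp m (c r) * a p" using hcomp_mult[OF af[OF pr(1)]] by simp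
            finally show ?thesis unfolding qy by (simp add: mult.assoc)
          qed
          then have z: "\<forall>pr\<in>{..d} \<times> {..d}. (\<Sum>i\<in>I. smult [:?y i:] (B i a pr)) = 0"
            using sumB[of _ ?y a] by auto
          have "?y (i, k) = 0" if "k \<le> n - 1" for k
            by (rule 6(3)[OF fa z]) (use that i in \<open>simp add: I_def\<close>)
          then have "q ?y i = 0" by (simp add: q_def form_of_def)
          then show ?thesis unfolding qy by simp
        qed
        have nz: "a 0 \<noteq> 0" using nonzero[OF a(2)] by simp
        then have g0: "g \<noteq> 0" and c0: "c 0 \<noteq> 0" using c[of 0] by auto
        \<comment> \<open>The top degrees of \<open>g\<close> and \<open>c 0\<close> add up to
          \<open>n\<close>, and that of \<open>c 0\<close> is at least \<open>n\<close> by
          \<open>low\<close>; so \<open>g\<close> is constant.\<close>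
        obtain k where k: "hcomp k g \<noteq> 0" "\<And>m. m > k \<Longrightarrow> hcomp m g = 0" using top_component[OF g0] by blast
        obtain l where l: "hcomp l (c 0) \<noteq> 0" "\<And>m. m > l \<Longrightarrow> hcomp m (c 0) = 0" using top_component[OF c0] by blast
        have "hcomp (k + l) (a 0) \<noteq> 0" using hcomp_top_mult[OF k(2) l(2)] k(1) l(1) c[of 0] by simp
        then have "k + l = n" using hcomp_form[OF af[of 0], of "k + l"] by (simp split: if_splits)
        moreover have "l > n - 1" using low[of l 0] l(1) by force
        ultimately have "k = 0" by simp
        then have "g = hcomp 0 g"
        proof -
          have "cf g i j = cf (hcomp 0 g) i j" for i j
            using arg_cong[OF k(2)[of "i + j"], of "\<lambda>x. cf x i j"] \<open>k = 0\<close>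
            by (cases "i + j = 0") (auto simp: cf_hcomp)
          then show ?thesis by (rule poly_poly_eqI)
        qed
        then have "g \<in> forms 0" by (metis hcomp_in_forms)
        then obtain e where e: "g = [:[:e:]:]" by (auto simp only: forms_0_const)
        with g0 show "is_unit g" by (simp add: is_unit_const_poly_iff)
      qed
    qed
  qed
qed

lemma generic_tuple_open:
  fixes a0 :: "nat \<Rightarrow> 'k::field poly poly"
  assumes a0: "a0 \<in> form_tuples n d" "lin_indep_tuple d a0" "rel_prime_tuple d a0" and n: "n \<ge> 1"
  obtains f where "f \<in> polynomial_functions n d" "f a0 \<noteq> 0"
    "\<And>a. f a \<noteq> 0 \<Longrightarrow> a \<in> form_tuples n d \<Longrightarrow> lin_indep_tuple d a \<and> rel_prime_tuple d a"
proof -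
  obtain f where f: "f \<in> polynomial_functions n d" "f a0 \<noteq> 0" "\<And>a. f a \<noteq> 0 \<Longrightarrow> lin_indep_tuple d a"
    using lin_indep_open[OF a0(1,2)] by blast
  obtain g where g: "g \<in> polynomial_functions n d" "g a0 \<noteq> 0"
    "\<And>a. g a \<noteq> 0 \<Longrightarrow> a \<in> form_tuples n d \<Longrightarrow> lin_indep_tuple d a \<Longrightarrow> rel_prime_tuple d a"
    using rel_prime_open[OF a0 n] by blast
  show thesis
    by (rule that[of "\<lambda>a. f a * g a"]) (use f g in \<open>auto intro: polynomial_functions.mult\<close>)
qed

section \<open>Irreducibility and closure of the strata\<close>

definition mk_tuple :: "nat \<Rightarrow> (nat \<Rightarrow> 'k::field poly poly) \<Rightarrow> (nat \<Rightarrow> 'k poly poly) \<Rightarrow>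
    'k poly poly \<Rightarrow> 'k poly poly \<Rightarrow> nat \<Rightarrow> 'k poly poly" where
  "mk_tuple d u v h1 h2 = (\<lambda>i. if i \<le> d then u i * h1 + v i * h2 else undefined)"

lemma mk_tuple_in_form_tuples:
  assumes "e1 \<le> n" "e2 \<le> n" "h1 \<in> forms e1" "h2 \<in> forms e2"
    "\<And>i. i \<le> d \<Longrightarrow> u i \<in> forms (n - e1)" "\<And>i. i \<le> d \<Longrightarrow> v i \<in> forms (n - e2)"
  shows "mk_tuple d u v h1 h2 \<in> form_tuples n d"
proof -
  have "u i * h1 + v i * h2 \<in> forms n" if "i \<le> d" for i
    using assms that by (intro add_in_forms mult_in_forms'[of _ "n - e1" _ e1] mult_in_forms'[of _ "n - e2" _ e2]) auto
  then show ?thesis by (auto simp: mk_tuple_def form_tuples_def split: if_splits)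
qed

lemma mk_tuple_split_rep:
  assumes "h1 \<in> forms e1" "h2 \<in> forms e2"
    "\<And>i. i \<le> d \<Longrightarrow> u i \<in> forms (n - e1)" "\<And>i. i \<le> d \<Longrightarrow> v i \<in> forms (n - e2)"
  shows "split_rep n d e1 e2 (mk_tuple d u v h1 h2)"
  unfolding split_rep_def
  by (intro exI[of _ h1] exI[of _ h2] exI[of _ u] exI[of _ v]) (use assms in \<open>auto simp: mk_tuple_def\<close>)

lemma split_rep_eq_mk_tuple:
  assumes "split_rep n d e1 e2 a" "a \<in> form_tuples n d"
  obtains h1 h2 u v where "h1 \<in> forms e1" "h2 \<in> forms e2"
    "\<And>i. i \<le> d \<Longrightarrow> u i \<in> forms (n - e1)" "\<And>i. i \<le> d \<Longrightarrow> v i \<in> forms (n - e2)"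
    "a = mk_tuple d u v h1 h2"
proof -
  obtain h1 h2 u v where h: "h1 \<in> forms e1" "h2 \<in> forms e2" and
    uv: "\<forall>i\<le>d. u i \<in> forms (n - e1) \<and> v i \<in> forms (n - e2) \<and> a i = u i * h1 + v i * h2"
    using assms(1) unfolding split_rep_def by (elim exE conjE)
  have "a = mk_tuple d u v h1 h2"
  proof
    fix i show "a i = mk_tuple d u v h1 h2 i"
      using uv PiE_arb[of a "{..d}" _ i] assms(2) by (cases "i \<le> d") (auto simp: mk_tuple_def form_tuples_def)
  qed
  with h uv show thesis by (intro that) auto
qed

lemma common_divisor_of_powers:
  fixes g :: "'k::field poly poly"
  assumes "g dvd varS ^ k" "g dvd varT ^ l"
  shows "g dvd 1"
proof -
  obtain c where c: "varS ^ k = g * c" using assms(1) by (elim dvdE)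
  have "varS ^ k \<noteq> (0 :: 'k poly poly)" by simp
  then have gc: "g \<noteq> 0" "c \<noteq> 0" using c by auto
  have "degree (varS ^ k :: 'k poly poly) = 0" by (simp add: varS_power)
  then have "degree g = 0" using degree_mult_eq[OF gc] c by simp
  then obtain g0 where g0: "g = [:g0:]" by (elim degree_eq_zeroE)
  have "g0 dvd coeff (varT ^ l) l" using assms(2) unfolding g0 const_poly_dvd_iff by blast
  then have "g0 dvd 1" by (simp add: varT_power)
  then show ?thesis unfolding g0 by (simp add: is_unit_const_poly_iff)
qed

text \<open>The tuple of all monomials divisible by \<open>varT ^ e1\<close> or by \<open>varS ^ e2\<close>.\<close>

definition base_u :: "nat \<Rightarrow> nat \<Rightarrow> 'k::field poly poly" where
  "base_u b1 i = (if i \<le> b1 then varS ^ (b1 - i) * varT ^ i else 0)"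

definition base_v :: "nat \<Rightarrow> nat \<Rightarrow> nat \<Rightarrow> 'k::field poly poly" where
  "base_v d b1 i = (if i \<le> b1 then 0 else varS ^ (d - i) * varT ^ (i - b1 - 1))"

lemma base_tuple:
  assumes A: "(\<alpha>1, \<alpha>2) \<in> two_part_partitions (d + 1)" and n: "n \<ge> d + 1"
  shows "mk_tuple d (base_u (\<alpha>1 - 1)) (base_v d (\<alpha>1 - 1)) (varT ^ (n + 1 - \<alpha>1)) (varS ^ (n + 1 - \<alpha>2))
    \<in> P_mu_min_part n d (\<alpha>1, \<alpha>2)" (is "?a \<in> _")
    and "i \<le> d \<Longrightarrow> base_u (\<alpha>1 - 1) i \<in> forms (\<alpha>1 - 1)"
    and "i \<le> d \<Longrightarrow> base_v d (\<alpha>1 - 1) i \<in> forms (\<alpha>2 - 1)"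
proof -
  define e1 e2 b1 b2 where "e1 = n + 1 - \<alpha>1" and "e2 = n + 1 - \<alpha>2" and "b1 = \<alpha>1 - 1" and "b2 = \<alpha>2 - 1"
  have deg: "d = b1 + b2 + 1" "b1 + e1 = n" "b2 + e2 = n" "e1 \<le> n" "e2 \<le> n" "n < e1 + e2" "n - e1 = b1" "n - e2 = b2"
    using A n by (auto simp: two_part_partitions_def e1_def e2_def b1_def b2_def)
  have u: "base_u b1 i \<in> forms b1" if "i \<le> d" for i :: nat
    unfolding base_u_def by (auto intro: monomial_in_forms)
  have v: "base_v d b1 i \<in> forms b2" if "i \<le> d" for i
    unfolding base_v_def using that deg(1) by (auto intro!: monomial_in_forms)
  then show "i \<le> d \<Longrightarrow> base_u (\<alpha>1 - 1) i \<in> forms (\<alpha>1 - 1)" "i \<le> d \<Longrightarrow> base_v d (\<alpha>1 - 1) i \<in> forms (\<alpha>2 - 1)"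
    using u by (simp_all add: b1_def b2_def)
  have a: "?a i = base_u b1 i * varT ^ e1 + base_v d b1 i * varS ^ e2" if "i \<le> d" for i
    using that by (simp add: mk_tuple_def e1_def e2_def b1_def)
  \<comment> \<open>The pure powers of both variables occur, at the two positions where the blocks
    meet; they alone force coprimality.\<close>
  have S: "?a (b1 + 1) = varS ^ n"
    using a[of "b1 + 1"] deg by (simp add: base_u_def base_v_def flip: power_add)
  have T: "?a b1 = varT ^ n"
    using a[of b1] deg by (simp add: base_u_def base_v_def flip: power_add)
  have "?a \<in> form_tuples n d"
    using u v deg unfolding e1_def[symmetric] e2_def[symmetric] b1_def[symmetric]
    by (intro mk_tuple_in_form_tuples[of e1 n e2]) auto
  moreover have "lin_indep_tuple d ?a"
    unfolding lin_indep_tuple_def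
  proof (intro allI impI)
    fix c :: "nat \<Rightarrow> 'a" and i assume 0: "(\<Sum>i\<le>d. smult [:c i:] (?a i)) = 0" and i: "i \<le> d"
    have "(\<Sum>i\<le>d. smult [:c i:] (?a i)) = (\<Sum>i\<le>b1. smult [:c i:] (?a i)) + (\<Sum>i\<le>b2. smult [:c (b1 + 1 + i):] (?a (b1 + 1 + i)))"
      by (subst deg(1)) (rule sum_split_atMost)
    also have "(\<Sum>i\<le>b1. smult [:c i:] (?a i)) = form_of b1 c * varT ^ e1"
      unfolding form_of_def sum_distrib_right
    proof (intro sum.cong refl)
      fix i assume i: "i \<in> {..b1}"
      then have "i \<le> d" using deg(1) by simp
      from a[OF this] i show "smult [:c i:] (?a i) = smult [:c i:] (varS ^ (b1 - i) * varT ^ i) * varT ^ e1"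
        by (simp add: base_u_def base_v_def)
    qed
    also have "(\<Sum>i\<le>b2. smult [:c (b1 + 1 + i):] (?a (b1 + 1 + i))) = form_of b2 (\<lambda>i. c (b1 + 1 + i)) * varS ^ e2"
      unfolding form_of_def sum_distrib_right
    proof (intro sum.cong refl)
      fix i assume i: "i \<in> {..b2}"
      then have "b1 + 1 + i \<le> d" using deg(1) by simp
      from a[OF this] i deg(1) show "smult [:c (b1 + 1 + i):] (?a (b1 + 1 + i)) =
          smult [:c (b1 + 1 + i):] (varS ^ (b2 - i) * varT ^ i) * varS ^ e2"
        by (simp add: base_u_def base_v_def)
    qed
    finally have 0: "form_of b1 c * varT ^ e1 + form_of b2 (\<lambda>i. c (b1 + 1 + i)) * varS ^ e2 = 0"
      using 0 by simp
    have cop: "Rings.coprime (varT ^ e1) (varS ^ e2 :: 'a poly poly)"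
      unfolding Rings.coprime_def using common_divisor_of_powers by blast
    have "form_of b1 c * varT ^ e1 \<in> forms n" using deg by (intro mult_in_forms') auto
    from coprime_forms_unique[OF cop _ _ varT_power_in_forms varS_power_in_forms 0 this deg(6)]
    have "form_of b1 c = 0" "form_of b2 (\<lambda>i. c (b1 + 1 + i)) = 0" by simp_all
    then have "cf (form_of b1 c) i (b1 - i) = 0"
      "cf (form_of b2 (\<lambda>i. c (b1 + 1 + i))) (i - b1 - 1) (b2 - (i - b1 - 1)) = 0" by simp_all
    then show "c i = 0" using i deg(1) unfolding cf_form_of by (cases "i \<le> b1") auto
  qed
  moreover have "rel_prime_tuple d ?a"
    unfolding rel_prime_tuple_def
  proof (intro allI impI)
    fix g assume "\<forall>i\<le>d. g dvd ?a i"
    then have "g dvd ?a (b1 + 1)" "g dvd ?a b1" using deg(1) by auto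
    then show "is_unit g" unfolding S T by (rule common_divisor_of_powers)
  qed
  moreover have "split_rep n d (n + 1 - \<alpha>1) (n + 1 - \<alpha>2) ?a"
    using u v unfolding e1_def[symmetric] e2_def[symmetric] b1_def[symmetric]
    by (intro mk_tuple_split_rep) (auto simp: deg)
  ultimately show "?a \<in> P_mu_min_part n d (\<alpha>1, \<alpha>2)" unfolding P_mu_min_part_iff[OF A n] by blast
qed

lemma mk_tuple_form_fun:
  assumes "fun_ring A" "\<And>i. i \<le> d \<Longrightarrow> fun_ring.form_fun A (\<lambda>x. u x i)"
    "\<And>i. i \<le> d \<Longrightarrow> fun_ring.form_fun A (\<lambda>x. v x i)"
    "fun_ring.form_fun A h1" "fun_ring.form_fun A h2" "i \<le> d"
  shows "fun_ring.form_fun A (\<lambda>x. mk_tuple d (u x) (v x) (h1 x) (h2 x) i)"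
proof -
  interpret fun_ring A by fact
  have "(\<lambda>x. mk_tuple d (u x) (v x) (h1 x) (h2 x) i) = (\<lambda>x. u x i * h1 x + v x i * h2 x)"
    using assms(6) by (simp add: mk_tuple_def)
  then show ?thesis
    by (simp only:) (intro form_fun_add form_fun_mult assms(2-5) assms(6))
qed

lemma polynomial_function_form_fun:
  assumes "fun_ring A" "f \<in> polynomial_functions n d" "\<And>i. i \<le> d \<Longrightarrow> fun_ring.form_fun A (\<lambda>x. \<phi> x i)"
  shows "(\<lambda>x. f (\<phi> x)) \<in> A"
proof -
  interpret fun_ring A by fact
  show ?thesis by (intro polynomial_function_compose[OF assms(2)] form_funD assms(3))
qed

text \<open>Linear independence and coprimality are open conditions, so their validity at one
  parameter \<open>c\<close> spreads to all but finitely many. The point \<open>c\<close> may itself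
  belong to \<open>F\<close>: then the curve approaches a tuple of another stratum.\<close>

lemma curve_in_stratum:
  fixes \<gamma> :: "'k::field \<Rightarrow> nat \<Rightarrow> 'k poly poly"
  assumes A: "(\<alpha>1, \<alpha>2) \<in> two_part_partitions (d + 1)" and n: "n \<ge> d + 1"
    and \<gamma>: "\<And>i. i \<le> d \<Longrightarrow> fun_ring.form_fun (range poly) (\<lambda>t. \<gamma> t i)" "\<And>t. \<gamma> t \<in> form_tuples n d"
    and c: "lin_indep_tuple d (\<gamma> c)" "rel_prime_tuple d (\<gamma> c)"
    and F: "finite F" "\<And>t. t \<notin> F \<Longrightarrow> split_rep n d (n + 1 - \<alpha>1) (n + 1 - \<alpha>2) (\<gamma> t)"
  obtains F' where "finite F'" "\<And>t. t \<notin> F' \<Longrightarrow> \<gamma> t \<in> P_mu_min_part n d (\<alpha>1, \<alpha>2)"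
proof -
  obtain f where f: "f \<in> polynomial_functions n d" "f (\<gamma> c) \<noteq> 0"
    "\<And>a. f a \<noteq> 0 \<Longrightarrow> a \<in> form_tuples n d \<Longrightarrow> lin_indep_tuple d a \<and> rel_prime_tuple d a"
    by (rule generic_tuple_open[OF \<gamma>(2) c]) (use n in auto)
  have "(\<lambda>t. f (\<gamma> t)) \<in> range poly" by (rule polynomial_function_form_fun[OF fun_ring_poly f(1) \<gamma>(1)])
  from poly_fun_cofinite_nonzero[OF this f(2)] have "finite {t. f (\<gamma> t) = 0}" .
  then show thesis
    using F f(3) \<gamma>(2) by (intro that[of "F \<union> {t. f (\<gamma> t) = 0}"]) (auto simp: P_mu_min_part_iff[OF A n])
qed

text \<open>Two tuples are joined by the segment between their data \<open>(u, v, h1, h2)\<close>,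
  which stays in the stratum outside a finite set. Two functions nonzero at the respective ends are
  simultaneously nonzero at some point of it.\<close>

lemma irreducible_P_mu_min_part:
  assumes inf: "infinite (UNIV :: 'k::field set)"
    and A: "(\<alpha>1, \<alpha>2) \<in> two_part_partitions (d + 1)" and n: "n \<ge> d + 1"
  shows "irreducible_space (subtopology (zariski n d) (P_mu_min_part n d (\<alpha>1, \<alpha>2) :: (nat \<Rightarrow> 'k poly poly) set))"
proof -
  let ?P = "P_mu_min_part n d (\<alpha>1, \<alpha>2) :: (nat \<Rightarrow> 'k poly poly) set"
  let ?e1 = "n + 1 - \<alpha>1" and ?e2 = "n + 1 - \<alpha>2"
  have sub: "?P \<subseteq> form_tuples n d" using P_mu_min_part_imp_split_rep(1) by blast
  interpret fun_ring "range (poly :: 'k poly \<Rightarrow> 'k \<Rightarrow> 'k)" by (rule fun_ring_poly)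
  show ?thesis
    unfolding irreducible_space_zariski_iff[OF sub]
  proof (intro conjI ballI impI)
    show "?P \<noteq> {}" using base_tuple(1)[OF A n] by blast
    fix f g :: "(nat \<Rightarrow> 'k poly poly) \<Rightarrow> 'k"
    assume f: "f \<in> polynomial_functions n d" and g: "g \<in> polynomial_functions n d"
      and fg: "\<forall>a\<in>?P. f a * g a = 0"
    show "(\<forall>a\<in>?P. f a = 0) \<or> (\<forall>a\<in>?P. g a = 0)"
    proof (rule ccontr)
      assume "\<not> ?thesis"
      then obtain a a' where a: "a \<in> ?P" "f a \<noteq> 0" and a': "a' \<in> ?P" "g a' \<noteq> 0" by blast
      note aP = P_mu_min_part_imp_split_rep[OF a(1)] and a'P = P_mu_min_part_imp_split_rep[OF a'(1)]
      obtain h1 h2 u v where h: "h1 \<in> forms ?e1" "h2 \<in> forms ?e2"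
        and uv: "\<And>i. i \<le> d \<Longrightarrow> u i \<in> forms (n - ?e1)" "\<And>i. i \<le> d \<Longrightarrow> v i \<in> forms (n - ?e2)"
        and eq: "a = mk_tuple d u v h1 h2"
        using split_rep_eq_mk_tuple[OF aP(4,1)] by blast
      obtain h1' h2' u' v' where h': "h1' \<in> forms ?e1" "h2' \<in> forms ?e2"
        and uv': "\<And>i. i \<le> d \<Longrightarrow> u' i \<in> forms (n - ?e1)" "\<And>i. i \<le> d \<Longrightarrow> v' i \<in> forms (n - ?e2)"
        and eq': "a' = mk_tuple d u' v' h1' h2'"
        using split_rep_eq_mk_tuple[OF a'P(4,1)] by blast
      define L :: "'k poly poly \<Rightarrow> 'k poly poly \<Rightarrow> 'k \<Rightarrow> 'k poly poly" where "L = (\<lambda>p q t. p + smult [:t:] (q - p))"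
      have Lf: "L p q t \<in> forms m" if "p \<in> forms m" "q \<in> forms m" for p q t m
        using that by (auto simp: L_def)
      have LA: "form_fun (L p q)" for p q
        unfolding L_def by (intro form_fun_add form_fun_const form_fun_smult) simp
      have L01: "L p q 0 = p" "L p q 1 = q" for p q by (simp_all add: L_def flip: one_pCons)
      define \<gamma> where "\<gamma> = (\<lambda>t. mk_tuple d (\<lambda>i. L (u i) (u' i) t) (\<lambda>i. L (v i) (v' i) t) (L h1 h1' t) (L h2 h2' t))"
      have \<gamma>01: "\<gamma> 0 = a" "\<gamma> 1 = a'" by (simp_all add: \<gamma>_def L01 eq eq')
      have e: "?e1 \<le> n" "?e2 \<le> n" using A by (auto simp: two_part_partitions_def)
      have \<gamma>A: "form_fun (\<lambda>t. \<gamma> t i)" if "i \<le> d" for i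
        unfolding \<gamma>_def using that LA by (intro mk_tuple_form_fun fun_ring_poly) simp_all
      have \<gamma>f: "\<gamma> t \<in> form_tuples n d" for t
        unfolding \<gamma>_def using e h h' uv uv' by (intro mk_tuple_in_form_tuples[of ?e1 n ?e2] Lf) auto
      have "split_rep n d ?e1 ?e2 (\<gamma> t)" for t
        unfolding \<gamma>_def using e h h' uv uv' by (intro mk_tuple_split_rep Lf) auto
      then obtain F where F: "finite F" "\<And>t. t \<notin> F \<Longrightarrow> \<gamma> t \<in> ?P"
        using curve_in_stratum[OF A n \<gamma>A \<gamma>f _ _ finite.emptyI, of 0] aP(2,3) unfolding \<gamma>01 by blast
      have "finite {t. f (\<gamma> t) = 0}"
        using polynomial_function_form_fun[OF fun_ring_poly f \<gamma>A] a(2) \<gamma>01(1)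
        by (intro poly_fun_cofinite_nonzero[of _ 0]) auto
      moreover have "finite {t. g (\<gamma> t) = 0}"
        using polynomial_function_form_fun[OF fun_ring_poly g \<gamma>A] a'(2) \<gamma>01(2)
        by (intro poly_fun_cofinite_nonzero[of _ 1]) auto
      ultimately have "finite (F \<union> {t. f (\<gamma> t) = 0} \<union> {t. g (\<gamma> t) = 0})" using F(1) by simp
      then obtain t where "t \<notin> F \<union> {t. f (\<gamma> t) = 0} \<union> {t. g (\<gamma> t) = 0}"
        using inf by (meson ex_new_if_finite)
      then show False using fg F(2)[of t] by auto
    qed
  qed
qed

section \<open>Strata in the closure: degeneration of the pair of forms\<close>

text \<open>For \<open>\<epsilon> \<noteq> 0\<close> the forms \<open>S^a h2 + \<epsilon> y\<close> and \<open>T^b h2 - \<epsilon> x\<close>, where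
  \<open>h1 = S^a x + T^b y\<close>, generate an ideal that contains \<open>h1\<close>; at \<open>\<epsilon> = 0\<close> they degenerate to multiples
  of \<open>h2\<close>.\<close>

lemma stratum_in_closure:
  fixes a :: "nat \<Rightarrow> 'k::field poly poly"
  assumes inf: "infinite (UNIV :: 'k set)"
    and A: "(\<alpha>1, \<alpha>2) \<in> two_part_partitions (d + 1)" and A': "(\<alpha>1', \<alpha>2') \<in> two_part_partitions (d + 1)"
    and n: "n \<ge> d + 1" and le: "\<alpha>1' \<le> \<alpha>1"
    and a: "a \<in> P_mu_min_part n d (\<alpha>1', \<alpha>2')"
    and f: "f \<in> polynomial_functions n d" "\<forall>b\<in>P_mu_min_part n d (\<alpha>1, \<alpha>2). f b = 0"
  shows "f a = 0"
proof (cases "\<alpha>1' = \<alpha>1")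
  case True
  then have "\<alpha>2' = \<alpha>2" using A A' by (simp add: two_part_partitions_def)
  with True a f(2) show ?thesis by blast
next
  case False
  interpret fun_ring "range (poly :: 'k poly \<Rightarrow> 'k \<Rightarrow> 'k)" by (rule fun_ring_poly)
  define e1 e2 e1' e2' where "e1 = n + 1 - \<alpha>1" and "e2 = n + 1 - \<alpha>2"
    and "e1' = n + 1 - \<alpha>1'" and "e2' = n + 1 - \<alpha>2'"
  \<comment> \<open>The exponents that raise \<open>h2\<close> to the degrees \<open>e1\<close> and
    \<open>e2\<close>. Both partitions have the same sum, so \<open>p + q = e1' - e2'\<close>, small
    enough to decompose \<open>h1\<close> as well as every \<open>v i\<close>.\<close>
  define p q where "p = e1 - e2'" and "q = e2 - e2'"
  have deg: "e1 \<le> n" "e2 \<le> n" "e1' \<le> n" "e2' \<le> n" "p + q \<le> e1' + 1" "p + q \<le> (n - e2') + 1"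
    "e1' - p = e2" "e1' - q = e1" "n - e2' - p = n - e1" "n - e2' - q = n - e2"
    "e1 = e2' + p" "e2 = e2' + q" "n - e1 = n - e1' + q" "n - e2 = n - e1' + p" "e1' = e1 + q" "e1' = e2 + p"
    using A A' n le False unfolding p_def q_def e1_def e2_def e1'_def e2'_def two_part_partitions_def by auto
  note aP = P_mu_min_part_imp_split_rep[OF a]
  obtain h1 h2 u v where h: "h1 \<in> forms e1'" "h2 \<in> forms e2'"
    and uv: "\<And>i. i \<le> d \<Longrightarrow> u i \<in> forms (n - e1')" "\<And>i. i \<le> d \<Longrightarrow> v i \<in> forms (n - e2')"
    and eq: "a = mk_tuple d u v h1 h2"
    using split_rep_eq_mk_tuple[OF aP(4,1)] unfolding e1'_def e2'_def by blast
  obtain x y where xy: "x \<in> forms e2" "y \<in> forms e1" "h1 = varS ^ p * x + varT ^ q * y"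
    using forms_decompose[OF h(1) deg(5)] unfolding deg(7,8) by blast
  have "\<exists>v' v''. v' \<in> forms (n - e1) \<and> v'' \<in> forms (n - e2) \<and> v i = varS ^ p * v' + varT ^ q * v''" if "i \<le> d" for i
    using forms_decompose[OF uv(2)[OF that] deg(6)] unfolding deg(9,10) by blast
  then obtain v' v'' where v': "\<And>i. i \<le> d \<Longrightarrow> v' i \<in> forms (n - e1)" and v'': "\<And>i. i \<le> d \<Longrightarrow> v'' i \<in> forms (n - e2)"
    and v: "\<And>i. i \<le> d \<Longrightarrow> v i = varS ^ p * v' i + varT ^ q * v'' i" by metis
  \<comment> \<open>In \<open>v i * h2\<close>, split as
    \<open>varS ^ p * v' i * h2 + varT ^ q * v'' i * h2\<close>, the multiples of \<open>h2\<close>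
    are replaced by the deformed forms, while \<open>u i * h1\<close> is left alone. The result is
    polynomial in \<open>t\<close>, although its split representation contains
    \<open>1 / t\<close>.\<close>
  define \<gamma> where "\<gamma> = (\<lambda>t i. if i \<le> d then a i + smult [:t:] (v' i * y - v'' i * x) else undefined)"
  have \<gamma>A: "form_fun (\<lambda>t. \<gamma> t i)" if "i \<le> d" for i
  proof -
    have "(\<lambda>t. \<gamma> t i) = (\<lambda>t. a i + smult [:t:] (v' i * y - v'' i * x))" using that by (simp add: \<gamma>_def)
    then show ?thesis by (simp only:) (intro form_fun_add form_fun_smult form_fun_const id_in_range_poly)
  qed
  have \<gamma>0: "\<gamma> 0 = a" by (auto simp: \<gamma>_def eq mk_tuple_def)
  have \<gamma>f: "\<gamma> t \<in> form_tuples n d" for t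
  proof -
    have "a i + smult [:t:] (v' i * y - v'' i * x) \<in> forms n" if i: "i \<le> d" for i
    proof (intro add_in_forms smult_in_forms diff_in_forms)
      show "a i \<in> forms n" using aP(1) i by (auto simp: form_tuples_def)
      show "v' i * y \<in> forms n" by (rule mult_in_forms'[OF v'[OF i] xy(2)]) (use deg(1) in simp)
      show "v'' i * x \<in> forms n" by (rule mult_in_forms'[OF v''[OF i] xy(1)]) (use deg(2) in simp)
    qed
    then show ?thesis by (auto simp: \<gamma>_def form_tuples_def split: if_splits)
  qed
  have split: "split_rep n d e1 e2 (\<gamma> t)" if t: "t \<notin> {0}" for t
    unfolding split_rep_def
  proof (intro exI conjI allI impI)
    show "varS ^ p * h2 + smult [:t:] y \<in> forms e1"
      by (intro add_in_forms smult_in_forms xy mult_in_forms'[OF varS_power_in_forms h(2)]) (use deg(11) in simp)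
    show "varT ^ q * h2 - smult [:t:] x \<in> forms e2"
      by (intro diff_in_forms smult_in_forms xy mult_in_forms'[OF varT_power_in_forms h(2)]) (use deg(12) in simp)
    fix i assume i: "i \<le> d"
    \<comment> \<open>\<open>varT ^ q\<close> times the first deformed form minus
      \<open>varS ^ p\<close> times the second is the scalar \<open>t\<close> times
      \<open>h1\<close>; dividing by \<open>t\<close> recovers \<open>u i * h1\<close>.\<close>
    show "smult [:1 / t:] (varT ^ q * u i) + v' i \<in> forms (n - e1)"
      by (intro add_in_forms smult_in_forms v' i mult_in_forms'[OF varT_power_in_forms uv(1)[OF i]]) (use deg(13) in simp)
    show "v'' i - smult [:1 / t:] (varS ^ p * u i) \<in> forms (n - e2)"
      by (intro diff_in_forms smult_in_forms v'' i mult_in_forms'[OF varS_power_in_forms uv(1)[OF i]]) (use deg(14) in simp)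
    have c: "[:[:1 / t:]:] * [:[:t:]:] = (1 :: 'k poly poly)" using t by (simp add: pCons_one)
    have s: "smult [:c:] z = [:[:c:]:] * z" for c and z :: "'k poly poly" by simp
    let ?t = "[:[:t:]:] :: 'k poly poly" and ?s = "[:[:1 / t:]:] :: 'k poly poly"
    have "(?s * (varT ^ q * u i) + v' i) * (varS ^ p * h2 + ?t * y) +
        (v'' i - ?s * (varS ^ p * u i)) * (varT ^ q * h2 - ?t * x) =
      (?s * ?t) * u i * (varS ^ p * x + varT ^ q * y) + (varS ^ p * v' i + varT ^ q * v'' i) * h2 + ?t * (v' i * y - v'' i * x)"
      by (simp only: algebra_simps)
    also have "\<dots> = u i * h1 + v i * h2 + ?t * (v' i * y - v'' i * x)"
      unfolding c xy(3) v[OF i] by (simp only: mult_1)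
    finally show "\<gamma> t i = (smult [:1 / t:] (varT ^ q * u i) + v' i) * (varS ^ p * h2 + smult [:t:] y) +
       (v'' i - smult [:1 / t:] (varS ^ p * u i)) * (varT ^ q * h2 - smult [:t:] x)"
      unfolding s using i by (simp only: \<gamma>_def eq mk_tuple_def if_True s)
  qed
  obtain F where F: "finite F" "\<And>t. t \<notin> F \<Longrightarrow> \<gamma> t \<in> P_mu_min_part n d (\<alpha>1, \<alpha>2)"
  proof (rule curve_in_stratum[OF A n \<gamma>A \<gamma>f, of 0 "{0}"])
    show "lin_indep_tuple d (\<gamma> 0)" "rel_prime_tuple d (\<gamma> 0)" unfolding \<gamma>0 using aP by simp_all
    show "split_rep n d (n + 1 - \<alpha>1) (n + 1 - \<alpha>2) (\<gamma> t)" if "t \<notin> {0}" for t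
      using split[OF that] unfolding e1_def e2_def .
  qed (use that in auto)
  have "(\<lambda>t. f (\<gamma> t)) 0 = 0"
    by (rule poly_fun_eq_0[OF polynomial_function_form_fun[OF fun_ring_poly f(1) \<gamma>A] inf F(1)])
      (use F(2) f(2) in auto)
  then show ?thesis by (simp add: \<gamma>0)
qed

section \<open>Strata outside the closure: the colon system\<close>

text \<open>The unknowns of the linear system \<open>S^(b-q) T^q h = \<Sum> y (q, l) \<Phi> l\<close>, \<open>q \<le> b\<close>: the coefficients of the form
  \<open>h\<close> of degree \<open>e\<close> (left summand) and the \<open>y (q, l)\<close> (right summand).\<close>

definition colon_system :: "nat \<Rightarrow> nat \<Rightarrow> ('x \<Rightarrow> nat \<Rightarrow> 'k::field poly poly) \<Rightarrow> nat + nat \<times> nat \<Rightarrow> 'x \<Rightarrow> nat \<Rightarrow> 'k poly poly" where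
  "colon_system b e \<Phi> i x q = (case i of
     Inl k \<Rightarrow> varS ^ (b - q) * varT ^ q * (varS ^ (e - k) * varT ^ k)
   | Inr pl \<Rightarrow> if fst pl = q then - \<Phi> x (snd pl) else 0)"

lemma colon_system_sum:
  assumes "q \<le> b" "finite K"
  shows "(\<Sum>i\<in>K <+> ({..b} \<times> {..d}). smult [:y i:] (colon_system b e \<Phi> i x q)) =
    varS ^ (b - q) * varT ^ q * (\<Sum>k\<in>K. smult [:y (Inl k):] (varS ^ (e - k) * varT ^ k)) -
    (\<Sum>l\<le>d. smult [:y (Inr (q, l)):] (\<Phi> x l))"
proof -
  have "(\<Sum>i\<in>K <+> ({..b} \<times> {..d}). smult [:y i:] (colon_system b e \<Phi> i x q)) =
    (\<Sum>k\<in>K. smult [:y (Inl k):] (colon_system b e \<Phi> (Inl k) x q)) +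
    (\<Sum>pl\<in>{..b} \<times> {..d}. smult [:y (Inr pl):] (colon_system b e \<Phi> (Inr pl) x q))"
    using assms(2) by (subst sum.Plus) auto
  also have "(\<Sum>k\<in>K. smult [:y (Inl k):] (colon_system b e \<Phi> (Inl k) x q)) =
     varS ^ (b - q) * varT ^ q * (\<Sum>k\<in>K. smult [:y (Inl k):] (varS ^ (e - k) * varT ^ k))"
    by (simp add: colon_system_def sum_distrib_left)
  also have "(\<Sum>pl\<in>{..b} \<times> {..d}. smult [:y (Inr pl):] (colon_system b e \<Phi> (Inr pl) x q)) =
     (\<Sum>p\<le>b. \<Sum>l\<le>d. smult [:y (Inr (p, l)):] (colon_system b e \<Phi> (Inr (p, l)) x q))"
    by (simp add: sum.cartesian_product case_prod_unfold)
  also have "\<dots> = (\<Sum>p\<le>b. if p = q then - (\<Sum>l\<le>d. smult [:y (Inr (q, l)):] (\<Phi> x l)) else 0)"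
    unfolding sum_negf[symmetric] by (intro sum.cong) (auto simp: colon_system_def)
  also have "\<dots> = - (\<Sum>l\<le>d. smult [:y (Inr (q, l)):] (\<Phi> x l))" using assms(1) by simp
  finally show ?thesis by simp
qed

lemma colon_system_in_forms:
  assumes "i \<in> K <+> ({..b} \<times> {..d})" "q \<le> b" "K \<subseteq> {..e}" "b + e = n" "\<Phi> x \<in> form_tuples n d"
  shows "colon_system b e \<Phi> i x q \<in> forms n"
proof (cases i)
  case (Inl k)
  then have "k \<le> e" using assms by auto
  then show ?thesis using assms Inl unfolding colon_system_def
    by (auto intro!: mult_in_forms'[of _ b _ e] monomial_in_forms)
next
  case (Inr pl)
  then show ?thesis using assms by (auto simp: colon_system_def form_tuples_def)
qed

lemma (in fun_ring) colon_system_coeffs: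
  assumes "i \<in> K <+> ({..b} \<times> {..d})" "c \<le> n"
    and "\<And>l c. l \<le> d \<Longrightarrow> c \<le> n \<Longrightarrow> (\<lambda>x. cf (\<Phi> x l) c (n - c)) \<in> A"
  shows "(\<lambda>x. cf (colon_system b e \<Phi> i x q) c (n - c)) \<in> A"
proof (cases i)
  case (Inr pl)
  then have l: "snd pl \<le> d" using assms(1) by auto
  have eq: "cf (colon_system b e \<Phi> i x q) c (n - c) = (if fst pl = q then - cf (\<Phi> x (snd pl)) c (n - c) else 0)" for x
    by (simp add: colon_system_def Inr)
  show ?thesis unfolding eq using assms(3)[OF l assms(2)] by (cases "fst pl = q") auto
qed (simp add: colon_system_def)

text \<open>\<open>K\<close> lists the exponents whose coefficients are unknown: all of them for
  separating strata, the free ones of the normal form for recovering parameters. Once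
  \<open>h\<close> vanishes, linear independence of the tuple disposes of the other
  unknowns.\<close>

lemma colon_system_injective:
  assumes "K \<subseteq> {..e}" and ind: "lin_indep_tuple d (\<Phi> x)"
    and h: "\<And>h. h \<in> forms e \<Longrightarrow> (\<And>k. k \<notin> K \<Longrightarrow> cf h k (e - k) = 0) \<Longrightarrow>
       (\<And>q. q \<le> b \<Longrightarrow> varS ^ (b - q) * varT ^ q * h \<in> tuple_span d (\<Phi> x)) \<Longrightarrow> h = 0"
    and y: "\<forall>q\<in>{..b}. (\<Sum>i\<in>K <+> ({..b} \<times> {..d}). smult [:y i:] (colon_system b e \<Phi> i x q)) = 0"
  shows "\<forall>i\<in>K <+> ({..b} \<times> {..d}). y i = 0"
proof -
  have K: "finite K" using assms(1) by (rule finite_subset) simp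
  define h where "h = (\<Sum>k\<in>K. smult [:y (Inl k):] (varS ^ (e - k) * varT ^ k))"
  have hf: "h \<in> forms e" unfolding h_def using assms(1) by (intro sum_in_forms smult_in_forms monomial_in_forms) auto
  have hc: "cf h k (e - k) = (if k \<in> K then y (Inl k) else 0)" for k
  proof -
    have "cf h k (e - k) = (\<Sum>j\<in>K. if j = k then y (Inl k) else 0)"
      unfolding h_def cf_sum by (intro sum.cong) (auto simp: cf_monomial)
    then show ?thesis using K by simp
  qed
  have eq: "varS ^ (b - q) * varT ^ q * h = (\<Sum>l\<le>d. smult [:y (Inr (q, l)):] (\<Phi> x l))" if "q \<le> b" for q
    using bspec[OF y, of q] that unfolding colon_system_sum[OF that K] h_def[symmetric] by simp
  have h0: "h = 0"
  proof (rule h[OF hf])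
    show "cf h k (e - k) = 0" if "k \<notin> K" for k using hc that by simp
    show "varS ^ (b - q) * varT ^ q * h \<in> tuple_span d (\<Phi> x)" if "q \<le> b" for q
      unfolding eq[OF that] tuple_span_def by (rule rangeI)
  qed
  have "y (Inl k) = 0" if "k \<in> K" for k using hc[of k] that h0 by simp
  moreover have "y (Inr (q, l)) = 0" if "q \<le> b" "l \<le> d" for q l
  proof -
    have "(\<Sum>l\<le>d. smult [:y (Inr (q, l)):] (\<Phi> x l)) = 0" using eq[OF that(1)] h0 by simp
    from ind[unfolded lin_indep_tuple_def, rule_format, of "\<lambda>l. y (Inr (q, l))", OF this that(2)] show ?thesis .
  qed
  ultimately show ?thesis by auto
qed

text \<open>By descent, a form of degree \<open>e\<close> all of whose multiples of degree
  \<open>n\<close> lie in the span of \<open>a\<close> belongs to the degree \<open>e\<close> part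
  of the ideal of \<open>h1\<close> and \<open>h2\<close>. That part is zero because
  \<open>e\<close> is below both degrees.\<close>

lemma strata_separated:
  fixes a :: "nat \<Rightarrow> 'k::field poly poly"
  assumes A: "(\<alpha>1, \<alpha>2) \<in> two_part_partitions (d + 1)" and A': "(\<alpha>1', \<alpha>2') \<in> two_part_partitions (d + 1)"
    and n: "n \<ge> d + 1" and less: "\<alpha>1 < \<alpha>1'"
    and a: "a \<in> P_mu_min_part n d (\<alpha>1', \<alpha>2')"
  obtains f where "f \<in> polynomial_functions n d" "f a \<noteq> 0" "\<forall>b\<in>P_mu_min_part n d (\<alpha>1, \<alpha>2). f b = 0"
proof -
  interpret fun_ring "polynomial_functions n d :: ((nat \<Rightarrow> 'k poly poly) \<Rightarrow> 'k) set"
    by (rule fun_ring_polynomial_functions)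
  define e b where "e = n + 1 - \<alpha>2" and "b = \<alpha>2 - 1"
  have be: "b + e = n" "b = n - e" "e \<le> n" using A n by (auto simp: two_part_partitions_def e_def b_def)
  obtain h1 h2 u v where s: "split_tuple n d (n + 1 - \<alpha>1') (n + 1 - \<alpha>2') a h1 h2 u v"
    using split_tuple_if[OF A' n P_mu_min_part_imp_split_rep[OF a]] by blast
  interpret s: split_tuple n d "n + 1 - \<alpha>1'" "n + 1 - \<alpha>2'" a h1 h2 u v by (rule s)
  have lt: "e < n + 1 - \<alpha>2'" "e < n + 1 - \<alpha>1'"
    using A A' less n by (auto simp: two_part_partitions_def e_def)
  let ?I = "{..e} <+> ({..b} \<times> {..d})"
  let ?\<Phi> = "\<lambda>x :: nat \<Rightarrow> 'k poly poly. x"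
  show thesis
  proof (rule form_system_injective_near[of ?I "{..b}" "colon_system b e ?\<Phi>" a "\<lambda>_. n"], goal_cases)
    case (3 i q)
    then show ?case using colon_system_in_forms[of i "{..e}" b d q e n ?\<Phi> a] be s.a by auto
  next
    case (4 i q c)
    then show ?case by (intro colon_system_coeffs[of i "{..e}" b d]) (auto intro: polynomial_functions.coord)
  next
    case (5 y)
    show ?case
    proof (rule colon_system_injective[OF order_refl _ _ 5])
      show "lin_indep_tuple d a" by (rule s.ind)
      fix h assume h: "h \<in> forms e"
        and V: "\<And>q. q \<le> b \<Longrightarrow> varS ^ (b - q) * varT ^ q * h \<in> tuple_span d a"
      have "h \<in> gen2 h1 h2 e"
      proof (rule gen2_descend_many[OF s.coprime s.nonzero s.h _ h])
        show "e + b + 1 < n + 1 - \<alpha>1' + (n + 1 - \<alpha>2')" using s.degrees n be by simp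
        fix p q assume "p + q = b"
        then have "p = b - q" "q \<le> b" by auto
        then show "varS ^ p * varT ^ q * h \<in> gen2 h1 h2 (e + b)"
          using V[of q] be unfolding s.tuple_span by (simp add: add.commute)
      qed
      then obtain x y where xy: "h = x * h1 + y * h2" "x * h1 \<in> forms e" "y * h2 \<in> forms e" by (auto simp: gen2_def)
      have "x = 0" using factor_in_forms[OF xy(2) s.h(1) s.nonzero(1)] lt by auto
      moreover have "y = 0" using factor_in_forms[OF xy(3) s.h(2) s.nonzero(2)] lt by auto
      ultimately show "h = 0" using xy(1) by simp
    qed
  next
    case (6 f)
    show ?case
    proof (rule that[OF 6(1,2)], intro ballI)
      fix a' :: "nat \<Rightarrow> 'k poly poly" assume a': "a' \<in> P_mu_min_part n d (\<alpha>1, \<alpha>2)"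
      obtain g1 g2 u' v' where s': "split_tuple n d (n + 1 - \<alpha>1) (n + 1 - \<alpha>2) a' g1 g2 u' v'"
        using split_tuple_if[OF A n P_mu_min_part_imp_split_rep[OF a']] by blast
      interpret s': split_tuple n d "n + 1 - \<alpha>1" e a' g1 g2 u' v' using s' unfolding e_def .
      \<comment> \<open>On the stratum to be annihilated, \<open>g2\<close> is such a form and gives
        a nontrivial solution.\<close>
      have "varS ^ (b - q) * varT ^ q * g2 \<in> tuple_span d a'" if "q \<le> b" for q
      proof -
        have "varS ^ (b - q) * varT ^ q \<in> forms b" using that by (intro monomial_in_forms) auto
        then show ?thesis unfolding s'.tuple_span s'.gen2 s'.b2_def be(2)[symmetric]
          by (intro CollectI exI[of _ 0] exI[of _ "varS ^ (b - q) * varT ^ q"]) simp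
      qed
      then have "\<forall>q\<in>{..b}. \<exists>c. varS ^ (b - q) * varT ^ q * g2 = (\<Sum>l\<le>d. smult [:c l:] (a' l))"
        unfolding tuple_span_def by auto
      from bchoice[OF this] obtain c where
        c: "\<forall>q\<in>{..b}. varS ^ (b - q) * varT ^ q * g2 = (\<Sum>l\<le>d. smult [:c q l:] (a' l))" by (elim exE)
      define y where "y = (\<lambda>i. case i of Inl k \<Rightarrow> cf g2 k (e - k) | Inr ql \<Rightarrow> c (fst ql) (snd ql))"
      have g2: "(\<Sum>k\<le>e. smult [:y (Inl k):] (varS ^ (e - k) * varT ^ k)) = g2"
        using form_of_cf[OF s'.h(2)] by (simp add: form_of_def y_def)
      have y: "\<forall>q\<in>{..b}. (\<Sum>i\<in>?I. smult [:y i:] (colon_system b e ?\<Phi> i a' q)) = 0"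
      proof
        fix q assume q: "q \<in> {..b}"
        then have "q \<le> b" by simp
        from c q show "(\<Sum>i\<in>?I. smult [:y i:] (colon_system b e ?\<Phi> i a' q)) = 0"
          unfolding colon_system_sum[OF \<open>q \<le> b\<close> finite_atMost] g2 by (simp add: y_def)
      qed
      show "f a' = 0"
      proof (rule ccontr)
        assume "f a' \<noteq> 0"
        from 6(3)[OF this y] have "y (Inl k) = 0" if "k \<le> e" for k using that by blast
        then have "g2 = 0" unfolding g2[symmetric] by (intro sum.neutral) auto
        with s'.nonzero(2) show False by simp
      qed
    qed
  qed simp_all
qed

section \<open>The closure of a stratum and openness in it\<close>

lemma closure_of_stratum:
  assumes inf: "infinite (UNIV :: 'k::field set)" and d: "d \<ge> 1"
    and A: "(\<alpha>1, \<alpha>2) \<in> two_part_partitions (d + 1)" and n: "n \<ge> d + 1"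
  shows "(zariski_mu_min n d :: (nat \<Rightarrow> 'k poly poly) topology) closure_of P_mu_min_part n d (\<alpha>1, \<alpha>2) =
    (\<Union>A'\<in>{A' \<in> two_part_partitions (d + 1). partition_le A' (\<alpha>1, \<alpha>2)}. P_mu_min_part n d A')"
    (is "?X closure_of ?PA = ?U")
proof -
  let ?P = "P_mu n d (mu_min n d) :: (nat \<Rightarrow> 'k poly poly) set"
  have P: "?P \<subseteq> form_tuples n d" and PA: "?PA \<subseteq> ?P" by (auto simp: P_mu_def P_mu_min_part_def)
  have cl: "?X closure_of ?PA = {a \<in> ?P. \<forall>f\<in>polynomial_functions n d. (\<forall>b\<in>?PA. f b = 0) \<longrightarrow> f a = 0}"
    unfolding zariski_mu_min_def by (rule closure_of_subtopology_zariski[OF P PA])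
  have le: "partition_le (\<alpha>1', \<alpha>2') (\<alpha>1, \<alpha>2) \<longleftrightarrow> \<alpha>1' \<le> \<alpha>1"
    if "(\<alpha>1', \<alpha>2') \<in> two_part_partitions (d + 1)" for \<alpha>1' \<alpha>2'
    using that A by (auto simp: partition_le_def two_part_partitions_def)
  show ?thesis
  proof (intro subset_antisym subsetI)
    fix a assume a: "a \<in> ?X closure_of ?PA"
    then have aP: "a \<in> ?P" unfolding cl by simp
    then obtain A' where A': "A' \<in> two_part_partitions (d + 1)" "a \<in> P_mu_min_part n d A'"
      unfolding P_mu_min_eq_Union[OF n d] by (elim UN_E)
    obtain \<alpha>1' \<alpha>2' where A'_eq: "A' = (\<alpha>1', \<alpha>2')" by (cases A')
    have "\<alpha>1' \<le> \<alpha>1"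
    proof (rule ccontr)
      assume "\<not> ?thesis"
      then have less: "\<alpha>1 < \<alpha>1'" by simp
      obtain f where "f \<in> polynomial_functions n d" "f a \<noteq> 0" "\<forall>b\<in>?PA. f b = 0"
        by (rule strata_separated[OF A A'(1)[unfolded A'_eq] n less A'(2)[unfolded A'_eq]])
      then show False using a unfolding cl by blast
    qed
    then have "partition_le A' (\<alpha>1, \<alpha>2)" using le A'(1) unfolding A'_eq by blast
    then show "a \<in> ?U" using A' by blast
  next
    fix a assume "a \<in> ?U"
    then obtain \<alpha>1' \<alpha>2' where A': "(\<alpha>1', \<alpha>2') \<in> two_part_partitions (d + 1)" "\<alpha>1' \<le> \<alpha>1" "a \<in> P_mu_min_part n d (\<alpha>1', \<alpha>2')"
      using le by force
    then have "a \<in> ?P" by (simp add: P_mu_min_part_def)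
    then show "a \<in> ?X closure_of ?PA" unfolding cl using stratum_in_closure[OF inf A A'(1) n A'(2,3)] by blast
  qed
qed

text \<open>The 2-part partitions of \<open>d + 1\<close> are totally ordered. What the closure adds
  to the stratum is therefore the closure of the next smaller stratum, or nothing if
  \<open>\<alpha>1 = 1\<close>.\<close>

lemma stratum_open_in_closure:
  assumes inf: "infinite (UNIV :: 'k::field set)" and d: "d \<ge> 1"
    and A: "(\<alpha>1, \<alpha>2) \<in> two_part_partitions (d + 1)" and n: "n \<ge> d + 1"
  shows "openin (subtopology (zariski_mu_min n d) (zariski_mu_min n d closure_of P_mu_min_part n d (\<alpha>1, \<alpha>2)))
    (P_mu_min_part n d (\<alpha>1, \<alpha>2) :: (nat \<Rightarrow> 'k poly poly) set)"
proof -
  let ?X = "zariski_mu_min n d :: (nat \<Rightarrow> 'k poly poly) topology"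
  let ?S = "\<lambda>A. P_mu_min_part n d A :: (nat \<Rightarrow> 'k poly poly) set"
  define Q where "Q = (if \<alpha>1 = 1 then {} else ?S (\<alpha>1 - 1, \<alpha>2 + 1))"
  have sub: "?S A' \<subseteq> topspace ?X" for A'
    unfolding zariski_mu_min_def topspace_subtopology topspace_zariski by (auto simp: P_mu_min_part_def P_mu_def)
  have clQ: "?X closure_of Q = (\<Union>A'\<in>{A' \<in> two_part_partitions (d + 1). fst A' < \<alpha>1}. ?S A')"
  proof (cases "\<alpha>1 = 1")
    case True
    then have empty: "{A' \<in> two_part_partitions (d + 1). fst A' < \<alpha>1} = {}"
      by (auto simp: two_part_partitions_def)
    show ?thesis unfolding empty by (simp add: Q_def True)
  next
    case False
    then have A1: "(\<alpha>1 - 1, \<alpha>2 + 1) \<in> two_part_partitions (d + 1)" using A by (auto simp: two_part_partitions_def)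
    have "{A' \<in> two_part_partitions (d + 1). partition_le A' (\<alpha>1 - 1, \<alpha>2 + 1)} =
        {A' \<in> two_part_partitions (d + 1). fst A' < \<alpha>1}"
      using A False by (auto simp: two_part_partitions_def partition_le_def)
    then show ?thesis using False closure_of_stratum[OF inf d A1 n] by (simp add: Q_def)
  qed
  have disj: "x \<notin> ?S (\<alpha>1, \<alpha>2)" if x: "x \<in> ?S A'" and A': "A' \<in> two_part_partitions (d + 1)" "fst A' < \<alpha>1" for x A'
  proof
    assume xA: "x \<in> ?S (\<alpha>1, \<alpha>2)"
    obtain \<alpha>1' \<alpha>2' where A'_eq: "A' = (\<alpha>1', \<alpha>2')" by (cases A')
    have less: "\<alpha>1' < \<alpha>1" using A'(2) by (simp add: A'_eq)
    obtain f :: "(nat \<Rightarrow> 'k poly poly) \<Rightarrow> 'k" where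
      "f x \<noteq> 0" "\<forall>b\<in>?S (\<alpha>1', \<alpha>2'). f b = 0"
      by (rule strata_separated[OF A'(1)[unfolded A'_eq] A n less xA])
    then show False using x unfolding A'_eq by simp
  qed
  have "?S (\<alpha>1, \<alpha>2) = (topspace ?X - ?X closure_of Q) \<inter> (?X closure_of ?S (\<alpha>1, \<alpha>2))"
  proof (intro subset_antisym subsetI IntI DiffI)
    fix x assume x: "x \<in> ?S (\<alpha>1, \<alpha>2)"
    then show "x \<in> topspace ?X" using sub by blast
    show "x \<notin> ?X closure_of Q" unfolding clQ
    proof
      assume "x \<in> (\<Union>A'\<in>{A' \<in> two_part_partitions (d + 1). fst A' < \<alpha>1}. ?S A')"
      then obtain A' where "A' \<in> two_part_partitions (d + 1)" "fst A' < \<alpha>1" "x \<in> ?S A'" by blast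
      with disj x show False by simp
    qed
    show "x \<in> ?X closure_of ?S (\<alpha>1, \<alpha>2)" using closure_of_subset[OF sub] x by blast
  next
    fix x assume x: "x \<in> (topspace ?X - ?X closure_of Q) \<inter> (?X closure_of ?S (\<alpha>1, \<alpha>2))"
    then obtain \<alpha>1' \<alpha>2' where A': "(\<alpha>1', \<alpha>2') \<in> two_part_partitions (d + 1)" "partition_le (\<alpha>1', \<alpha>2') (\<alpha>1, \<alpha>2)"
      "x \<in> ?S (\<alpha>1', \<alpha>2')" unfolding closure_of_stratum[OF inf d A n] by force
    have "\<not> \<alpha>1' < \<alpha>1" using x A'(1,3) unfolding clQ by force
    then have "\<alpha>1' = \<alpha>1" using A'(2) by (simp add: partition_le_def)
    moreover then have "\<alpha>2' = \<alpha>2" using A A'(1) by (simp add: two_part_partitions_def)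
    ultimately show "x \<in> ?S (\<alpha>1, \<alpha>2)" using A'(3) by simp
  qed
  moreover have "openin ?X (topspace ?X - ?X closure_of Q)" by (intro openin_diff) auto
  ultimately show ?thesis unfolding openin_subtopology by blast
qed

section \<open>Dimension of the strata\<close>

subsection \<open>Algebraically independent functions from chains\<close>

lemma sum_PiE_insert:
  fixes f :: "('i \<Rightarrow> 'b) \<Rightarrow> 'a::comm_monoid_add"
  assumes "x \<notin> S"
  shows "(\<Sum>e\<in>PiE (insert x S) (\<lambda>_. T). f e) = (\<Sum>k\<in>T. \<Sum>e\<in>PiE S (\<lambda>_. T). f (e(x := k)))"
proof -
  have "(\<Sum>e\<in>PiE (insert x S) (\<lambda>_. T). f e) = (\<Sum>p\<in>T \<times> PiE S (\<lambda>_. T). f ((snd p)(x := fst p)))"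
    unfolding PiE_insert_eq
    by (subst sum.reindex[OF inj_combinator[OF assms]]) (simp add: case_prod_unfold comp_def)
  then show ?thesis by (simp add: sum.cartesian_product case_prod_unfold)
qed

text \<open>Exponent vectors range over a box, the shape in which monomials are counted
  later.\<close>

definition alg_independent_on :: "'a set \<Rightarrow> (nat \<Rightarrow> 'a \<Rightarrow> 'k::field) \<Rightarrow> nat \<Rightarrow> bool" where
  "alg_independent_on Z F m \<longleftrightarrow> (\<forall>r c. (\<forall>z\<in>Z. (\<Sum>e\<in>PiE {..<m} (\<lambda>_. {..r}). c e * (\<Prod>l<m. F l z ^ e l)) = 0) \<longrightarrow>
     (\<forall>e\<in>PiE {..<m} (\<lambda>_. {..r}). c e = 0))"

text \<open>Each step of the chain contributes a function \<open>f\<close> that vanishes on the smaller set but not on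
  the larger one: in a relation, a power of \<open>f\<close> can be cancelled on the larger irreducible set, and
  the lowest coefficient is then a relation on the smaller set.\<close>

lemma alg_independent_chain:
  fixes Z :: "nat \<Rightarrow> 'a set" and R :: "('a \<Rightarrow> 'k::field) set"
  assumes R: "fun_ring R"
    and "\<And>i. i \<le> m \<Longrightarrow> Z i \<noteq> {}"
    and "\<And>i f g. i \<le> m \<Longrightarrow> f \<in> R \<Longrightarrow> g \<in> R \<Longrightarrow> (\<forall>z\<in>Z i. f z * g z = 0) \<Longrightarrow> (\<forall>z\<in>Z i. f z = 0) \<or> (\<forall>z\<in>Z i. g z = 0)"
    and "\<And>i. i < m \<Longrightarrow> Z i \<subseteq> Z (Suc i)"
    and "\<And>i. i < m \<Longrightarrow> \<exists>f\<in>R. (\<forall>z\<in>Z i. f z = 0) \<and> (\<exists>z\<in>Z (Suc i). f z \<noteq> 0)"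
  shows "\<exists>F. (\<forall>l<m. F l \<in> R) \<and> alg_independent_on (Z m) F m"
  using assms(2-)
proof (induction m)
  case 0
  have "Z 0 \<noteq> {}" using 0(1) by simp
  then have "alg_independent_on (Z 0) F 0" for F :: "nat \<Rightarrow> 'a \<Rightarrow> 'k"
    by (auto simp: alg_independent_on_def)
  then show ?case by auto
next
  case (Suc m)
  interpret fun_ring R by (rule R)
  have "\<exists>F. (\<forall>l<m. F l \<in> R) \<and> alg_independent_on (Z m) F m"
    by (rule Suc.IH) (use Suc.prems in auto)
  then obtain F where F: "\<forall>l<m. F l \<in> R" "alg_independent_on (Z m) F m" by blast
  obtain f z0 where f: "f \<in> R" "\<forall>z\<in>Z m. f z = 0" "z0 \<in> Z (Suc m)" "f z0 \<noteq> 0"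
    using Suc.prems(4)[of m] by blast
  let ?E = "\<lambda>r. PiE {..<m} (\<lambda>_. {..r})"
  define F' where "F' = F(m := f)"
  have "\<forall>l<Suc m. F' l \<in> R" using F(1) f(1) by (auto simp: F'_def less_Suc_eq)
  moreover have "alg_independent_on (Z (Suc m)) F' (Suc m)"
    unfolding alg_independent_on_def
  proof (intro allI impI ballI)
    fix r :: nat and c e
    assume rel: "\<forall>z\<in>Z (Suc m). (\<Sum>e\<in>PiE {..<Suc m} (\<lambda>_. {..r}). c e * (\<Prod>l<Suc m. F' l z ^ e l)) = 0"
      and e: "e \<in> PiE {..<Suc m} (\<lambda>_. {..r})"
    define P where "P = (\<lambda>k z. \<Sum>e\<in>?E r. c (e(m := k)) * (\<Prod>l<m. F l z ^ e l))"
    have PR: "P k \<in> R" for k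
      unfolding P_def by (intro sum mult const prod power) (use F(1) in auto)
    have expand: "(\<Sum>e\<in>PiE {..<Suc m} (\<lambda>_. {..r}). c e * (\<Prod>l<Suc m. F' l z ^ e l)) = (\<Sum>k\<le>r. P k z * f z ^ k)" for z
    proof -
      have "(\<Prod>l<m. F' l z ^ (e(m := k)) l) = (\<Prod>l<m. F l z ^ e l)" for e k
        by (intro prod.cong) (auto simp: F'_def)
      then have "c (e(m := k)) * (\<Prod>l<Suc m. F' l z ^ (e(m := k)) l) = c (e(m := k)) * (\<Prod>l<m. F l z ^ e l) * f z ^ k" for e k
        by (simp add: F'_def)
      moreover have "(\<Sum>e\<in>PiE {..<Suc m} (\<lambda>_. {..r}). G e) = (\<Sum>k\<le>r. \<Sum>e\<in>?E r. G (e(m := k)))"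
        for G :: "(nat \<Rightarrow> nat) \<Rightarrow> 'k"
        unfolding lessThan_Suc by (rule sum_PiE_insert) simp
      ultimately show ?thesis by (simp only: P_def sum_distrib_right)
    qed
    have zero: "\<forall>e\<in>?E r. c (e(m := k)) = 0" if "k \<le> r" for k
      using that
    proof (induction k rule: less_induct)
      case (less k)
      have P0: "P j z = 0" if "j < k" for j z
      proof -
        have j: "j \<le> r" using less.prems that by simp
        have "c (e(m := j)) = 0" if "e \<in> ?E r" for e by (rule bspec[OF less.IH[OF \<open>j < k\<close> j] that])
        then show ?thesis unfolding P_def by (intro sum.neutral ballI) (simp only: mult_zero_left)
      qed
      define Q where "Q = (\<lambda>z. \<Sum>j\<in>{k..r}. P j z * f z ^ (j - k))"
      have QR: "Q \<in> R" unfolding Q_def by (intro sum mult power PR f)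
      have "f z ^ k * Q z = 0" if z: "z \<in> Z (Suc m)" for z
      proof -
        have "0 = (\<Sum>j\<le>r. P j z * f z ^ j)" using bspec[OF rel z] unfolding expand by simp
        also have "\<dots> = (\<Sum>j\<in>{k..r}. P j z * f z ^ j)"
          using P0 less.prems by (intro sum.mono_neutral_right) (auto simp: not_le)
        also have "\<dots> = f z ^ k * Q z"
          unfolding Q_def sum_distrib_left
        proof (intro sum.cong refl)
          fix j assume "j \<in> {k..r}"
          then have "f z ^ j = f z ^ k * f z ^ (j - k)" by (simp flip: power_add)
          then show "P j z * f z ^ j = f z ^ k * (P j z * f z ^ (j - k))" by simp
        qed
        finally show ?thesis by simp
      qed
      then have "(\<forall>z\<in>Z (Suc m). f z ^ k = 0) \<or> (\<forall>z\<in>Z (Suc m). Q z = 0)"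
        using power[OF f(1)] QR by (intro Suc.prems(2)) auto
      then have Q0: "\<forall>z\<in>Z (Suc m). Q z = 0" using f(3,4) by auto
      have Pk: "P k z = 0" if z: "z \<in> Z m" for z
      proof -
        have "z \<in> Z (Suc m)" using Suc.prems(3)[of m] z by blast
        then have "0 = Q z" using Q0 by simp
        also have "\<dots> = (\<Sum>j\<in>{k..r}. if j = k then P k z else 0)"
          unfolding Q_def using f(2) z by (intro sum.cong) (auto simp: power_0_left)
        also have "\<dots> = P k z" using less.prems by simp
        finally show ?thesis by simp
      qed
      show ?case
        by (rule F(2)[unfolded alg_independent_on_def, THEN spec[of _ r],
            THEN spec[of _ "\<lambda>e. c (e(m := k))"], THEN mp]) (intro ballI Pk[unfolded P_def])
    qed
    \<comment> \<open>The value \<open>undefined\<close> at \<open>m\<close> makes the shortened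
      exponent vector extensional on the first \<open>m\<close> indices.\<close>
    have "e m \<le> r" "e(m := undefined) \<in> ?E r" using e by (auto simp: PiE_iff extensional_def)
    from zero[OF this(1), THEN bspec, OF this(2)] show "c e = 0" by simp
  qed
  ultimately show ?case by blast
qed

subsection \<open>Counting monomials\<close>

text \<open>Polynomial functions in the variables \<open>T\<close>, with each exponent, rather than
  the total degree, bounded by \<open>K\<close>: the number of monomials is then a plain
  power.\<close>

definition poly_box :: "'i set \<Rightarrow> nat \<Rightarrow> (('i \<Rightarrow> 'k::field) \<Rightarrow> 'k) set" where
  "poly_box T K = {f. \<exists>c. \<forall>x. f x = (\<Sum>e\<in>PiE T (\<lambda>_. {..K}). c e * (\<Prod>i\<in>T. x i ^ e i))}"

lemma poly_boxI: "(\<lambda>x. \<Sum>e\<in>PiE T (\<lambda>_. {..K}). c e * (\<Prod>i\<in>T. x i ^ e i)) \<in> poly_box T K"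
  by (auto simp: poly_box_def)

lemma poly_boxE:
  assumes "f \<in> poly_box T K"
  obtains c where "f = (\<lambda>x. \<Sum>e\<in>PiE T (\<lambda>_. {..K}). c e * (\<Prod>i\<in>T. x i ^ e i))"
  using assms by (auto simp: poly_box_def)

lemma poly_box_monomial:
  assumes "finite T" "\<And>i. i \<in> T \<Longrightarrow> e i \<le> K"
  shows "(\<lambda>x. c * (\<Prod>i\<in>T. x i ^ e i)) \<in> poly_box T K"
proof -
  define e' where "e' = restrict e T"
  have e': "e' \<in> PiE T (\<lambda>_. {..K})" using assms(2) by (auto simp: e'_def)
  have "(\<Prod>i\<in>T. x i ^ e i) = (\<Prod>i\<in>T. x i ^ e' i)" for x :: "'a \<Rightarrow> 'b" by (intro prod.cong) (auto simp: e'_def)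
  then have "c * (\<Prod>i\<in>T. x i ^ e i) = (\<Sum>g\<in>PiE T (\<lambda>_. {..K}). (if g = e' then c else 0) * (\<Prod>i\<in>T. x i ^ g i))" for x :: "'a \<Rightarrow> 'b"
    using e' finite_PiE[OF assms(1), of "\<lambda>_. {..K}"] by (simp add: if_distrib[of "\<lambda>z. z * _"] cong: if_cong)
  then have "(\<lambda>x. c * (\<Prod>i\<in>T. x i ^ e i)) = (\<lambda>x. \<Sum>g\<in>PiE T (\<lambda>_. {..K}). (if g = e' then c else 0) * (\<Prod>i\<in>T. x i ^ g i))"
    by (rule ext)
  then show ?thesis by (simp only: poly_boxI)
qed

lemma poly_box_add:
  assumes "f \<in> poly_box T K" "g \<in> poly_box T K"
  shows "(\<lambda>x. f x + g x) \<in> poly_box T K"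
proof -
  obtain c where c: "f = (\<lambda>x. \<Sum>e\<in>PiE T (\<lambda>_. {..K}). c e * (\<Prod>i\<in>T. x i ^ e i))" using assms(1) by (rule poly_boxE)
  obtain c' where c': "g = (\<lambda>x. \<Sum>e\<in>PiE T (\<lambda>_. {..K}). c' e * (\<Prod>i\<in>T. x i ^ e i))" using assms(2) by (rule poly_boxE)
  have "(\<lambda>x. f x + g x) = (\<lambda>x. \<Sum>e\<in>PiE T (\<lambda>_. {..K}). (c e + c' e) * (\<Prod>i\<in>T. x i ^ e i))"
    unfolding c c' by (simp add: distrib_right sum.distrib)
  then show ?thesis by (simp only: poly_boxI)
qed

lemma poly_box_const: "finite T \<Longrightarrow> (\<lambda>_. c) \<in> poly_box T K"
  using poly_box_monomial[of T "\<lambda>_. 0" K c] by simp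

lemma poly_box_sum:
  assumes "finite T" "\<And>i. i \<in> I \<Longrightarrow> f i \<in> poly_box T K"
  shows "(\<lambda>x. \<Sum>i\<in>I. f i x) \<in> poly_box T K"
  using assms(2)
  by (induction I rule: infinite_finite_induct) (auto intro: poly_box_add poly_box_const[OF assms(1)])

lemma poly_box_mono:
  assumes "finite T" "f \<in> poly_box T K" "K \<le> K'"
  shows "f \<in> poly_box T K'"
proof -
  obtain c where c: "f = (\<lambda>x. \<Sum>e\<in>PiE T (\<lambda>_. {..K}). c e * (\<Prod>i\<in>T. x i ^ e i))" using assms(2) by (rule poly_boxE)
  have "(\<lambda>x. \<Sum>e\<in>PiE T (\<lambda>_. {..K}). c e * (\<Prod>i\<in>T. x i ^ e i)) \<in> poly_box T K'"
    by (intro poly_box_sum poly_box_monomial assms(1)) (use assms(3) in \<open>fastforce simp: PiE_iff\<close>)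
  then show ?thesis unfolding c .
qed

lemma poly_box_mult:
  assumes "finite T" "f \<in> poly_box T K" "g \<in> poly_box T L"
  shows "(\<lambda>x. f x * g x) \<in> poly_box T (K + L)"
proof -
  obtain c where c: "f = (\<lambda>x. \<Sum>e\<in>PiE T (\<lambda>_. {..K}). c e * (\<Prod>i\<in>T. x i ^ e i))" using assms(2) by (rule poly_boxE)
  obtain c' where c': "g = (\<lambda>x. \<Sum>e\<in>PiE T (\<lambda>_. {..L}). c' e * (\<Prod>i\<in>T. x i ^ e i))" using assms(3) by (rule poly_boxE)
  have "f x * g x = (\<Sum>e\<in>PiE T (\<lambda>_. {..K}). \<Sum>e'\<in>PiE T (\<lambda>_. {..L}). (c e * c' e') * (\<Prod>i\<in>T. x i ^ (e i + e' i)))" for x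
    unfolding c c' sum_product by (intro sum.cong) (auto simp: power_add prod.distrib)
  moreover have "(\<lambda>x. \<Sum>e\<in>PiE T (\<lambda>_. {..K}). \<Sum>e'\<in>PiE T (\<lambda>_. {..L}). (c e * c' e') * (\<Prod>i\<in>T. x i ^ (e i + e' i))) \<in> poly_box T (K + L)"
    by (intro poly_box_sum poly_box_monomial assms(1)) (auto simp: PiE_iff intro: add_mono)
  ultimately show ?thesis by simp
qed

lemma poly_box_power:
  assumes "finite T" "f \<in> poly_box T K"
  shows "(\<lambda>x. f x ^ k) \<in> poly_box T (k * K)"
proof (induction k)
  case (Suc k)
  from poly_box_mult[OF assms(1,2) Suc] show ?case by simp
qed (simp add: poly_box_const[OF assms(1)])

lemma poly_box_prod:
  assumes "finite T" "\<And>l. l < m \<Longrightarrow> f l \<in> poly_box T K"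
  shows "(\<lambda>x. \<Prod>l<m. f l x) \<in> poly_box T (m * K)"
  using assms(2)
proof (induction m)
  case (Suc m)
  from poly_box_mult[OF assms(1) Suc.IH Suc.prems[of m]] Suc.prems show ?case by (simp add: add.commute)
qed (simp add: poly_box_const[OF assms(1)])

lemma fun_ring_poly_box:
  fixes T :: "'i set"
  assumes T: "finite T"
  shows "fun_ring (\<Union>K. poly_box T K :: (('i \<Rightarrow> 'k::field) \<Rightarrow> 'k) set)"
proof
  show "(\<lambda>_. c) \<in> (\<Union>K. poly_box T K)" for c using poly_box_const[OF T] by blast
  fix f g :: "('i \<Rightarrow> 'k) \<Rightarrow> 'k" assume "f \<in> (\<Union>K. poly_box T K)" "g \<in> (\<Union>K. poly_box T K)"
  then obtain K L where f: "f \<in> poly_box T K" and g: "g \<in> poly_box T L" by blast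
  have "f \<in> poly_box T (K + L)" "g \<in> poly_box T (K + L)"
    using poly_box_mono[OF T f, of "K + L"] poly_box_mono[OF T g, of "K + L"] by simp_all
  then show "(\<lambda>x. f x + g x) \<in> (\<Union>K. poly_box T K)" using poly_box_add by blast
  show "(\<lambda>x. f x * g x) \<in> (\<Union>K. poly_box T K)" using poly_box_mult[OF T f g] by blast
qed

lemma coord_in_poly_box:
  assumes "finite T" "i \<in> T"
  shows "(\<lambda>x. x i) \<in> (\<Union>K. poly_box T K)"
proof -
  have "(\<Prod>j\<in>T. x j ^ (if j = i then 1 else 0)) = (\<Prod>j\<in>T. if j = i then x j else 1)" for x :: "'a \<Rightarrow> 'b"
    by (intro prod.cong) auto
  then have "(\<Prod>j\<in>T. x j ^ (if j = i then 1 else 0)) = x i" for x :: "'a \<Rightarrow> 'b" using assms by simp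
  then have "(\<lambda>x. x i) = (\<lambda>x :: 'a \<Rightarrow> 'b. 1 * (\<Prod>j\<in>T. x j ^ (if j = i then 1 else 0)))" by simp
  also have "\<dots> \<in> poly_box T 1" by (rule poly_box_monomial[OF assms(1)]) simp
  finally show ?thesis by blast
qed

text \<open>There are \<open>(r + 1) ^ m\<close> monomials in \<open>m\<close> functions with exponents at most \<open>r\<close>, but they lie in a
  space of dimension \<open>O(r ^ card T)\<close>.\<close>

lemma poly_box_relation:
  fixes f :: "nat \<Rightarrow> ('i \<Rightarrow> 'k::field) \<Rightarrow> 'k"
  assumes T: "finite T" "card T < m" and f: "\<And>l. l < m \<Longrightarrow> f l \<in> (\<Union>K. poly_box T K)"
  obtains r c where "\<exists>e\<in>PiE {..<m} (\<lambda>_. {..r}). c e \<noteq> 0"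
    "\<And>x. (\<Sum>e\<in>PiE {..<m} (\<lambda>_. {..r::nat}). c e * (\<Prod>l<m. f l x ^ e l)) = 0"
proof -
  have "\<forall>l\<in>{..<m}. \<exists>K. f l \<in> poly_box T K"
  proof
    fix l assume "l \<in> {..<m}"
    then show "\<exists>K. f l \<in> poly_box T K" using f[of l] by simp
  qed
  from bchoice[OF this] obtain k where k: "\<forall>l\<in>{..<m}. f l \<in> poly_box T (k l)" by (elim exE)
  define K where "K = (\<Sum>l<m. k l)"
  have fK: "f l \<in> poly_box T K" if "l < m" for l
  proof (rule poly_box_mono[OF T(1)])
    show "f l \<in> poly_box T (k l)" using k that by blast
    show "k l \<le> K" unfolding K_def using that by (intro member_le_sum) auto
  qed
  \<comment> \<open>Chosen so that
    \<open>((m * K + 1) * (r + 1)) ^ card T = r * (r + 1) ^ card T\<close>, which bounds the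
    dimension and is less than \<open>(r + 1) ^ m\<close>.\<close>
  define r where "r = (m * K + 1) ^ card T"
  let ?I = "PiE {..<m} (\<lambda>_. {..r})" and ?R = "PiE T (\<lambda>_. {..m * (r * K)})"
  have "\<forall>e\<in>?I. \<exists>c. \<forall>x. (\<Prod>l<m. f l x ^ e l) = (\<Sum>g\<in>?R. c g * (\<Prod>i\<in>T. x i ^ g i))"
  proof
    fix e assume e: "e \<in> ?I"
    have "(\<lambda>x. f l x ^ e l) \<in> poly_box T (r * K)" if "l < m" for l
    proof (rule poly_box_mono[OF T(1) poly_box_power[OF T(1) fK[OF that]]])
      show "e l * K \<le> r * K" using e that by (intro mult_right_mono) (auto simp: PiE_iff)
    qed
    from poly_box_prod[OF T(1) this] show "\<exists>c. \<forall>x. (\<Prod>l<m. f l x ^ e l) = (\<Sum>g\<in>?R. c g * (\<Prod>i\<in>T. x i ^ g i))"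
      unfolding poly_box_def by simp
  qed
  from bchoice[OF this] obtain M where
    M: "\<forall>e\<in>?I. \<forall>x. (\<Prod>l<m. f l x ^ e l) = (\<Sum>g\<in>?R. M e g * (\<Prod>i\<in>T. x i ^ g i))" by (elim exE)
  have "card ?R = (m * (r * K) + 1) ^ card T" using T(1) by (simp add: card_PiE)
  also have "\<dots> \<le> ((m * K + 1) * (r + 1)) ^ card T"
    by (intro power_mono) (auto simp: algebra_simps)
  also have "\<dots> = r * (r + 1) ^ card T" by (simp only: power_mult_distrib r_def[symmetric])
  also have "\<dots> < (r + 1) ^ Suc (card T)" by simp
  also have "\<dots> \<le> (r + 1) ^ m" using T(2) by (intro power_increasing) auto
  also have "\<dots> = card ?I" by (simp add: card_PiE)
  finally have "card ?R < card ?I" .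
  from exists_nontrivial_solution[OF finite_PiE[OF T(1)] finite_PiE[OF finite_lessThan] this, of "\<lambda>g e. M e g"]
  obtain c where c: "\<exists>e\<in>?I. c e \<noteq> 0" "\<forall>g\<in>?R. (\<Sum>e\<in>?I. M e g * c e) = 0" by auto
  show thesis
  proof (rule that[OF c(1)])
    fix x
    have "(\<Sum>e\<in>?I. c e * (\<Prod>l<m. f l x ^ e l)) = (\<Sum>e\<in>?I. c e * (\<Sum>g\<in>?R. M e g * (\<Prod>i\<in>T. x i ^ g i)))"
      using M by (intro sum.cong) auto
    also have "\<dots> = (\<Sum>g\<in>?R. (\<Sum>e\<in>?I. M e g * c e) * (\<Prod>i\<in>T. x i ^ g i))"
      unfolding sum_distrib_left sum_distrib_right by (subst sum.swap) (simp add: mult_ac)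
    also have "\<dots> = 0" using c(2) by simp
    finally show "(\<Sum>e\<in>?I. c e * (\<Prod>l<m. f l x ^ e l)) = 0" .
  qed
qed

text \<open>A longer chain would give more independent functions than parameters. Their pullbacks
  along \<open>\<Phi>\<close> satisfy a relation, and density carries it back to the top member of
  the chain.\<close>

lemma chain_length_le:
  fixes \<Phi> :: "('i \<Rightarrow> 'k::field) \<Rightarrow> 'a" and Z :: "nat \<Rightarrow> 'a set"
  assumes R: "fun_ring R" and T: "finite T"
    and \<Phi>: "\<And>f. f \<in> R \<Longrightarrow> (\<lambda>x. f (\<Phi> x)) \<in> (\<Union>K. poly_box T K)"
    and dense: "\<And>f. f \<in> R \<Longrightarrow> (\<And>x. f (\<Phi> x) = 0) \<Longrightarrow> \<forall>z\<in>Z m. f z = 0"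
    and "\<And>i. i \<le> m \<Longrightarrow> Z i \<noteq> {}"
    and "\<And>i f g. i \<le> m \<Longrightarrow> f \<in> R \<Longrightarrow> g \<in> R \<Longrightarrow> (\<forall>z\<in>Z i. f z * g z = 0) \<Longrightarrow> (\<forall>z\<in>Z i. f z = 0) \<or> (\<forall>z\<in>Z i. g z = 0)"
    and "\<And>i. i < m \<Longrightarrow> Z i \<subseteq> Z (Suc i)"
    and "\<And>i. i < m \<Longrightarrow> \<exists>f\<in>R. (\<forall>z\<in>Z i. f z = 0) \<and> (\<exists>z\<in>Z (Suc i). f z \<noteq> 0)"
  shows "m \<le> card T"
proof (rule ccontr)
  interpret fun_ring R by (rule R)
  assume "\<not> m \<le> card T"
  then have m: "card T < m" by simp
  obtain F where F: "\<forall>l<m. F l \<in> R" "alg_independent_on (Z m) F m"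
    using alg_independent_chain[of R m Z, OF R assms(5-8)] by blast
  have "(\<lambda>x. F l (\<Phi> x)) \<in> (\<Union>K. poly_box T K)" if "l < m" for l using F(1) that \<Phi> by blast
  from poly_box_relation[of T m "\<lambda>l x. F l (\<Phi> x)", OF T m this] obtain r c where
    c: "\<exists>e\<in>PiE {..<m} (\<lambda>_. {..r}). c e \<noteq> 0"
      "\<And>x. (\<Sum>e\<in>PiE {..<m} (\<lambda>_. {..r::nat}). c e * (\<Prod>l<m. F l (\<Phi> x) ^ e l)) = 0" by blast
  have "(\<lambda>z. \<Sum>e\<in>PiE {..<m} (\<lambda>_. {..r}). c e * (\<Prod>l<m. F l z ^ e l)) \<in> R"
    by (intro sum mult const prod power) (use F(1) in auto)
  from dense[OF this c(2)] have "\<forall>e\<in>PiE {..<m} (\<lambda>_. {..r}). c e = 0"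
    using F(2) unfolding alg_independent_on_def by blast
  with c(1) show False by blast
qed

subsection \<open>A normal form\<close>

type_synonym param = "nat \<times> nat \<times> nat"

lemma mk_tuple_cong:
  "(\<And>i. i \<le> d \<Longrightarrow> u i * h1 + v i * h2 = u' i * h1' + v' i * h2') \<Longrightarrow> mk_tuple d u v h1 h2 = mk_tuple d u' v' h1' h2'"
  by (auto simp: mk_tuple_def)

lemma form_of_delta: "form_of m (\<lambda>k. if k = j then 1 else 0) = (if j \<le> m then varS ^ (m - j) * varT ^ j else 0)"
  by (rule poly_poly_eqI) (auto simp: cf_form_of cf_monomial)

text \<open>Division with remainder, ordered by powers of \<open>varT\<close>: the monomial
  \<open>varS ^ e2\<close> of \<open>h2\<close> has coefficient 1, so the coefficients of the
  quotient are determined one by one. For the largest \<open>K\<close> every monomial of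
  \<open>h1\<close> divisible by \<open>varS ^ e2\<close> is removed.\<close>

lemma form_division:
  assumes h: "h1 \<in> forms e1" "h2 \<in> forms e2" "e2 \<le> e1" "cf h2 0 e2 = 1" and "K \<le> e1 - e2 + 1"
  shows "\<exists>w\<in>forms (e1 - e2). \<forall>k<K. cf (h1 - w * h2) k (e1 - k) = 0"
  using assms(5)
proof (induction K)
  case 0
  show ?case by (intro bexI[of _ 0]) auto
next
  case (Suc K)
  then obtain w where w: "w \<in> forms (e1 - e2)" "\<And>k. k < K \<Longrightarrow> cf (h1 - w * h2) k (e1 - k) = 0" by auto
  define c where "c = cf (h1 - w * h2) K (e1 - K)"
  define w' where "w' = w + smult [:c:] (varS ^ (e1 - e2 - K) * varT ^ K)"
  have K: "K \<le> e1 - e2" using Suc.prems by simp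
  have "w' \<in> forms (e1 - e2)" unfolding w'_def using w(1) K by (intro add_in_forms smult_in_forms monomial_in_forms) auto
  moreover have "cf (h1 - w' * h2) k (e1 - k) = 0" if k: "k < Suc K" for k
  proof -
    have "h1 - w' * h2 = (h1 - w * h2) - smult [:c:] (varS ^ (e1 - e2 - K) * (varT ^ K * h2))"
      by (simp add: w'_def algebra_simps)
    then have "cf (h1 - w' * h2) k (e1 - k) = cf (h1 - w * h2) k (e1 - k) - c * cf (varS ^ (e1 - e2 - K) * (varT ^ K * h2)) k (e1 - k)"
      by (simp only: coeff_diff) simp
    also have "cf (varS ^ (e1 - e2 - K) * (varT ^ K * h2)) k (e1 - k) = (if k = K then 1 else 0)"
      using k K h(3,4) unfolding cf_varS_power_mult cf_varT_power_mult by auto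
    finally have eq: "cf (h1 - w' * h2) k (e1 - k) = cf (h1 - w * h2) k (e1 - k) - c * (if k = K then 1 else 0)" .
    show ?thesis
    proof (cases "k = K")
      case True
      then show ?thesis unfolding eq by (simp only: c_def simp_thms if_True mult_1_right diff_self)
    next
      case False
      then have "k < K" using k by simp
      from w(2)[OF this] False show ?thesis unfolding eq by simp
    qed
  qed
  ultimately show ?case by blast
qed

locale stratum =
  fixes n d \<alpha>1 \<alpha>2 :: nat and ty :: "'k::field itself"
  assumes inf: "infinite (UNIV :: 'k set)"
    and n: "n \<ge> d + 1" and A: "(\<alpha>1, \<alpha>2) \<in> two_part_partitions (d + 1)"
begin

definition e1 :: nat where "e1 = n + 1 - \<alpha>1"
definition e2 :: nat where "e2 = n + 1 - \<alpha>2"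
definition b1 :: nat where "b1 = \<alpha>1 - 1"
definition b2 :: nat where "b2 = \<alpha>2 - 1"

lemma degrees: "d = b1 + b2 + 1" "b1 + e1 = n" "b2 + e2 = n" "e1 \<le> n" "e2 \<le> n" "n - e1 = b1" "n - e2 = b2"
  "e2 \<le> e1" "1 \<le> e2" "n + 1 < e1 + e2" "b1 + (e1 - e2) = b2"
  using A n by (auto simp: two_part_partitions_def e1_def e2_def b1_def b2_def)

text \<open>Modulo the automorphisms of \<open>R(-e1) \<oplus> R(-e2)\<close>, the generic pair \<open>(h1, h2)\<close> has the coefficient of
  \<open>varT ^ e1\<close> in \<open>h1\<close> and that of \<open>varS ^ e2\<close> in \<open>h2\<close> equal to \<open>1\<close>, no monomial of \<open>h1\<close> divisible by
  \<open>varS ^ e2\<close> and, if \<open>e1 = e2\<close>, no monomial \<open>varT ^ e1\<close> in \<open>h2\<close>. The sets \<open>K1\<close> and \<open>K2\<close> index the free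
  coefficients that remain.\<close>

definition K1 :: "nat set" where "K1 = {e1 - e2 <..< e1}"
definition K2 :: "nat set" where "K2 = (if e1 = e2 then {1..<e2} else {1..e2})"

definition pu :: "(param \<Rightarrow> 'k) \<Rightarrow> nat \<Rightarrow> 'k poly poly" where
  "pu x i = form_of b1 (\<lambda>k. x (0, i, k))"
definition pv :: "(param \<Rightarrow> 'k) \<Rightarrow> nat \<Rightarrow> 'k poly poly" where
  "pv x i = form_of b2 (\<lambda>k. x (1, i, k))"
definition ph1 :: "(param \<Rightarrow> 'k) \<Rightarrow> 'k poly poly" where
  "ph1 x = form_of e1 (\<lambda>k. if k = e1 then 1 else if k \<in> K1 then x (2, 0, k) else 0)"
definition ph2 :: "(param \<Rightarrow> 'k) \<Rightarrow> 'k poly poly" where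
  "ph2 x = form_of e2 (\<lambda>k. if k = 0 then 1 else if k \<in> K2 then x (3, 0, k) else 0)"
definition \<Phi> :: "(param \<Rightarrow> 'k) \<Rightarrow> nat \<Rightarrow> 'k poly poly" where
  "\<Phi> x = mk_tuple d (pu x) (pv x) (ph1 x) (ph2 x)"

text \<open>The first entry is a tag: 0 and 1 for the coefficients of \<open>u i\<close> and
  \<open>v i\<close>, 2 and 3 for the free coefficients of \<open>h1\<close> and \<open>h2\<close>,
  whose middle entry is a placeholder.\<close>

definition params :: "param set" where
  "params = {0} \<times> {..d} \<times> {..b1} \<union> {1} \<times> {..d} \<times> {..b2} \<union> {2} \<times> {0} \<times> K1 \<union> {3} \<times> {0} \<times> K2"

lemma finite_K [simp]: "finite K1" "finite K2"
  by (simp_all add: K1_def K2_def)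

lemma finite_params: "finite params"
  by (simp add: params_def)

text \<open>The coefficients of \<open>u\<close> and \<open>v\<close> number
  \<open>(d + 1)^2\<close>, and \<open>2 * \<alpha>2 = d + 1 + (\<alpha>2 - \<alpha>1)\<close>
  converts the rest. For \<open>\<alpha>1 = \<alpha>2\<close> one more coefficient of
  \<open>h2\<close> is normalised away; without it the count would exceed the formula by one, whence
  the maximum with 0.\<close>

lemma card_params: "int (card params) = int (d^2 + d + 2 * n) - max 0 (int \<alpha>2 - int \<alpha>1 - 1)"
proof -
  have "card params = (d + 1) * (b1 + 1) + (d + 1) * (b2 + 1) + card K1 + card K2"
  proof -
    let ?A = "{0 :: nat} \<times> {..d} \<times> {..b1}" and ?B = "{1 :: nat} \<times> {..d} \<times> {..b2}"
      and ?C = "{2 :: nat} \<times> {0 :: nat} \<times> K1" and ?D = "{3 :: nat} \<times> {0 :: nat} \<times> K2"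
    have "card (?A \<union> ?B \<union> ?C \<union> ?D) = card (?A \<union> ?B \<union> ?C) + card ?D" by (rule card_Un_disjoint) auto
    also have "card (?A \<union> ?B \<union> ?C) = card (?A \<union> ?B) + card ?C" by (rule card_Un_disjoint) auto
    also have "card (?A \<union> ?B) = card ?A + card ?B" by (rule card_Un_disjoint) auto
    finally show ?thesis unfolding params_def by (simp only: card_cartesian_product) simp
  qed
  also have "card K1 = e2 - 1" using degrees by (simp add: K1_def)
  also have "card K2 = (if e1 = e2 then e2 - 1 else e2)" by (simp add: K2_def)
  finally have c: "card params = (d + 1) * (b1 + 1) + (d + 1) * (b2 + 1) + (e2 - 1) + (if e1 = e2 then e2 - 1 else e2)" .
  have "(d + 1) * (b1 + 1) + (d + 1) * (b2 + 1) = (d + 1) * (d + 1)" using degrees(1) by (simp add: algebra_simps)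
  then have "card params = d^2 + 2 * d + 1 + (e2 - 1) + (if e1 = e2 then e2 - 1 else e2)"
    unfolding c by (simp add: power2_eq_square)
  moreover have "\<alpha>1 + \<alpha>2 = d + 1" "1 \<le> \<alpha>1" "\<alpha>1 \<le> \<alpha>2" using A by (auto simp: two_part_partitions_def)
  ultimately show ?thesis using n by (auto simp: e1_def e2_def)
qed

lemma in_forms [simp, intro]: "pu x i \<in> forms b1" "pv x i \<in> forms b2" "ph1 x \<in> forms e1" "ph2 x \<in> forms e2"
  by (simp_all add: pu_def pv_def ph1_def ph2_def)

abbreviation PA :: "(nat \<Rightarrow> 'k poly poly) set" where "PA \<equiv> P_mu_min_part n d (\<alpha>1, \<alpha>2)"

lemma PA_iff: "a \<in> PA \<longleftrightarrow> a \<in> form_tuples n d \<and> lin_indep_tuple d a \<and> rel_prime_tuple d a \<and> split_rep n d e1 e2 a"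
  unfolding P_mu_min_part_iff[OF A n] e1_def e2_def ..

lemma PA_subset: "PA \<subseteq> form_tuples n d"
  using PA_iff by blast

lemma \<Phi>_in_form_tuples: "\<Phi> x \<in> form_tuples n d"
  unfolding \<Phi>_def by (intro mk_tuple_in_form_tuples[of e1 n e2]) (simp_all add: degrees)

lemma \<Phi>_split_rep: "split_rep n d e1 e2 (\<Phi> x)"
  unfolding \<Phi>_def by (intro mk_tuple_split_rep) (simp_all add: degrees)

lemma \<Phi>_split_tuple:
  assumes "\<Phi> x \<in> PA"
  shows "split_tuple n d e1 e2 (\<Phi> x) (ph1 x) (ph2 x) (pu x) (pv x)"
proof
  show "n + 1 - e1 + (n + 1 - e2) = d + 1" using degrees by simp
  show "\<Phi> x i = pu x i * ph1 x + pv x i * ph2 x" if "i \<le> d" for i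
    using that by (simp add: \<Phi>_def mk_tuple_def)
qed (use assms n in \<open>simp_all add: PA_iff degrees(4,6-8)\<close>)

lemma \<Phi>_form_fun:
  assumes R: "fun_ring R" and x: "\<And>p. p \<in> params \<Longrightarrow> (\<lambda>t. x t p) \<in> R" and i: "i \<le> d"
  shows "fun_ring.form_fun R (\<lambda>t. \<Phi> (x t) i)"
proof -
  interpret fun_ring R by (rule R)
  show ?thesis unfolding \<Phi>_def
  proof (rule mk_tuple_form_fun[OF R])
    show "form_fun (\<lambda>t. pu (x t) i)" "form_fun (\<lambda>t. pv (x t) i)" if "i \<le> d" for i
      unfolding pu_def pv_def using that by (auto intro!: form_fun_form_of x simp: params_def)
    show "form_fun (\<lambda>t. ph1 (x t))"
      unfolding ph1_def
    proof (rule form_fun_form_of)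
      fix k show "(\<lambda>t. if k = e1 then 1 else if k \<in> K1 then x t (2, 0, k) else 0) \<in> R"
        using x[of "(2, 0, k)"] by (cases "k = e1"; cases "k \<in> K1") (auto simp: params_def)
    qed
    show "form_fun (\<lambda>t. ph2 (x t))"
      unfolding ph2_def
    proof (rule form_fun_form_of)
      fix k show "(\<lambda>t. if k = 0 then 1 else if k \<in> K2 then x t (3, 0, k) else 0) \<in> R"
        using x[of "(3, 0, k)"] by (cases "k = 0"; cases "k \<in> K2") (auto simp: params_def)
    qed
  qed (rule i)
qed

text \<open>The parameters of the monomial base tuple. Denominators will be required not to vanish
  there, because syzygies of monomials make injectivity easy to check.\<close>

definition x0 :: "param \<Rightarrow> 'k" where
  "x0 = (\<lambda>(t, i, k). if t = 0 then (if k = i then 1 else 0) else if t = 1 then (if i = b1 + 1 + k then 1 else 0) else 0)"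

lemma x0: "ph1 x0 = varT ^ e1" "ph2 x0 = varS ^ e2" "\<Phi> x0 \<in> PA"
proof -
  have "ph1 x0 = form_of e1 (\<lambda>k. if k = e1 then 1 else 0)"
    unfolding ph1_def by (intro arg_cong[of _ _ "form_of e1"]) (auto simp: x0_def)
  then show h1: "ph1 x0 = varT ^ e1" by (simp add: form_of_delta)
  have "ph2 x0 = form_of e2 (\<lambda>k. if k = 0 then 1 else 0)"
    unfolding ph2_def by (intro arg_cong[of _ _ "form_of e2"]) (auto simp: x0_def)
  then show h2: "ph2 x0 = varS ^ e2" by (simp add: form_of_delta)
  have u: "pu x0 i = base_u b1 i" for i
    unfolding pu_def base_u_def x0_def by (simp add: form_of_delta)
  have v: "pv x0 i = base_v d b1 i" if i: "i \<le> d" for i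
  proof (cases "i \<le> b1")
    case True
    then have "pv x0 i = form_of b2 (\<lambda>_. 0)" unfolding pv_def x0_def by (intro arg_cong[of _ _ "form_of b2"]) auto
    then show ?thesis using True by (simp add: base_v_def form_of_def)
  next
    case False
    then have "pv x0 i = form_of b2 (\<lambda>k. if k = i - b1 - 1 then 1 else 0)"
      unfolding pv_def x0_def by (intro arg_cong[of _ _ "form_of b2"]) auto
    moreover have "i - b1 - 1 \<le> b2" "b2 - (i - b1 - 1) = d - i" using i False degrees(1) by auto
    ultimately show ?thesis using False by (simp add: form_of_delta base_v_def)
  qed
  have "\<Phi> x0 = mk_tuple d (base_u b1) (base_v d b1) (varT ^ e1) (varS ^ e2)"
    unfolding \<Phi>_def h1 h2 by (intro mk_tuple_cong) (simp add: u v)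
  then show "\<Phi> x0 \<in> PA" using base_tuple(1)[OF A n] unfolding b1_def e1_def e2_def by simp
qed

subsection \<open>Upper bound\<close>

text \<open>Allows a coefficient of \<open>h1\<close> or \<open>h2\<close> to be assumed nonzero:
  where it vanishes, a line through the pair leaves that locus.\<close>

lemma line_vanishing:
  assumes f: "f \<in> polynomial_functions n d"
    and 0: "\<And>t. t \<noteq> 0 \<Longrightarrow> f (mk_tuple d u v (h1 + smult [:t:] g1) (h2 + smult [:t:] g2)) = 0"
  shows "f (mk_tuple d u v h1 h2) = (0 :: 'k)"
proof -
  interpret fun_ring "range (poly :: 'k poly \<Rightarrow> 'k \<Rightarrow> 'k)" by (rule fun_ring_poly)
  have "(\<lambda>t. f (mk_tuple d u v (h1 + smult [:t:] g1) (h2 + smult [:t:] g2))) \<in> range poly"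
    by (intro polynomial_function_form_fun[OF fun_ring_poly f] mk_tuple_form_fun fun_ring_poly
        form_fun_const form_fun_add form_fun_smult id_in_range_poly)
  from poly_fun_eq_0[OF this inf, of "{0}" 0] 0 show ?thesis by simp
qed

lemma \<Phi>_dense_normal:
  assumes f: "\<And>x. f (\<Phi> x) = (0 :: 'k)"
    and uv: "\<And>i. i \<le> d \<Longrightarrow> u i \<in> forms b1" "\<And>i. i \<le> d \<Longrightarrow> v i \<in> forms b2"
    and h1: "h1 \<in> forms e1" "cf h1 e1 0 = 1" "\<And>k. k \<le> e1 - e2 \<Longrightarrow> cf h1 k (e1 - k) = 0"
    and h2: "h2 \<in> forms e2" "cf h2 0 e2 = 1" "e1 = e2 \<Longrightarrow> cf h2 e2 0 = 0"
  shows "f (mk_tuple d u v h1 h2) = 0"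
proof -
  define x :: "param \<Rightarrow> 'k" where "x = (\<lambda>(t, i, k). if t = 0 then cf (u i) k (b1 - k) else if t = 1 then cf (v i) k (b2 - k)
    else if t = 2 then cf h1 k (e1 - k) else cf h2 k (e2 - k))"
  have u: "pu x i = u i" and v: "pv x i = v i" if "i \<le> d" for i
    using form_of_cf[OF uv(1)[OF that]] form_of_cf[OF uv(2)[OF that]] by (simp_all add: pu_def pv_def x_def)
  have "ph1 x = h1"
  proof (rule forms_eqI[OF _ h1(1)])
    fix k assume k: "k \<le> e1"
    then have "k = e1 \<or> k \<in> K1 \<or> (k \<notin> K1 \<and> k \<le> e1 - e2)" by (auto simp: K1_def)
    then show "cf (ph1 x) k (e1 - k) = cf h1 k (e1 - k)"
      using k h1 degrees(8,9) by (auto simp: ph1_def cf_form_of x_def)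
  qed simp
  moreover have "ph2 x = h2"
  proof (rule forms_eqI[OF _ h2(1)])
    fix k assume k: "k \<le> e2"
    then have "k = 0 \<or> k \<in> K2 \<or> (k \<notin> K2 \<and> k = e2 \<and> e1 = e2)" by (auto simp: K2_def)
    then show "cf (ph2 x) k (e2 - k) = cf h2 k (e2 - k)"
      using k h2 degrees(8,9) by (auto simp: ph2_def cf_form_of x_def)
  qed simp
  ultimately have "mk_tuple d u v h1 h2 = \<Phi> x"
    unfolding \<Phi>_def by (intro mk_tuple_cong) (simp add: u v)
  then show ?thesis using f by simp
qed

text \<open>The numbered claims drop the normalising conditions one by one. Scaling and division
  change \<open>(h1, h2)\<close> by an automorphism that \<open>u\<close> and \<open>v\<close>
  compensate, so the tuple stays the same; conditions that a coefficient be nonzero are dropped by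
  \<open>line_vanishing\<close>.\<close>

lemma \<Phi>_dense:
  assumes f: "f \<in> polynomial_functions n d" "\<And>x. f (\<Phi> x) = (0 :: 'k)" and a: "a \<in> PA"
  shows "f a = 0"
proof -
  have smult_cancel: "smult [:c:] p * smult [:1 / c:] q = p * q" if "c \<noteq> 0" for c and p q :: "'k poly poly"
  proof -
    have "smult [:c:] p * smult [:1 / c:] q = smult [:c * (1 / c):] (p * q)" by simp
    also have "\<dots> = p * q" using that by (simp add: pCons_one)
    finally show ?thesis .
  qed
  have 1: "f (mk_tuple d u v h1 h2) = 0"
    if uv: "\<And>i. i \<le> d \<Longrightarrow> u i \<in> forms b1" "\<And>i. i \<le> d \<Longrightarrow> v i \<in> forms b2"
      and h1: "h1 \<in> forms e1" "\<And>k. k \<le> e1 - e2 \<Longrightarrow> cf h1 k (e1 - k) = 0" "cf h1 e1 0 \<noteq> 0"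
      and h2: "h2 \<in> forms e2" "cf h2 0 e2 = 1" for u v h1 h2
  proof -
    define c where "c = cf h1 e1 0"
    define g where "g = smult [:1 / c:] h1"
    \<comment> \<open>Only for \<open>e1 = e2\<close> can a constant multiple of \<open>g\<close> be
      subtracted from \<open>h2\<close>; it removes \<open>varT ^ e2\<close>. The coefficient of
      \<open>varS ^ e2\<close> is unaffected, as \<open>g\<close> lacks that monomial.\<close>
    define b where "b = (if e1 = e2 then cf h2 e2 0 else 0)"
    have c: "c \<noteq> 0" using h1(3) by (simp add: c_def)
    have g: "g \<in> forms e1" "cf g e1 0 = 1" "\<And>k. k \<le> e1 - e2 \<Longrightarrow> cf g k (e1 - k) = 0"
      using h1 c by (simp_all add: g_def c_def smult_in_forms)
    have bg: "smult [:b:] g \<in> forms e2" using g(1) by (auto simp: b_def)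
    have "f (mk_tuple d u v h1 h2) = f (mk_tuple d (\<lambda>i. smult [:c:] (u i) + smult [:b:] (v i)) v g (h2 - smult [:b:] g))"
      by (intro arg_cong[of _ _ f] mk_tuple_cong) (use smult_cancel[OF c] in \<open>simp add: g_def algebra_simps\<close>)
    also have "\<dots> = 0"
    proof (rule \<Phi>_dense_normal[of f, OF f(2)])
      show "smult [:c:] (u i) + smult [:b:] (v i) \<in> forms b1" if "i \<le> d" for i
        using uv[OF that] degrees(11) by (cases "e1 = e2") (auto simp: b_def)
      show "h2 - smult [:b:] g \<in> forms e2" using h2(1) bg by (rule diff_in_forms)
      show "cf (h2 - smult [:b:] g) 0 e2 = 1" using h2(2) g(3)[of 0] by (auto simp: b_def)
      show "cf (h2 - smult [:b:] g) e2 0 = 0" if "e1 = e2" using that g(2) by (simp add: b_def)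
    qed (use uv g in auto)
    finally show ?thesis .
  qed
  have 2: "f (mk_tuple d u v h1 h2) = 0"
    if uv: "\<And>i. i \<le> d \<Longrightarrow> u i \<in> forms b1" "\<And>i. i \<le> d \<Longrightarrow> v i \<in> forms b2"
      and h1: "h1 \<in> forms e1" "\<And>k. k \<le> e1 - e2 \<Longrightarrow> cf h1 k (e1 - k) = 0"
      and h2: "h2 \<in> forms e2" "cf h2 0 e2 = 1" for u v h1 h2
  proof (cases "cf h1 e1 0 = 0")
    case True
    have Te: "cf (varT ^ e1 :: 'k poly poly) k j = (if k = e1 \<and> j = 0 then 1 else 0)" for k j
      using cf_monomial[of 0 e1 k j, where 'a = 'k] by simp
    show ?thesis
    proof (rule line_vanishing[OF f(1), of u v h1 "varT ^ e1" h2 0])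
      fix t :: 'k assume "t \<noteq> 0"
      then show "f (mk_tuple d u v (h1 + smult [:t:] (varT ^ e1)) (h2 + smult [:t:] 0)) = 0"
        using uv h1 h2 True degrees(8,9) by (intro 1) (auto simp: Te)
    qed
  qed (use that in \<open>auto intro: 1\<close>)
  have 3: "f (mk_tuple d u v h1 h2) = 0"
    if uv: "\<And>i. i \<le> d \<Longrightarrow> u i \<in> forms b1" "\<And>i. i \<le> d \<Longrightarrow> v i \<in> forms b2"
      and h: "h1 \<in> forms e1" "h2 \<in> forms e2" "cf h2 0 e2 = 1" for u v h1 h2
  proof -
    obtain w where w: "w \<in> forms (e1 - e2)" "\<And>k. k < e1 - e2 + 1 \<Longrightarrow> cf (h1 - w * h2) k (e1 - k) = 0"
      using form_division[OF h(1,2) degrees(8) h(3) order_refl] by blast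
    have "f (mk_tuple d u v h1 h2) = f (mk_tuple d u (\<lambda>i. v i + u i * w) (h1 - w * h2) h2)"
      by (intro arg_cong[of _ _ f] mk_tuple_cong) (simp add: algebra_simps)
    also have "\<dots> = 0"
    proof (rule 2)
      show "v i + u i * w \<in> forms b2" if "i \<le> d" for i
        using uv[OF that] w(1) degrees(11) by (intro add_in_forms mult_in_forms'[of _ b1 _ "e1 - e2"]) auto
      show "h1 - w * h2 \<in> forms e1"
        using h w(1) degrees(8) by (intro diff_in_forms mult_in_forms'[of _ "e1 - e2" _ e2]) auto
      show "cf (h1 - w * h2) k (e1 - k) = 0" if "k \<le> e1 - e2" for k
        using w(2)[of k] that by simp
    qed (use uv h in auto)
    finally show ?thesis .
  qed
  have 4: "f (mk_tuple d u v h1 h2) = 0"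
    if uv: "\<And>i. i \<le> d \<Longrightarrow> u i \<in> forms b1" "\<And>i. i \<le> d \<Longrightarrow> v i \<in> forms b2"
      and h: "h1 \<in> forms e1" "h2 \<in> forms e2" "cf h2 0 e2 \<noteq> 0" for u v h1 h2
  proof -
    have "f (mk_tuple d u v h1 h2) = f (mk_tuple d u (\<lambda>i. smult [:cf h2 0 e2:] (v i)) h1 (smult [:1 / cf h2 0 e2:] h2))"
      by (intro arg_cong[of _ _ f] mk_tuple_cong) (simp only: smult_cancel[OF h(3)])
    also have "\<dots> = 0"
      by (rule 3) (use uv h in \<open>auto simp: smult_in_forms\<close>)
    finally show ?thesis .
  qed
  have 5: "f (mk_tuple d u v h1 h2) = 0"
    if uv: "\<And>i. i \<le> d \<Longrightarrow> u i \<in> forms b1" "\<And>i. i \<le> d \<Longrightarrow> v i \<in> forms b2"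
      and h: "h1 \<in> forms e1" "h2 \<in> forms e2" for u v h1 h2
  proof (cases "cf h2 0 e2 = 0")
    case True
    have Se: "cf (varS ^ e2 :: 'k poly poly) 0 e2 = 1"
      using cf_monomial[of e2 0 0 e2, where 'a = 'k] by simp
    show ?thesis
    proof (rule line_vanishing[OF f(1), of u v h1 0 h2 "varS ^ e2"])
      fix t :: 'k assume "t \<noteq> 0"
      then show "f (mk_tuple d u v (h1 + smult [:t:] 0) (h2 + smult [:t:] (varS ^ e2))) = 0"
        using uv h True by (intro 4) (auto simp: Se)
    qed
  qed (use that in \<open>auto intro: 4\<close>)
  have "split_rep n d e1 e2 a" "a \<in> form_tuples n d" using a PA_iff by blast+
  then obtain h1 h2 u v where "h1 \<in> forms e1" "h2 \<in> forms e2"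
    "\<And>i. i \<le> d \<Longrightarrow> u i \<in> forms (n - e1)" "\<And>i. i \<le> d \<Longrightarrow> v i \<in> forms (n - e2)"
    "a = mk_tuple d u v h1 h2" by (rule split_rep_eq_mk_tuple) blast
  then show ?thesis using 5 by (simp only: degrees(6,7))
qed

lemma chain_bound:
  fixes Z :: "nat \<Rightarrow> (nat \<Rightarrow> 'k poly poly) set"
  assumes cl: "\<And>i. i \<le> m \<Longrightarrow> closedin (subtopology (zariski n d) PA) (Z i)"
    and irr: "\<And>i. i \<le> m \<Longrightarrow> irreducible_space (subtopology (zariski n d) (Z i))"
    and less: "\<And>i. i < m \<Longrightarrow> Z i \<subset> Z (Suc i)"
  shows "m \<le> card params"
proof (rule chain_length_le[OF fun_ring_polynomial_functions[of n d] finite_params, where \<Phi> = \<Phi> and Z = Z and m = m])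
  have ZA: "Z i \<subseteq> PA" if "i \<le> m" for i
    using closedin_subset[OF cl[OF that]] by (simp add: topspace_subtopology)
  have Zf: "Z i \<subseteq> form_tuples n d" if "i \<le> m" for i using ZA[OF that] PA_subset by blast
  show "(\<lambda>x. f (\<Phi> x)) \<in> (\<Union>K. poly_box params K)" if "f \<in> polynomial_functions n d" for f :: "(nat \<Rightarrow> 'k poly poly) \<Rightarrow> 'k"
    by (rule polynomial_function_form_fun[OF fun_ring_poly_box[OF finite_params] that
        \<Phi>_form_fun[OF fun_ring_poly_box[OF finite_params] coord_in_poly_box[OF finite_params]]])
  show "\<forall>z\<in>Z m. f z = 0" if "f \<in> polynomial_functions n d" "\<And>x. f (\<Phi> x) = 0" for f :: "(nat \<Rightarrow> 'k poly poly) \<Rightarrow> 'k"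
    using \<Phi>_dense[OF that] ZA[OF order_refl] by blast
  show "Z i \<noteq> {}" if "i \<le> m" for i
    using irr[OF that] unfolding irreducible_space_zariski_iff[OF Zf[OF that]] by blast
  show "(\<forall>z\<in>Z i. f z = 0) \<or> (\<forall>z\<in>Z i. g z = 0)"
    if "i \<le> m" "f \<in> polynomial_functions n d" "g \<in> polynomial_functions n d" "\<forall>z\<in>Z i. f z * g z = 0"
    for i and f g :: "(nat \<Rightarrow> 'k poly poly) \<Rightarrow> 'k"
    using irr[OF that(1)] that(2-4) unfolding irreducible_space_zariski_iff[OF Zf[OF that(1)]] by blast
  show "Z i \<subseteq> Z (Suc i)" if "i < m" for i using less[OF that] by blast
  show "\<exists>f\<in>polynomial_functions n d. (\<forall>z\<in>Z i. f z = (0 :: 'k)) \<and> (\<exists>z\<in>Z (Suc i). f z \<noteq> 0)" if i: "i < m" for i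
  proof -
    obtain z where z: "z \<in> Z (Suc i)" "z \<notin> Z i" using less[OF i] by blast
    have "closedin (subtopology (zariski n d) PA) (Z i)" using cl i by simp
    then obtain F where F: "F \<subseteq> polynomial_functions n d" "Z i = {a \<in> PA. \<forall>f\<in>F. f a = 0}"
      unfolding closedin_subtopology_zariski[OF PA_subset] by (elim exE conjE)
    have "z \<in> PA" using z(1) ZA[of "Suc i"] i by auto
    then obtain f where "f \<in> F" "f z \<noteq> 0" using z(2) unfolding F(2) by blast
    moreover have "\<forall>z\<in>Z i. f z = 0" using \<open>f \<in> F\<close> unfolding F(2) by blast
    ultimately show ?thesis using F(1) z(1) by blast
  qed
qed

subsection \<open>Lower bound\<close>

text \<open>Functions of the parameters that, over the stratum, are quotients of polynomial
  functions of the tuple with a denominator nonzero at the base tuple. They play the role of a local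
  ring, so linear systems injective at \<open>x0\<close> can be solved in them.\<close>

definition rat_fun :: "((param \<Rightarrow> 'k) \<Rightarrow> 'k) set" where
  "rat_fun = {y. \<exists>p\<in>polynomial_functions n d. \<exists>q\<in>polynomial_functions n d. q (\<Phi> x0) \<noteq> 0 \<and>
     (\<forall>x. \<Phi> x \<in> PA \<longrightarrow> p (\<Phi> x) = q (\<Phi> x) * y x)}"

lemma rat_funI:
  assumes "p \<in> polynomial_functions n d" "q \<in> polynomial_functions n d" "q (\<Phi> x0) \<noteq> 0"
    "\<And>x. \<Phi> x \<in> PA \<Longrightarrow> p (\<Phi> x) = q (\<Phi> x) * y x"
  shows "y \<in> rat_fun"
  using assms unfolding rat_fun_def by blast

lemma rat_funE:
  assumes "y \<in> rat_fun"
  obtains p q where "p \<in> polynomial_functions n d" "q \<in> polynomial_functions n d" "q (\<Phi> x0) \<noteq> 0"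
    "\<And>x. \<Phi> x \<in> PA \<Longrightarrow> p (\<Phi> x) = q (\<Phi> x) * y x"
  using assms unfolding rat_fun_def by blast

lemma fun_ring_rat_fun: "fun_ring rat_fun"
proof
  interpret fun_ring "polynomial_functions n d :: ((nat \<Rightarrow> 'k poly poly) \<Rightarrow> 'k) set"
    by (rule fun_ring_polynomial_functions)
  show "(\<lambda>_. c) \<in> rat_fun" for c by (rule rat_funI[of "\<lambda>_. c" "\<lambda>_. 1"]) auto
  fix y z assume "y \<in> rat_fun" "z \<in> rat_fun"
  then obtain p q r s where pq: "p \<in> polynomial_functions n d" "q \<in> polynomial_functions n d" "q (\<Phi> x0) \<noteq> 0"
    "\<And>x. \<Phi> x \<in> PA \<Longrightarrow> p (\<Phi> x) = q (\<Phi> x) * y x"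
    and rs: "r \<in> polynomial_functions n d" "s \<in> polynomial_functions n d" "s (\<Phi> x0) \<noteq> 0"
    "\<And>x. \<Phi> x \<in> PA \<Longrightarrow> r (\<Phi> x) = s (\<Phi> x) * z x"
    by (metis rat_funE)
  show "(\<lambda>x. y x + z x) \<in> rat_fun"
    by (rule rat_funI[of "\<lambda>a. p a * s a + r a * q a" "\<lambda>a. q a * s a"]) (use pq rs in \<open>auto simp: algebra_simps\<close>)
  show "(\<lambda>x. y x * z x) \<in> rat_fun"
    by (rule rat_funI[of "\<lambda>a. p a * r a" "\<lambda>a. q a * s a"]) (use pq rs in \<open>auto simp: algebra_simps\<close>)
qed

lemma rat_fun_divide:
  assumes f: "f \<in> rat_fun" "f x0 \<noteq> 0" and g: "g \<in> rat_fun" and y: "\<And>x. \<Phi> x \<in> PA \<Longrightarrow> f x * y x = g x"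
  shows "y \<in> rat_fun"
proof -
  interpret fun_ring "polynomial_functions n d :: ((nat \<Rightarrow> 'k poly poly) \<Rightarrow> 'k) set"
    by (rule fun_ring_polynomial_functions)
  obtain p q where pq: "p \<in> polynomial_functions n d" "q \<in> polynomial_functions n d" "q (\<Phi> x0) \<noteq> 0"
    "\<And>x. \<Phi> x \<in> PA \<Longrightarrow> p (\<Phi> x) = q (\<Phi> x) * f x" by (rule rat_funE[OF f(1)]) blast
  obtain r s where rs: "r \<in> polynomial_functions n d" "s \<in> polynomial_functions n d" "s (\<Phi> x0) \<noteq> 0"
    "\<And>x. \<Phi> x \<in> PA \<Longrightarrow> r (\<Phi> x) = s (\<Phi> x) * g x" by (rule rat_funE[OF g]) blast
  show ?thesis
  proof (rule rat_funI[of "\<lambda>a. r a * q a" "\<lambda>a. p a * s a"])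
    show "p (\<Phi> x0) * s (\<Phi> x0) \<noteq> 0" using pq(3,4) rs(3) f(2) x0(3) by simp
    fix x assume x: "\<Phi> x \<in> PA"
    have "r (\<Phi> x) * q (\<Phi> x) = s (\<Phi> x) * q (\<Phi> x) * g x" using rs(4)[OF x] by simp
    also have "\<dots> = s (\<Phi> x) * q (\<Phi> x) * (f x * y x)" using y[OF x] by simp
    also have "\<dots> = p (\<Phi> x) * s (\<Phi> x) * y x" using pq(4)[OF x] by simp
    finally show "r (\<Phi> x) * q (\<Phi> x) = p (\<Phi> x) * s (\<Phi> x) * y x" .
  qed (use pq rs in auto)
qed

lemma rat_fun_tuple_coeff:
  assumes "l \<le> d" "c \<le> n"
  shows "(\<lambda>x. cf (\<Phi> x l) c (n - c)) \<in> rat_fun"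
  by (rule rat_funI[of "\<lambda>a. cf (a l) c (n - c)" "\<lambda>_. 1"])
    (use assms in \<open>auto intro: polynomial_functions.coord polynomial_functions.const\<close>)

lemma gen2_base_coeff:
  fixes h :: "'k poly poly"
  assumes "h \<in> gen2 (varT ^ e1) (varS ^ e2) m" "k < e1" "m - k < e2"
  shows "cf h k (m - k) = 0"
proof -
  obtain u v where "h = varT ^ e1 * u + varS ^ e2 * v"
    using assms(1) by (auto simp: gen2_def mult.commute)
  then show ?thesis using assms(2,3) by (simp add: cf_varT_power_mult cf_varS_power_mult)
qed

text \<open>\<open>G\<close> is the fixed part of a normalised form and \<open>K\<close> the
  exponents of its unknown coefficients. At \<open>x0\<close> a solution of the homogeneous system
  lies in the ideal of \<open>varT ^ e1\<close> and \<open>varS ^ e2\<close> by descent, but is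
  supported on monomials outside it.\<close>

lemma rat_fun_colon_coeff:
  fixes y :: "nat \<Rightarrow> (param \<Rightarrow> 'k) \<Rightarrow> 'k" and G :: "'k poly poly"
  assumes be: "b + e = n" and K: "K \<subseteq> {..e}" "\<And>k. k \<in> K \<Longrightarrow> k < e1 \<and> e - k < e2"
    and G: "G \<in> forms e"
    and H: "\<And>x q. \<Phi> x \<in> PA \<Longrightarrow> q \<le> b \<Longrightarrow> varS ^ (b - q) * varT ^ q *
       (G + (\<Sum>k\<in>K. smult [:y k x:] (varS ^ (e - k) * varT ^ k))) \<in> tuple_span d (\<Phi> x)"
    and k: "k \<in> K"
  shows "y k \<in> rat_fun"
proof -
  interpret fun_ring rat_fun by (rule fun_ring_rat_fun)
  interpret s: split_tuple n d e1 e2 "\<Phi> x0" "ph1 x0" "ph2 x0" "pu x0" "pv x0" by (rule \<Phi>_split_tuple[OF x0(3)])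
  have finK: "finite K" using K(1) by (rule finite_subset) simp
  let ?I = "K <+> ({..b} \<times> {..d})" and ?X = "{x. \<Phi> x \<in> PA}"
  let ?H = "\<lambda>x. G + (\<Sum>k\<in>K. smult [:y k x:] (varS ^ (e - k) * varT ^ k))"
  have "\<forall>x\<in>?X. \<exists>c. \<forall>q\<le>b. varS ^ (b - q) * varT ^ q * ?H x = (\<Sum>l\<le>d. smult [:c q l:] (\<Phi> x l))"
  proof
    fix x assume x: "x \<in> ?X"
    have "\<forall>q\<in>{..b}. \<exists>c. varS ^ (b - q) * varT ^ q * ?H x = (\<Sum>l\<le>d. smult [:c l:] (\<Phi> x l))"
    proof
      fix q assume "q \<in> {..b}"
      then have "varS ^ (b - q) * varT ^ q * ?H x \<in> tuple_span d (\<Phi> x)" using H x by simp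
      then show "\<exists>c. varS ^ (b - q) * varT ^ q * ?H x = (\<Sum>l\<le>d. smult [:c l:] (\<Phi> x l))"
        unfolding tuple_span_def by (elim imageE) (rule exI)
    qed
    from bchoice[OF this] obtain c where
      "\<forall>q\<in>{..b}. varS ^ (b - q) * varT ^ q * ?H x = (\<Sum>l\<le>d. smult [:c q l:] (\<Phi> x l))" by (elim exE)
    then show "\<exists>c. \<forall>q\<le>b. varS ^ (b - q) * varT ^ q * ?H x = (\<Sum>l\<le>d. smult [:c q l:] (\<Phi> x l))"
      by (intro exI[of _ c]) simp
  qed
  from bchoice[OF this] obtain c where
    c: "\<And>x q. \<Phi> x \<in> PA \<Longrightarrow> q \<le> b \<Longrightarrow> varS ^ (b - q) * varT ^ q * ?H x = (\<Sum>l\<le>d. smult [:c x q l:] (\<Phi> x l))"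
    by auto
  define Y where "Y = (\<lambda>i x. case i of Inl k \<Rightarrow> y k x | Inr ql \<Rightarrow> c x (fst ql) (snd ql))"
  define C where "C = (\<lambda>(x :: param \<Rightarrow> 'k) q. - (varS ^ (b - q) * varT ^ q * G))"
  obtain f g where f: "f \<in> rat_fun" "f x0 \<noteq> 0" and g: "\<And>i. i \<in> ?I \<Longrightarrow> g i \<in> rat_fun"
    and fg: "\<And>i x. i \<in> ?I \<Longrightarrow> x \<in> ?X \<Longrightarrow> f x * Y i x = g i x"
  proof (rule form_system_solution[of ?I "{..b}" "colon_system b e \<Phi>" x0 "\<lambda>_. n" C ?X Y], goal_cases)
    case 1 show ?case using finK by simp
  next
    case 2 show ?case by simp
  next
    case (3 i q)
    show ?case by (rule colon_system_in_forms[OF 3(2) _ K(1) be]) (use 3 \<Phi>_in_form_tuples in auto)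
  next
    case (4 i q a)
    show ?case by (rule colon_system_coeffs[OF 4(2) 4(4)]) (rule rat_fun_tuple_coeff)
  next
    case (5 z)
    show ?case
    proof (rule colon_system_injective[OF K(1) s.ind _ 5(2)])
      fix h assume h: "h \<in> forms e" "\<And>k. k \<notin> K \<Longrightarrow> cf h k (e - k) = 0"
        "\<And>q. q \<le> b \<Longrightarrow> varS ^ (b - q) * varT ^ q * h \<in> tuple_span d (\<Phi> x0)"
      have "h \<in> gen2 (ph1 x0) (ph2 x0) e"
      proof (rule gen2_descend_many[OF s.coprime s.nonzero s.h _ h(1)])
        show "e + b + 1 < e1 + e2" using degrees(10) be by simp
        fix p q assume "p + q = b"
        then have "p = b - q" "q \<le> b" by auto
        then show "varS ^ p * varT ^ q * h \<in> gen2 (ph1 x0) (ph2 x0) (e + b)"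
          using h(3)[of q] be unfolding s.tuple_span by (simp add: add.commute)
      qed
      then have h': "h \<in> gen2 (varT ^ e1) (varS ^ e2) e" unfolding x0 .
      show "h = 0"
      proof (rule forms_eqI[OF h(1) zero_in_forms])
        fix k show "cf h k (e - k) = cf 0 k (e - k)"
          using gen2_base_coeff[OF h', of k] K(2) h(2) by (cases "k \<in> K") auto
      qed
    qed
  next
    case (6 q a)
    show ?case unfolding C_def by (rule const)
  next
    case (7 x q)
    then have q: "q \<le> b" and x: "\<Phi> x \<in> PA" by auto
    have "(\<Sum>i\<in>?I. smult [:Y i x:] (colon_system b e \<Phi> i x q)) =
      varS ^ (b - q) * varT ^ q * (\<Sum>k\<in>K. smult [:y k x:] (varS ^ (e - k) * varT ^ k)) - varS ^ (b - q) * varT ^ q * ?H x"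
      unfolding colon_system_sum[OF q finK] c[OF x q] by (simp add: Y_def)
    then show ?case by (simp add: C_def distrib_left)
  next
    case (8 f g)
    then show ?case by blast
  qed
  have "Inl k \<in> ?I" using k by blast
  then show ?thesis
    using fg[of "Inl k"] by (intro rat_fun_divide[OF f g]) (auto simp: Y_def)
qed

lemma form_of_split_coeff:
  assumes "finite K" "K \<subseteq> {..e}" "k0 \<notin> K" "k0 \<le> e"
  shows "form_of e (\<lambda>k. if k = k0 then 1 else if k \<in> K then z k else (0 :: 'k)) =
    varS ^ (e - k0) * varT ^ k0 + (\<Sum>k\<in>K. smult [:z k:] (varS ^ (e - k) * varT ^ k))"
proof -
  have "(\<Sum>k\<in>K. smult [:z k:] (varS ^ (e - k) * varT ^ k)) = (\<Sum>k\<le>e. smult [:if k \<in> K then z k else 0:] (varS ^ (e - k) * varT ^ k))"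
    using assms(1,2) by (intro sum.mono_neutral_cong_left) auto
  moreover have "varS ^ (e - k0) * varT ^ k0 = (\<Sum>k\<le>e. smult [:if k = k0 then (1 :: 'k) else 0:] (varS ^ (e - k) * varT ^ k))"
    unfolding form_of_def[symmetric] form_of_delta using assms(4) by simp
  moreover have "form_of e (\<lambda>k. if k = k0 then 1 else if k \<in> K then z k else 0) =
      (\<Sum>k\<le>e. smult [:if k = k0 then 1 else 0:] (varS ^ (e - k) * varT ^ k) +
        smult [:if k \<in> K then z k else 0:] (varS ^ (e - k) * varT ^ k))"
    unfolding form_of_def using assms(3) by (intro sum.cong) auto
  ultimately show ?thesis by (simp only: sum.distrib)
qed

text \<open>\<open>K1\<close> and \<open>K2\<close> contain only monomials outside the ideal of
  \<open>varT ^ e1\<close> and \<open>varS ^ e2\<close>. For \<open>e1 = e2\<close> this is why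
  \<open>K2\<close> leaves out \<open>e2\<close>.\<close>

lemma rat_fun_h_coeffs: "k \<in> K1 \<Longrightarrow> (\<lambda>x. x (2, 0, k)) \<in> rat_fun" "k \<in> K2 \<Longrightarrow> (\<lambda>x. x (3, 0, k)) \<in> rat_fun"
proof -
  have K1: "K1 \<subseteq> {..e1}" "e1 \<notin> K1" and K2: "K2 \<subseteq> {..e2}" "0 \<notin> K2" by (auto simp: K1_def K2_def split: if_splits)
  have h1: "ph1 x = varT ^ e1 + (\<Sum>k\<in>K1. smult [:x (2, 0, k):] (varS ^ (e1 - k) * varT ^ k))" for x
    unfolding ph1_def form_of_split_coeff[OF finite_K(1) K1 order_refl] by simp
  have h2: "ph2 x = varS ^ e2 + (\<Sum>k\<in>K2. smult [:x (3, 0, k):] (varS ^ (e2 - k) * varT ^ k))" for x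
    unfolding ph2_def form_of_split_coeff[OF finite_K(2) K2 le0] by simp
  show "(\<lambda>x. x (2, 0, k)) \<in> rat_fun" if k: "k \<in> K1"
  proof (rule rat_fun_colon_coeff[OF degrees(2) K1(1) _ varT_power_in_forms _ k])
    show "k < e1 \<and> e1 - k < e2" if "k \<in> K1" for k using that by (auto simp: K1_def)
    fix x q assume x: "\<Phi> x \<in> PA" and q: "q \<le> b1"
    interpret s: split_tuple n d e1 e2 "\<Phi> x" "ph1 x" "ph2 x" "pu x" "pv x" by (rule \<Phi>_split_tuple[OF x])
    have "varS ^ (b1 - q) * varT ^ q \<in> forms (s.b1)" unfolding s.b1_def degrees(6) using q by (intro monomial_in_forms) auto
    then have "varS ^ (b1 - q) * varT ^ q * ph1 x \<in> tuple_span d (\<Phi> x)"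
      unfolding s.tuple_span s.gen2 by (intro CollectI exI[of _ "varS ^ (b1 - q) * varT ^ q"] exI[of _ 0]) simp
    then show "varS ^ (b1 - q) * varT ^ q * (varT ^ e1 + (\<Sum>k\<in>K1. smult [:x (2, 0, k):] (varS ^ (e1 - k) * varT ^ k)))
      \<in> tuple_span d (\<Phi> x)" unfolding h1 .
  qed
  show "(\<lambda>x. x (3, 0, k)) \<in> rat_fun" if k: "k \<in> K2"
  proof (rule rat_fun_colon_coeff[OF degrees(3) K2(1) _ varS_power_in_forms _ k])
    show "k < e1 \<and> e2 - k < e2" if "k \<in> K2" for k
      using that degrees(8,9) by (auto simp: K2_def split: if_splits)
    fix x q assume x: "\<Phi> x \<in> PA" and q: "q \<le> b2"
    interpret s: split_tuple n d e1 e2 "\<Phi> x" "ph1 x" "ph2 x" "pu x" "pv x" by (rule \<Phi>_split_tuple[OF x])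
    have "varS ^ (b2 - q) * varT ^ q \<in> forms (s.b2)" unfolding s.b2_def degrees(7) using q by (intro monomial_in_forms) auto
    then have "varS ^ (b2 - q) * varT ^ q * ph2 x \<in> tuple_span d (\<Phi> x)"
      unfolding s.tuple_span s.gen2 by (intro CollectI exI[of _ 0] exI[of _ "varS ^ (b2 - q) * varT ^ q"]) simp
    then show "varS ^ (b2 - q) * varT ^ q * (varS ^ e2 + (\<Sum>k\<in>K2. smult [:x (3, 0, k):] (varS ^ (e2 - k) * varT ^ k)))
      \<in> tuple_span d (\<Phi> x)" unfolding h2 .
  qed
qed

text \<open>With \<open>h1\<close> and \<open>h2\<close> already rational in the tuple, the equation
  for its member \<open>i\<close> is linear in the coefficients of \<open>u i\<close> and
  \<open>v i\<close>, and injective at \<open>x0\<close> because the sum is direct.\<close>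

lemma rat_fun_uv_coeffs:
  assumes i: "i \<le> d"
  shows "k \<le> b1 \<Longrightarrow> (\<lambda>x. x (0, i, k)) \<in> rat_fun" "k \<le> b2 \<Longrightarrow> (\<lambda>x. x (1, i, k)) \<in> rat_fun"
proof -
  interpret fun_ring rat_fun by (rule fun_ring_rat_fun)
  interpret s: split_tuple n d e1 e2 "\<Phi> x0" "ph1 x0" "ph2 x0" "pu x0" "pv x0" by (rule \<Phi>_split_tuple[OF x0(3)])
  have h1: "form_fun ph1"
    unfolding ph1_def
  proof (rule form_fun_form_of)
    fix k show "(\<lambda>x. if k = e1 then 1 else if k \<in> K1 then x (2, 0, k) else 0) \<in> rat_fun"
      using rat_fun_h_coeffs(1)[of k] by (cases "k = e1"; cases "k \<in> K1") auto
  qed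
  have h2: "form_fun ph2"
    unfolding ph2_def
  proof (rule form_fun_form_of)
    fix k show "(\<lambda>x. if k = 0 then 1 else if k \<in> K2 then x (3, 0, k) else 0) \<in> rat_fun"
      using rat_fun_h_coeffs(2)[of k] by (cases "k = 0"; cases "k \<in> K2") auto
  qed
  let ?I = "{..b1} <+> {..b2}" and ?X = "{x. \<Phi> x \<in> PA}"
  define B :: "nat + nat \<Rightarrow> (param \<Rightarrow> 'k) \<Rightarrow> unit \<Rightarrow> 'k poly poly" where
    "B = (\<lambda>j x _. case j of Inl k \<Rightarrow> varS ^ (b1 - k) * varT ^ k * ph1 x | Inr k \<Rightarrow> varS ^ (b2 - k) * varT ^ k * ph2 x)"
  define Y where "Y = (\<lambda>j (x :: param \<Rightarrow> 'k). case j of Inl k \<Rightarrow> x (0, i, k) | Inr k \<Rightarrow> x (1, i, k))"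
  have sumB: "(\<Sum>j\<in>?I. smult [:z j:] (B j x w)) = form_of b1 (\<lambda>k. z (Inl k)) * ph1 x + form_of b2 (\<lambda>k. z (Inr k)) * ph2 x"
    for z x w by (subst sum.Plus) (simp_all add: B_def form_of_def sum_distrib_right)
  obtain f g where f: "f \<in> rat_fun" "f x0 \<noteq> 0" and g: "\<And>j. j \<in> ?I \<Longrightarrow> g j \<in> rat_fun"
    and fg: "\<And>j x. j \<in> ?I \<Longrightarrow> x \<in> ?X \<Longrightarrow> f x * Y j x = g j x"
  proof (rule form_system_solution[of ?I "{()}" B x0 "\<lambda>_. n" "\<lambda>x _. \<Phi> x i" ?X Y], goal_cases)
    case 1 show ?case by simp
  next
    case 2 show ?case by simp
  next
    case (3 j w)
    have "varS ^ (b1 - k) * varT ^ k * ph1 x0 \<in> forms n" if "k \<le> b1" for k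
      using that degrees(2) by (intro mult_in_forms'[of _ b1 _ e1] monomial_in_forms) auto
    moreover have "varS ^ (b2 - k) * varT ^ k * ph2 x0 \<in> forms n" if "k \<le> b2" for k
      using that degrees(3) by (intro mult_in_forms'[of _ b2 _ e2] monomial_in_forms) auto
    ultimately show ?case using 3(2) by (auto simp: B_def)
  next
    case (4 j w a)
    have "form_fun (\<lambda>x. B j x w)"
      unfolding B_def using h1 h2 by (cases j) (auto intro!: form_fun_mult)
    then show ?case by (rule form_funD)
  next
    case (5 z)
    then have "form_of b1 (\<lambda>k. z (Inl k)) * ph1 x0 + form_of b2 (\<lambda>k. z (Inr k)) * ph2 x0 = 0"
      unfolding sumB by simp
    moreover have "form_of b1 (\<lambda>k. z (Inl k)) \<in> forms s.b1" "form_of b2 (\<lambda>k. z (Inr k)) \<in> forms s.b2"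
      by (simp_all add: s.b1_def s.b2_def degrees(6,7))
    ultimately have z: "form_of b1 (\<lambda>k. z (Inl k)) = 0" "form_of b2 (\<lambda>k. z (Inr k)) = 0"
      using s.unique by blast+
    have "z (Inl k) = 0" if "k \<le> b1" for k
      using arg_cong[OF z(1), of "\<lambda>p. cf p k (b1 - k)"] that by (simp add: cf_form_of)
    moreover have "z (Inr k) = 0" if "k \<le> b2" for k
      using arg_cong[OF z(2), of "\<lambda>p. cf p k (b2 - k)"] that by (simp add: cf_form_of)
    ultimately show ?case by auto
  next
    case (6 w a)
    then show ?case using rat_fun_tuple_coeff[OF i] by blast
  next
    case (7 x w)
    show ?case unfolding sumB using i by (simp add: \<Phi>_def mk_tuple_def pu_def pv_def Y_def)
  next
    case (8 f g)
    then show ?case by blast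
  qed
  show "(\<lambda>x. x (0, i, k)) \<in> rat_fun" if "k \<le> b1"
  proof -
    have I: "Inl k \<in> ?I" using that by blast
    show ?thesis using fg[OF I] by (intro rat_fun_divide[OF f g[OF I]]) (simp add: Y_def)
  qed
  show "(\<lambda>x. x (1, i, k)) \<in> rat_fun" if "k \<le> b2"
  proof -
    have I: "Inr k \<in> ?I" using that by blast
    show ?thesis using fg[OF I] by (intro rat_fun_divide[OF f g[OF I]]) (simp add: Y_def)
  qed
qed

lemma rat_fun_param: "p \<in> params \<Longrightarrow> (\<lambda>x. x p) \<in> rat_fun"
  using rat_fun_h_coeffs rat_fun_uv_coeffs by (auto simp: params_def)

lemma line_in_PA:
  fixes x y :: "param \<Rightarrow> 'k"
  assumes "\<Phi> x \<in> PA"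
  obtains F where "finite F" "\<And>t. t \<notin> F \<Longrightarrow> \<Phi> (\<lambda>p. x p + t * (y p - x p)) \<in> PA"
    and "\<And>f. f \<in> polynomial_functions n d \<Longrightarrow> (\<lambda>t. f (\<Phi> (\<lambda>p. x p + t * (y p - x p)))) \<in> range poly"
proof -
  interpret fun_ring "range (poly :: 'k poly \<Rightarrow> 'k \<Rightarrow> 'k)" by (rule fun_ring_poly)
  let ?\<gamma> = "\<lambda>t. \<Phi> (\<lambda>p. x p + t * (y p - x p))"
  have \<gamma>: "form_fun (\<lambda>t. ?\<gamma> t i)" if "i \<le> d" for i
    by (rule \<Phi>_form_fun[OF fun_ring_poly _ that]) (intro add mult const id_in_range_poly)
  have 0: "?\<gamma> 0 = \<Phi> x" by simp
  have ind: "lin_indep_tuple d (?\<gamma> 0)" "rel_prime_tuple d (?\<gamma> 0)" unfolding 0 using assms PA_iff by blast+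
  have split: "split_rep n d (n + 1 - \<alpha>1) (n + 1 - \<alpha>2) (?\<gamma> t)" for t
    using \<Phi>_split_rep unfolding e1_def e2_def .
  show thesis
  proof (rule curve_in_stratum[OF A n \<gamma> \<Phi>_in_form_tuples ind finite.emptyI split])
    fix F assume F: "finite F" "\<And>t. t \<notin> F \<Longrightarrow> ?\<gamma> t \<in> PA"
    show thesis by (rule that[OF F polynomial_function_form_fun[OF fun_ring_poly _ \<gamma>]])
  qed
qed

text \<open>\<open>L i\<close> frozen at \<open>x0\<close> from the \<open>i\<close>-th parameter on
  is an affine space, so lines show that vanishing on its image \<open>Y i\<close> is a prime
  condition; the closure \<open>Z i\<close> inherits this, since vanishing on it can be tested on
  \<open>Y i\<close>.\<close>

lemma chain_exists:
  "\<exists>Z :: nat \<Rightarrow> (nat \<Rightarrow> 'k poly poly) set.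
     (\<forall>i\<le>card params. closedin (subtopology (zariski n d) PA) (Z i) \<and>
        irreducible_space (subtopology (zariski n d) (Z i))) \<and>
     (\<forall>i<card params. Z i \<subset> Z (Suc i))"
proof -
  let ?D = "card params" and ?R = "polynomial_functions n d :: ((nat \<Rightarrow> 'k poly poly) \<Rightarrow> 'k) set"
  obtain \<tau> where \<tau>: "bij_betw \<tau> {..<?D} params"
    using ex_bij_betw_nat_finite[OF finite_params] by (auto simp: atLeast0LessThan)
  define L where "L = (\<lambda>i. {x :: param \<Rightarrow> 'k. \<forall>j. i \<le> j \<and> j < ?D \<longrightarrow> x (\<tau> j) = x0 (\<tau> j)})"
  define Y where "Y = (\<lambda>i. {\<Phi> x | x. x \<in> L i \<and> \<Phi> x \<in> PA})"
  define Z where "Z = (\<lambda>i. {a \<in> PA. \<forall>f\<in>?R. (\<forall>b\<in>Y i. f b = 0) \<longrightarrow> f a = 0})"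
  have YZ: "Y i \<subseteq> Z i" for i by (auto simp: Y_def Z_def)
  have ZA: "Z i \<subseteq> PA" for i by (auto simp: Z_def)
  have x0L: "x0 \<in> L i" for i by (simp add: L_def)
  have line_L: "(\<lambda>p. x p + t * (y p - x p)) \<in> L i" if "x \<in> L i" "y \<in> L i" for x y t i
    using that by (simp add: L_def)
  have closed: "closedin (subtopology (zariski n d) PA) (Z i)" for i
    unfolding closedin_subtopology_zariski[OF PA_subset] Z_def
    by (intro exI[of _ "{f \<in> ?R. \<forall>b\<in>Y i. f b = 0}"]) auto
  have irr: "irreducible_space (subtopology (zariski n d) (Z i))" for i
    unfolding irreducible_space_zariski_iff[OF subset_trans[OF ZA PA_subset]]
  proof (intro conjI ballI impI)
    have "\<Phi> x0 \<in> Y i" using x0L x0(3) by (auto simp: Y_def)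
    then show "Z i \<noteq> {}" using YZ by blast
    fix f g assume f: "f \<in> ?R" and g: "g \<in> ?R" and fg: "\<forall>a\<in>Z i. f a * g a = 0"
    have "(\<forall>b\<in>Y i. f b = 0) \<or> (\<forall>b\<in>Y i. g b = 0)"
    proof (rule ccontr)
      assume "\<not> ?thesis"
      then obtain a b where ab: "a \<in> Y i" "f a \<noteq> 0" "b \<in> Y i" "g b \<noteq> 0" by auto
      from ab(1) obtain x where x: "x \<in> L i" "\<Phi> x \<in> PA" "f (\<Phi> x) \<noteq> 0"
        unfolding Y_def using ab(2) by (elim CollectE exE conjE) simp
      from ab(3) obtain y where y: "y \<in> L i" "\<Phi> y \<in> PA" "g (\<Phi> y) \<noteq> 0"
        unfolding Y_def using ab(4) by (elim CollectE exE conjE) simp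
      let ?\<gamma> = "\<lambda>t. \<Phi> (\<lambda>p. x p + t * (y p - x p))"
      obtain F where F: "finite F" "\<And>t. t \<notin> F \<Longrightarrow> ?\<gamma> t \<in> PA"
        "\<And>f. f \<in> ?R \<Longrightarrow> (\<lambda>t. f (?\<gamma> t)) \<in> range poly" by (rule line_in_PA[OF x(2), of y]) blast
      have "finite {t. f (?\<gamma> t) = 0}" by (rule poly_fun_cofinite_nonzero[OF F(3)[OF f], of 0]) (use x in simp)
      moreover have "finite {t. g (?\<gamma> t) = 0}" by (rule poly_fun_cofinite_nonzero[OF F(3)[OF g], of 1]) (use y in simp)
      ultimately have "finite (F \<union> {t. f (?\<gamma> t) = 0} \<union> {t. g (?\<gamma> t) = 0})" using F(1) by simp
      from ex_new_if_finite[OF inf this] obtain t where t: "t \<notin> F \<union> {t. f (?\<gamma> t) = 0} \<union> {t. g (?\<gamma> t) = 0}"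
        by (elim exE)
      then have "?\<gamma> t \<in> PA" using F(2) by simp
      then have "?\<gamma> t \<in> Y i" unfolding Y_def
        by (intro CollectI exI[of _ "\<lambda>p. x p + t * (y p - x p)"] conjI line_L[OF x(1) y(1)] refl)
      then have "f (?\<gamma> t) * g (?\<gamma> t) = 0" by (intro bspec[OF fg] subsetD[OF YZ])
      with t show False by simp
    qed
    then show "(\<forall>a\<in>Z i. f a = 0) \<or> (\<forall>a\<in>Z i. g a = 0)"
    proof
      assume "\<forall>b\<in>Y i. f b = 0"
      with f have "\<forall>a\<in>Z i. f a = 0" unfolding Z_def by simp
      then show ?thesis by (rule disjI1)
    next
      assume "\<forall>b\<in>Y i. g b = 0"
      with g have "\<forall>a\<in>Z i. g a = 0" unfolding Z_def by simp
      then show ?thesis by (rule disjI2)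
    qed
  qed
  have strict: "Z i \<subset> Z (Suc i)" if i: "i < ?D" for i
  proof
    have "Y i \<subseteq> Y (Suc i)" by (auto simp: Y_def L_def)
    then show "Z i \<subseteq> Z (Suc i)" unfolding Z_def by blast
    have "\<tau> i \<in> params" using bij_betwE[OF \<tau>] i by simp
    then obtain p q where pq: "p \<in> ?R" "q \<in> ?R" "q (\<Phi> x0) \<noteq> 0"
      "\<And>x. \<Phi> x \<in> PA \<Longrightarrow> p (\<Phi> x) = q (\<Phi> x) * x (\<tau> i)" 
      by (rule rat_funE[OF rat_fun_param]) blast
    \<comment> \<open>On the stratum, \<open>p / q\<close> is the parameter number \<open>i\<close>;
      clearing the denominator in the condition that it keeps its value at \<open>x0\<close> gives
      an equation of \<open>Y i\<close>.\<close>
    define f where "f = (\<lambda>a. p a - x0 (\<tau> i) * q a)"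
    interpret fun_ring ?R by (rule fun_ring_polynomial_functions)
    have f: "f \<in> ?R" unfolding f_def by (intro diff mult const pq(1,2))
    have fY: "f (\<Phi> x) = q (\<Phi> x) * (x (\<tau> i) - x0 (\<tau> i))" if "\<Phi> x \<in> PA" for x
      unfolding f_def pq(4)[OF that] by (simp add: algebra_simps)
    have "f b = 0" if "b \<in> Y i" for b
      using that fY i by (auto simp: Y_def L_def)
    then have "\<forall>b\<in>Y i. f b = 0" by simp
    then have fZ: "f a = 0" if "a \<in> Z i" for a using that f unfolding Z_def by simp
    \<comment> \<open>The line from \<open>x0\<close> towards \<open>y\<close> moves only the newly
      freed parameter. A point with \<open>t\<close> nonzero and \<open>q\<close> nonzero violates
      the equation \<open>f\<close>.\<close>
    define y where "y = x0(\<tau> i := x0 (\<tau> i) + 1)"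
    have inj: "\<tau> j \<noteq> \<tau> i" if "j < ?D" "j \<noteq> i" for j
      using \<tau> that i unfolding bij_betw_def inj_on_def by auto
    have yL: "y \<in> L (Suc i)" unfolding L_def y_def using inj by auto
    let ?x = "\<lambda>t p. x0 p + t * (y p - x0 p)"
    obtain F where F: "finite F" "\<And>t. t \<notin> F \<Longrightarrow> \<Phi> (?x t) \<in> PA"
      "\<And>f. f \<in> ?R \<Longrightarrow> (\<lambda>t. f (\<Phi> (?x t))) \<in> range poly" by (rule line_in_PA[OF x0(3), of y]) blast
    have "finite {t. q (\<Phi> (?x t)) = 0}" by (rule poly_fun_cofinite_nonzero[OF F(3)[OF pq(2)], of 0]) (use pq in simp)
    then have "finite (F \<union> {t. q (\<Phi> (?x t)) = 0} \<union> {0})" using F(1) by simp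
    from ex_new_if_finite[OF inf this] obtain t where t: "t \<notin> F \<union> {t. q (\<Phi> (?x t)) = 0} \<union> {0}" by (elim exE)
    then have PA: "\<Phi> (?x t) \<in> PA" using F(2) by simp
    then have "\<Phi> (?x t) \<in> Y (Suc i)" unfolding Y_def
      by (intro CollectI exI[of _ "?x t"] conjI line_L[OF x0L yL] refl)
    then have "\<Phi> (?x t) \<in> Z (Suc i)" by (rule subsetD[OF YZ])
    moreover have "f (\<Phi> (?x t)) \<noteq> 0" unfolding fY[OF PA] using t by (simp add: y_def)
    ultimately show "Z i \<noteq> Z (Suc i)" using fZ[of "\<Phi> (?x t)"] by auto
  qed
  show ?thesis using closed irr strict by blast
qed

lemma krull_dim_PA: "krull_dim (subtopology (zariski n d) PA) = enat (card params)"
proof -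
  have sub: "subtopology (subtopology (zariski n d) PA) Z = subtopology (zariski n d) Z" if "Z \<subseteq> PA" for Z
    unfolding subtopology_subtopology using that by (simp add: Int_absorb1)
  have subset: "Z \<subseteq> PA" if "closedin (subtopology (zariski n d) PA) Z" for Z
    using closedin_subset[OF that] by (simp add: topspace_subtopology)
  show ?thesis
    unfolding krull_dim_def
  proof (rule antisym)
    show "Sup {enat m | m. \<exists>Z :: nat \<Rightarrow> (nat \<Rightarrow> 'k poly poly) set.
      (\<forall>i\<le>m. closedin (subtopology (zariski n d) PA) (Z i) \<and>
        irreducible_space (subtopology (subtopology (zariski n d) PA) (Z i))) \<and>
      (\<forall>i<m. Z i \<subset> Z (Suc i))} \<le> enat (card params)"
    proof (rule Sup_least, clarify)
      fix m and Z :: "nat \<Rightarrow> (nat \<Rightarrow> 'k poly poly) set"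
      assume Z: "\<forall>i\<le>m. closedin (subtopology (zariski n d) PA) (Z i) \<and>
          irreducible_space (subtopology (subtopology (zariski n d) PA) (Z i))" "\<forall>i<m. Z i \<subset> Z (Suc i)"
      have "m \<le> card params"
      proof (rule chain_bound[of m Z])
        fix i assume i: "i \<le> m"
        show "closedin (subtopology (zariski n d) PA) (Z i)" using Z(1) i by blast
        then show "irreducible_space (subtopology (zariski n d) (Z i))"
          using Z(1) i sub[OF subset] by metis
      qed (use Z(2) in blast)
      then show "enat m \<le> enat (card params)" by simp
    qed
    obtain Z :: "nat \<Rightarrow> (nat \<Rightarrow> 'k poly poly) set" where
      Z: "\<forall>i\<le>card params. closedin (subtopology (zariski n d) PA) (Z i) \<and> irreducible_space (subtopology (zariski n d) (Z i))"
        "\<forall>i<card params. Z i \<subset> Z (Suc i)" using chain_exists by blast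
    have "irreducible_space (subtopology (subtopology (zariski n d) PA) (Z i))" if "i \<le> card params" for i
      using Z(1) that sub[OF subset] by metis
    with Z show "enat (card params) \<le> Sup {enat m | m. \<exists>Z :: nat \<Rightarrow> (nat \<Rightarrow> 'k poly poly) set.
      (\<forall>i\<le>m. closedin (subtopology (zariski n d) PA) (Z i) \<and>
        irreducible_space (subtopology (subtopology (zariski n d) PA) (Z i))) \<and>
      (\<forall>i<m. Z i \<subset> Z (Suc i))}"
      by (intro Sup_upper CollectI exI[of _ "card params"] conjI refl exI[of _ Z]) auto
  qed
qed

end

theorem theorem4p12:
  fixes n d \<alpha>1 \<alpha>2 :: nat
  assumes "infinite (UNIV :: 'k::field set)"
    and "d \<ge> 2" and "n \<ge> d + 1"
    and "(\<alpha>1, \<alpha>2) \<in> two_part_partitions (d + 1)"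
  shows "let X = (zariski_mu_min n d :: (nat \<Rightarrow> 'k poly poly) topology);
             PA = P_mu_min_part n d (\<alpha>1, \<alpha>2)
         in (irreducible_space (subtopology X PA) \<and>
             openin (subtopology X (X closure_of PA)) PA) \<and>
            krull_dim (subtopology X PA) =
              enat (nat (int (d^2 + d + 2 * n) - max 0 (int \<alpha>2 - int \<alpha>1 - 1))) \<and>
            X closure_of PA =
              (\<Union>A' \<in> {A' \<in> two_part_partitions (d + 1). partition_le A' (\<alpha>1, \<alpha>2)}.
                 P_mu_min_part n d A')"
proof -
  interpret stratum n d \<alpha>1 \<alpha>2 "TYPE('k)" by unfold_locales (fact assms)+
  have d: "d \<ge> 1" using assms(2) by simp
  have "subtopology (zariski_mu_min n d) PA = subtopology (zariski n d) PA"
    unfolding zariski_mu_min_def subtopology_subtopology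
    by (intro arg_cong[of _ _ "subtopology (zariski n d)"]) (auto simp: P_mu_min_part_def)
  then show ?thesis
    unfolding Let_def card_params[symmetric] nat_int
    using irreducible_P_mu_min_part[OF assms(1,4,3)] stratum_open_in_closure[OF assms(1) d assms(4,3)]
      closure_of_stratum[OF assms(1) d assms(4,3)] krull_dim_PA by simp
qed

end
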